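(* Let $r_*^{(i)}(n)>-1$ and $R_*^{(i)}(n)>-1$, $n\ge0$, $i\in\{0,1\}$, be nonrandom numbers, let $c_*^{(i)}(n)=-\lambda_n^{(i)}r_*^{(i)}(n)-\mu_n^{(i)}R_*^{(i)}(n)$, and let the measure $\mathbb P_*$ be defined by $\mathbb P_*(A)=\mathbb E[Z(t)\mathbf 1_A]$ for $A\in\mathcal F_t$, $t>0$, where $$Z(t)=\mathrm e^{\mathbb L_*(t)}\prod_{m=1}^{M(t)}\left[\left(1+R_*^{(\varepsilon_{m-1})}(N_{m-1}(T_m))\right)z_{*,m-1}(T_m)\right]\cdot z_{*,M(t)}\left(t-T^{(+,M(t))}\right).$$ Then under $\mathbb P_*$ the underlying state process $\varepsilon$ is governed by independent inter-switching times $T_m$, $m\ge1$, with Poisson-modulated exponential distributions, $T_m\sim\mathrm{PoExp}(\vec\lambda_*^{(\varepsilon_{m-1})},\vec\mu_*^{(\varepsilon_{m-1})})$, with the alternating parameters $$\lambda_{*n}^{(i)}=\lambda_n^{(i)}\left(1+r_*^{(i)}(n)\right),\qquad \mu_{*n}^{(i)}=\mu_n^{(i)}\left(1+R_*^{(i)}(n)\right),\qquad n\ge0,\ i\in\{0,1\}.$$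
   Context: **Distribution.** For sequences of positive numbers $\vec\lambda=\{\lambda_n\}_{n\ge0}$, $\vec\mu=\{\mu_n\}_{n\ge0}$, a random variable $T>0$ has the Poisson-modulated exponential distribution $\mathrm{PoExp}(\vec\lambda,\vec\mu)$ if $\mathbb P\{T>t\}=\mathbb E\exp\left(-\int_0^t\mu_{N(s)}\,\mathrm ds\right)$, where $N$ is the counting process starting at $0$ which stays at $n$ for an $\mathrm{Exp}(\lambda_n)$ time before jumping to $n+1$, the successive holding times being independent. **Setting under $\mathbb P$.** For $i\in\{0,1\}$ let $\{\lambda_n^{(i)}\}_{n\ge0}$, $\{\mu_n^{(i)}\}_{n\ge0}$ be positive with $\sum_n1/\lambda_n^{(i)}=\infty$. Let $\varepsilon_m\in\{0,1\}$, $m\ge0$, be the alternating sequence ($\varepsilon_{m+1}=1-\varepsilon_m$) with given initial value $\varepsilon_0=\varepsilon(0)$. $N_m$, $m\ge0$, are independent counting processes starting at $0$, where $N_m$ stays at $n$ for an $\mathrm{Exp}(\lambda_n^{(\varepsilon_m)})$ time before jumping to $n+1$, the successive holding times being independent. For $m\ge1$, conditionally on $N_{m-1}$, $\mathbb P\{T_m>t\mid N_{m-1}\}=\exp\left(-\int_0^t\mu^{(\varepsilon_{m-1})}_{N_{m-1}(s)}\,\mathrm ds\right)$; the pairs $(N_{m-1},T_m)$, $m\ge1$, are independent. Put $T^{(+,0)}=0$, $T^{(+,m)}=T_1+\dots+T_m$, $M(t)=\max\{m:T^{(+,m)}\le t\}$, and $\varepsilon(t)=\varepsilon_m$ for $T^{(+,m)}\le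 t<T^{(+,m+1)}$. The market process $X=\mathbb L+\mathbb J$ has the piecewise linear part $\mathbb L(t)=\sum_{m=1}^{M(t)}l_{m-1}(T_m)+l_{M(t)}(t-T^{(+,M(t))})$ with $l_m(t)=\int_0^tc^{(\varepsilon_m)}(N_m(s))\,\mathrm ds$ for given real numbers $c^{(i)}(n)$, and the jump part $\mathbb J(t)=\sum_{m=1}^{M(t)}[R_{m-1}(N_{m-1}(T_m))+j_{m-1}(T_m)]+j_{M(t)}(t-T^{(+,M(t))})$ with $j_m(t)=\sum_{n=1}^{N_m(t)}r_m(n-1)$; here $r_m(n),R_m(n)$ are independent random variables with values in $(-1,\infty)$, independent of all $N_m,T_m$, with laws depending only on $n$ and $\varepsilon_m$. The filtration $\mathcal F_t$ is generated up to time $t$ by $X(s)$, $\varepsilon(s)$, $M(s)$ and the current shock count $N_{M(s)}(s-T^{(+,M(s))})$, $s\le t$. **Ingredients of $Z$.** $$l_{*,m}(t)=\int_0^tc_*^{(\varepsilon_m)}(N_m(s))\,\mathrm ds,\qquad \mathbb L_*(t)=\sum_{m=1}^{M(t)}l_{*,m-1}(T_m)+l_{*,M(t)}\left(t-T^{(+,M(t))}\right),$$ $$z_{*,m}(t)=\prod_{n=1}^{N_m(t)}\left(1+r_*^{(\varepsilon_m)}(n-1)\right)\quad(\text{empty product}=1).$$ It is understood that $Z$ is a $\mathbb P$-martingale (with mean $1$), so that $\mathbb P_*$ is a well-defined probability measure, equivalent to $\mathbb P$ on each $\mathcal F_t$. *)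

theory Defs
  imports "HOL-Probability.Probability"
begin

text \<open>
  A counting process is represented by its holding times \<open>h 0, h 1, \<dots>\<close>. The maximum is the intended
  one as long as the jump times do not accumulate before \<open>t\<close>; past an accumulation point the value
  is an unspecified constant.
\<close>
definition counting :: "(nat \<Rightarrow> real) \<Rightarrow> real \<Rightarrow> nat" where
  "counting h t = Max {n. (\<Sum>k<n. h k) \<le> t}"

definition exp_minus :: "ennreal \<Rightarrow> real" where
  "exp_minus x = (if x = \<infinity> then 0 else exp (- enn2real x))"

text \<open>
  The random variable \<open>T\<close> has law \<open>PoExp(lam, mu)\<close>. The expectation on the right-hand side is taken on
  the canonical space of independent exponential holding times. The integral is a nonnegative one, with
  \<open>exp (-\<infinity>) = 0\<close>, because \<open>lam\<close> is not assumed to be non-explosive: \<open>mu\<close> may have infinite integral up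
  to the explosion time.
\<close>
definition has_poexp ::
  "'a measure \<Rightarrow> ('a \<Rightarrow> real) \<Rightarrow> (nat \<Rightarrow> real) \<Rightarrow> (nat \<Rightarrow> real) \<Rightarrow> bool" where
  "has_poexp Q T lam mu \<longleftrightarrow>
     T \<in> borel_measurable Q \<and> (\<forall>\<omega>\<in>space Q. T \<omega> > 0) \<and>
     (\<forall>t\<ge>0. measure Q {\<omega> \<in> space Q. T \<omega> > t} =
        (\<integral>h. exp_minus (\<integral>\<^sup>+s\<in>{0..t}. ennreal (mu (counting h s)) \<partial>lborel)
          \<partial>(\<Pi>\<^sub>M n\<in>UNIV. density lborel (exponential_density (lam n)))))"

text \<open>
  The case \<open>s = t\<close> says that \<open>Z t\<close> is \<open>F t\<close>-measurable up to a \<open>P\<close>-null set; strict adaptedness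
  is not required.
\<close>
definition is_martingale ::
  "'a measure \<Rightarrow> (real \<Rightarrow> 'a measure) \<Rightarrow> (real \<Rightarrow> 'a \<Rightarrow> real) \<Rightarrow> bool" where
  "is_martingale P F Z \<longleftrightarrow>
     (\<forall>t\<ge>0. subalgebra P (F t) \<and> integrable P (Z t)) \<and>
     (\<forall>s t. 0 \<le> s \<and> s \<le> t \<longrightarrow> (AE \<omega> in P. real_cond_exp P (F s) (Z t) \<omega> = Z s \<omega>))"

text \<open>
  The states are \<open>0\<close> and \<open>1\<close>; the first argument of \<open>lam\<close>, \<open>mu\<close> and \<open>c\<close> is the state.
  \<open>H m n\<close> is the holding time of the counting process \<open>N m\<close> at \<open>n\<close>. The inter-switching times
  \<open>T m\<close> are indexed by \<open>m \<ge> 1\<close>; the value \<open>T 0\<close> is irrelevant.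
\<close>
locale market_paths =
  fixes P :: "'a measure"
    and lam mu c :: "nat \<Rightarrow> nat \<Rightarrow> real"
    and e0 :: nat
    and H :: "nat \<Rightarrow> nat \<Rightarrow> 'a \<Rightarrow> real"
    and T :: "nat \<Rightarrow> 'a \<Rightarrow> real"
    and r R :: "nat \<Rightarrow> nat \<Rightarrow> 'a \<Rightarrow> real"
begin

primrec eps :: "nat \<Rightarrow> nat" where
  "eps 0 = e0"
| "eps (Suc m) = 1 - eps m"

definition N :: "nat \<Rightarrow> real \<Rightarrow> 'a \<Rightarrow> nat" where
  "N m t \<omega> = counting (\<lambda>n. H m n \<omega>) t"

definition Tplus :: "nat \<Rightarrow> 'a \<Rightarrow> real" where
  "Tplus m \<omega> = (\<Sum>k=1..m. T k \<omega>)"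

definition M :: "real \<Rightarrow> 'a \<Rightarrow> nat" where
  "M t \<omega> = Max {m. Tplus m \<omega> \<le> t}"

definition state :: "real \<Rightarrow> 'a \<Rightarrow> nat" where
  "state t \<omega> = eps (M t \<omega>)"

definition age :: "real \<Rightarrow> 'a \<Rightarrow> real" where
  "age t \<omega> = t - Tplus (M t \<omega>) \<omega>"

definition shocks :: "real \<Rightarrow> 'a \<Rightarrow> nat" where
  "shocks t \<omega> = N (M t \<omega>) (age t \<omega>) \<omega>"

text \<open>
  The velocities \<open>d\<close> are a parameter: \<open>d = c\<close> gives the linear part of the market process, and
  \<open>d = cstar rs Rs\<close> the exponent of the density process.
\<close>
definition lin :: "(nat \<Rightarrow> nat \<Rightarrow> real) \<Rightarrow> nat \<Rightarrow> real \<Rightarrow> 'a \<Rightarrow> real" where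
  "lin d m t \<omega> = (LBINT s:{0..t}. d (eps m) (N m s \<omega>))"

definition Lin :: "(nat \<Rightarrow> nat \<Rightarrow> real) \<Rightarrow> real \<Rightarrow> 'a \<Rightarrow> real" where
  "Lin d t \<omega> =
     (\<Sum>m=1..M t \<omega>. lin d (m - 1) (T m \<omega>) \<omega>) + lin d (M t \<omega>) (age t \<omega>) \<omega>"

definition jmp :: "nat \<Rightarrow> real \<Rightarrow> 'a \<Rightarrow> real" where
  "jmp m t \<omega> = (\<Sum>n=1..N m t \<omega>. r m (n - 1) \<omega>)"

definition Jmp :: "real \<Rightarrow> 'a \<Rightarrow> real" where
  "Jmp t \<omega> =
     (\<Sum>m=1..M t \<omega>. R (m - 1) (N (m - 1) (T m \<omega>) \<omega>) \<omega> + jmp (m - 1) (T m \<omega>) \<omega>)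
     + jmp (M t \<omega>) (age t \<omega>) \<omega>"

definition X :: "real \<Rightarrow> 'a \<Rightarrow> real" where
  "X t \<omega> = Lin c t \<omega> + Jmp t \<omega>"

definition Filt :: "real \<Rightarrow> 'a measure" where
  "Filt t = vimage_algebra (space P)
     (\<lambda>\<omega>. \<lambda>s\<in>{0..t}. (X s \<omega>, state s \<omega>, M s \<omega>, shocks s \<omega>))
     (\<Pi>\<^sub>M s\<in>{0..t}. borel \<Otimes>\<^sub>M count_space UNIV \<Otimes>\<^sub>M count_space UNIV \<Otimes>\<^sub>M count_space UNIV)"

definition path_N :: "nat \<Rightarrow> 'a \<Rightarrow> real \<Rightarrow> nat" where
  "path_N m \<omega> = (\<lambda>s\<in>{0..}. N m s \<omega>)"

definition cstar :: "(nat \<Rightarrow> nat \<Rightarrow> real) \<Rightarrow> (nat \<Rightarrow> nat \<Rightarrow> real) \<Rightarrow> nat \<Rightarrow> nat \<Rightarrow> real" where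
  "cstar rs Rs i n = - lam i n * rs i n - mu i n * Rs i n"

definition zstar :: "(nat \<Rightarrow> nat \<Rightarrow> real) \<Rightarrow> nat \<Rightarrow> real \<Rightarrow> 'a \<Rightarrow> real" where
  "zstar rs m t \<omega> = (\<Prod>n=1..N m t \<omega>. 1 + rs (eps m) (n - 1))"

definition Z :: "(nat \<Rightarrow> nat \<Rightarrow> real) \<Rightarrow> (nat \<Rightarrow> nat \<Rightarrow> real) \<Rightarrow> real \<Rightarrow> 'a \<Rightarrow> real" where
  "Z rs Rs t \<omega> =
     exp (Lin (cstar rs Rs) t \<omega>)
     * (\<Prod>m=1..M t \<omega>. (1 + Rs (eps (m - 1)) (N (m - 1) (T m \<omega>) \<omega>)) * zstar rs (m - 1) (T m \<omega>) \<omega>)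
     * zstar rs (M t \<omega>) (age t \<omega>) \<omega>"

end

abbreviation path_space :: "(real \<Rightarrow> nat) measure" where
  "path_space \<equiv> \<Pi>\<^sub>M s\<in>{0..}. count_space UNIV"

locale market = market_paths P lam mu c e0 H T r R + prob_space P
  for P :: "'a measure"
    and lam mu c :: "nat \<Rightarrow> nat \<Rightarrow> real"
    and e0 :: nat
    and H :: "nat \<Rightarrow> nat \<Rightarrow> 'a \<Rightarrow> real"
    and T :: "nat \<Rightarrow> 'a \<Rightarrow> real"
    and r R :: "nat \<Rightarrow> nat \<Rightarrow> 'a \<Rightarrow> real" +
  assumes e0: "e0 \<in> {0, 1}"
    and lam_pos: "\<And>i n. i \<in> {0, 1} \<Longrightarrow> lam i n > 0"
    and mu_pos: "\<And>i n. i \<in> {0, 1} \<Longrightarrow> mu i n > 0"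
    and lam_nonexplosive: "\<And>i. i \<in> {0, 1} \<Longrightarrow> \<not> summable (\<lambda>n. 1 / lam i n)"
    and H_distr: "\<And>m n. distributed P lborel (H m n) (exponential_density (lam (eps m) n))"
    and H_indep: "indep_vars (\<lambda>_. borel) (\<lambda>(m, n). H m n) UNIV"
    and T_rv: "\<And>m. m \<ge> 1 \<Longrightarrow> T m \<in> borel_measurable P"
    and T_pos: "\<And>m \<omega>. m \<ge> 1 \<Longrightarrow> \<omega> \<in> space P \<Longrightarrow> T m \<omega> > 0"
    and T_cond: "\<And>m t. m \<ge> 1 \<Longrightarrow> t \<ge> 0 \<Longrightarrow>
      (AE \<omega> in P.
        real_cond_exp P (vimage_algebra (space P) (path_N (m - 1)) path_space)
          (indicator {\<omega> \<in> space P. T m \<omega> > t}) \<omega>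
        = exp_minus (\<integral>\<^sup>+s\<in>{0..t}. ennreal (mu (eps (m - 1)) (N (m - 1) s \<omega>)) \<partial>lborel))"
    and NT_indep: "indep_vars (\<lambda>_. path_space \<Otimes>\<^sub>M borel) (\<lambda>m \<omega>. (path_N (m - 1) \<omega>, T m \<omega>)) {1..}"
    and r_range: "\<And>m n \<omega>. \<omega> \<in> space P \<Longrightarrow> r m n \<omega> > -1"
    and R_range: "\<And>m n \<omega>. \<omega> \<in> space P \<Longrightarrow> R m n \<omega> > -1"
    and rR_indep: "indep_vars (\<lambda>_. borel) (\<lambda>(b, m, n). if b then R m n else r m n) UNIV"
    and rR_indep_NT: "indep_set
      (sets (vimage_algebra (space P) (\<lambda>\<omega>. \<lambda>m\<in>{1..}. (path_N (m - 1) \<omega>, T m \<omega>))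
        (\<Pi>\<^sub>M m\<in>{1..}. path_space \<Otimes>\<^sub>M borel)))
      (sets (vimage_algebra (space P) (\<lambda>\<omega> (b, m, n). if b then R m n \<omega> else r m n \<omega>)
        (\<Pi>\<^sub>M k\<in>(UNIV :: (bool \<times> nat \<times> nat) set). borel)))"
    and r_law: "\<And>m m' n. eps m = eps m' \<Longrightarrow> distr P borel (r m n) = distr P borel (r m' n)"
    and R_law: "\<And>m m' n. eps m = eps m' \<Longrightarrow> distr P borel (R m n) = distr P borel (R m' n)"

end

theory Submission
  imports Defs
begin

text \<open>
  Between two switches the density process factorises over the stages of the market, a stage being a
  counting process together with the switching time that ends it. On the event that exactly
  \<open>m\<close> switches have happened by time \<open>s\<close>, \<open>Z s\<close> is the product of one weight for each of the
  \<open>m\<close> completed stages and one weight for the age of the current stage. The stages are independent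
  under \<open>P\<close>, so two computations about a single stage remain, and one argument that puts
  them together.

  A single stage. Tilting exponential holding times by factors \<open>\<rho> k * exp (- \<alpha> k * h k)\<close> only changes
  the intensity \<open>\<rho> k * l k\<close> and the decay rate \<open>\<alpha> k + l k\<close> of the holding density
  (\<open>nn_integral_tilt_cong\<close>). The exponent \<open>cstar\<close> is chosen such that the tilted and killed holding
  times have the intensity \<open>lam * (1 + rs)\<close> and, on top of it, the killing rate \<open>mu * (1 + Rs)\<close>. Hence
  the expected age weight on survival up to \<open>t\<close> is the probability \<open>alive_mass\<close> that a counting
  process with the new parameters is neither killed nor exploded at \<open>t\<close>
  (\<open>weighted_alive\<close>), and the expected weight of a stage completed by \<open>t\<close> is the probability
  \<open>killed_mass\<close> that it has been killed by \<open>t\<close> (\<open>weighted_killed\<close>).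

  Putting stages together. The value of \<open>Z\<close> is only accessible at deterministic times, while the
  \<open>m\<close>-th switch happens at a random time. The time of the \<open>m\<close>-th switch is rounded up to a grid of mesh
  \<open>d\<close>; on each event that fixes the grid point the density is \<open>Z\<close> at a deterministic time. Independence
  evaluates the expectation, and \<open>d \<rightarrow> 0\<close> gives (\<open>joint_switch_law\<close>)
  that the first \<open>m\<close> switching times have the product law of the measures \<open>switch_law\<close>, and
  that \<open>T (Suc m)\<close> has the tail \<open>alive_mass\<close>, independently of them.

  The new intensities may be explosive. The formula that defines \<open>PoExp\<close> allows paths to survive
  their explosion, whereas \<open>alive_mass\<close> does not count such paths. The difference vanishes:
  \<open>alive_mass\<close> at \<open>t\<close> is the tail of \<open>T (Suc m)\<close> and \<open>killed_mass\<close> at \<open>t\<close> the probability of its complement under the same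
  probability measure, so the two masses add up to \<open>1\<close> and no mass is left for paths that
  explode without having been killed (\<open>expected_survival\<close>).
\<close>

section \<open>Counting processes and their jump times\<close>

definition jump_time :: "(nat \<Rightarrow> real) \<Rightarrow> nat \<Rightarrow> real" where
  "jump_time h n = (\<Sum>k<n. h k)"

text \<open>
  Half-open, because counting processes are right-continuous.
\<close>
definition in_cell :: "(nat \<Rightarrow> real) \<Rightarrow> nat \<Rightarrow> real \<Rightarrow> bool" where
  "in_cell h n t \<longleftrightarrow> jump_time h n \<le> t \<and> t < jump_time h (Suc n)"

lemma jump_time_0 [simp]: "jump_time h 0 = 0"
  and jump_time_Suc: "jump_time h (Suc n) = jump_time h n + h n"
  by (simp_all add: jump_time_def)

lemma counting_eq: "counting h t = Max {n. jump_time h n \<le> t}"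
  by (simp add: counting_def jump_time_def)

lemma jump_time_strict_mono: "\<forall>k. 0 < h k \<Longrightarrow> strict_mono (jump_time h)"
  by (simp add: strict_mono_Suc_iff jump_time_Suc)

lemma jump_time_mono: "\<forall>k. 0 < h k \<Longrightarrow> m \<le> n \<Longrightarrow> jump_time h m \<le> jump_time h n"
  using strict_mono_less_eq[OF jump_time_strict_mono] by blast

lemma jump_time_nonneg: "\<forall>k. 0 < h k \<Longrightarrow> 0 \<le> jump_time h n"
  using jump_time_mono[of h 0 n] by simp

lemma counting_in_cell:
  assumes "\<forall>k. 0 < h k" "in_cell h n t"
  shows "counting h t = n"
proof -
  have "jump_time h m \<le> t \<longleftrightarrow> m \<le> n" for m
  proof
    assume "jump_time h m \<le> t"
    then have "jump_time h m < jump_time h (Suc n)" using assms(2) by (simp add: in_cell_def)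
    then show "m \<le> n"
      using strict_mono_less[OF jump_time_strict_mono[OF assms(1)]] by (simp add: less_Suc_eq_le)
  next
    assume "m \<le> n"
    then show "jump_time h m \<le> t"
      using jump_time_mono[OF assms(1)] assms(2) by (fastforce simp: in_cell_def)
  qed
  then have "{m. jump_time h m \<le> t} = {..n}" by auto
  then show ?thesis by (simp add: counting_eq) (rule Max_eqI, auto)
qed

lemma in_cell_unique:
  "\<forall>k. 0 < h k \<Longrightarrow> in_cell h n t \<Longrightarrow> in_cell h m t \<Longrightarrow> m = n"
  using counting_in_cell by metis

lemma ex_in_cell: "0 \<le> t \<Longrightarrow> t < jump_time h n \<Longrightarrow> \<exists>k<n. in_cell h k t"
proof (induction n)
  case (Suc n)
  show ?case
  proof (cases "t < jump_time h n")
    case True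
    then show ?thesis using Suc by (auto intro: less_SucI)
  next
    case False
    then show ?thesis using Suc.prems by (auto simp: in_cell_def intro!: exI[of _ n])
  qed
qed simp

text \<open>
  Here the jump times may accumulate before \<open>q\<close>. Then all of them are at most \<open>q\<close>, so the bound holds
  whatever value the counting process takes there.
\<close>
lemma jump_time_le_of_counting:
  assumes h: "\<forall>k. 0 < h k" and q: "0 \<le> q" and n: "n \<le> counting h q"
  shows "jump_time h n \<le> q"
proof (cases "finite {k. jump_time h k \<le> q}")
  case True
  have "{k. jump_time h k \<le> q} \<noteq> {}" using q by (auto intro: exI[of _ 0])
  then have "counting h q \<in> {k. jump_time h k \<le> q}"
    using True unfolding counting_eq by (intro Max_in)
  then show ?thesis using jump_time_mono[OF h n] by simp
next
  case False
  then obtain k where "n \<le> k" "jump_time h k \<le> q"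
    by (metis (mono_tags) finite_nat_set_iff_bounded_le linear mem_Collect_eq)
  then show ?thesis using jump_time_mono[OF h, of n k] by simp
qed

lemma rational_in_cell:
  assumes h: "\<forall>k. 0 < h k" and "jump_time h n < t"
  obtains q where "q \<in> \<rat>" "0 \<le> q" "q < t" "counting h q = n"
proof -
  have "jump_time h n < min t (jump_time h (Suc n))"
    using assms h[rule_format, of n] by (simp add: jump_time_Suc)
  then obtain q where q: "q \<in> \<rat>" "jump_time h n < q" "q < min t (jump_time h (Suc n))"
    using Rats_dense_in_real by blast
  then have "counting h q = n"
    by (intro counting_in_cell h) (auto simp: in_cell_def)
  moreover have "0 \<le> q" using jump_time_nonneg[OF h, of n] q by simp
  ultimately show ?thesis using q that by simp
qed

text \<open>
  A jump time is recovered from countably many values of the counting process. The time \<open>t\<close> itself is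
  needed besides the rationals, since the \<open>n\<close>-th jump may occur exactly at \<open>t\<close>.
\<close>
lemma jump_time_le_iff:
  assumes h: "\<forall>k. 0 < h k" and t: "0 \<le> t"
  shows "jump_time h n \<le> t \<longleftrightarrow> (\<exists>q\<in>insert t (\<rat> \<inter> {0..t}). n \<le> counting h q)"
proof
  assume le: "jump_time h n \<le> t"
  show "\<exists>q\<in>insert t (\<rat> \<inter> {0..t}). n \<le> counting h q"
  proof (cases "jump_time h n = t")
    case True
    then have "in_cell h n t" using h[rule_format, of n] by (simp add: in_cell_def jump_time_Suc)
    then show ?thesis using counting_in_cell[OF h] by auto
  next
    case False
    then have "jump_time h n < t" using le by simp
    then obtain q where "q \<in> \<rat>" "0 \<le> q" "q < t" "counting h q = n"
      using rational_in_cell[OF h] by blast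
    then show ?thesis by auto
  qed
next
  assume "\<exists>q\<in>insert t (\<rat> \<inter> {0..t}). n \<le> counting h q"
  then obtain q where "0 \<le> q" "q \<le> t" "n \<le> counting h q" using t by auto
  then show "jump_time h n \<le> t"
    using jump_time_le_of_counting[OF h, of q n] by linarith
qed

text \<open>
  The time of the \<open>n\<close>-th jump as a functional of the whole path. Rational times make it measurable for
  the product \<open>\<sigma>\<close>-algebra; the extended reals give a value to paths that never reach \<open>n\<close>.
\<close>
definition path_jump_time :: "(real \<Rightarrow> nat) \<Rightarrow> nat \<Rightarrow> real" where
  "path_jump_time p n = real_of_ereal (INF q\<in>\<rat> \<inter> {0..}. if n \<le> p q then ereal q else \<infinity>)"

definition path_holding :: "(real \<Rightarrow> nat) \<Rightarrow> nat \<Rightarrow> real" where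
  "path_holding p n = path_jump_time p (Suc n) - path_jump_time p n"

lemma path_jump_time_counting:
  assumes h: "\<forall>k. 0 < h k"
  shows "path_jump_time (\<lambda>s\<in>{0..}. counting h s) n = jump_time h n"
proof -
  have "(INF q\<in>\<rat> \<inter> {0..}. if n \<le> (\<lambda>s\<in>{0..}. counting h s) q then ereal q else \<infinity>)
      = ereal (jump_time h n)"
  proof (rule antisym)
    show "ereal (jump_time h n) \<le>
        (INF q\<in>\<rat> \<inter> {0..}. if n \<le> (\<lambda>s\<in>{0..}. counting h s) q then ereal q else \<infinity>)"
      using jump_time_le_of_counting[OF h] by (intro INF_greatest) auto
    show "(INF q\<in>\<rat> \<inter> {0..}. if n \<le> (\<lambda>s\<in>{0..}. counting h s) q then ereal q else \<infinity>)
        \<le> ereal (jump_time h n)"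
    proof (rule ereal_le_epsilon2)
      fix e :: real assume "0 < e"
      then obtain q where q: "q \<in> \<rat>" "0 \<le> q" "q < jump_time h n + e" "counting h q = n"
        using rational_in_cell[OF h, of n "jump_time h n + e"] by auto
      then show "(INF q\<in>\<rat> \<inter> {0..}. if n \<le> (\<lambda>s\<in>{0..}. counting h s) q then ereal q else \<infinity>)
        \<le> ereal (jump_time h n) + ereal e"
        by (intro INF_lower2[of q]) auto
    qed
  qed
  then show ?thesis by (simp add: path_jump_time_def)
qed

text \<open>
  Conditioning on the path of a counting process is therefore conditioning on its holding times.
\<close>
lemma path_holding_counting:
  assumes h: "\<forall>k. 0 < h k"
  shows "path_holding (\<lambda>s\<in>{0..}. counting h s) = h"
  by (rule ext)
    (simp add: path_holding_def path_jump_time_counting[OF h] jump_time_Suc)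

lemma measurable_path_jump_time [measurable]:
  "(\<lambda>p. path_jump_time p n) \<in> borel_measurable path_space"
proof -
  have "(\<lambda>p. if n \<le> p q then ereal q else \<infinity>) \<in> borel_measurable path_space"
    if "q \<in> \<rat> \<inter> {0..}" for q
  proof -
    have [measurable]: "(\<lambda>p. p q) \<in> measurable path_space (count_space UNIV)"
      using that by (intro measurable_component_singleton) auto
    show ?thesis by measurable
  qed
  moreover have "countable (\<rat> \<inter> {0::real..})"
    by (intro countable_Int1 countable_rat)
  ultimately show ?thesis
    unfolding path_jump_time_def
    by (intro borel_measurable_real_of_ereal borel_measurable_INF) auto
qed

lemma measurable_path_holding [measurable]:
  "path_holding \<in> measurable path_space (\<Pi>\<^sub>M n\<in>UNIV. borel)"
  unfolding path_holding_def[abs_def] by (rule measurable_PiM_single') (auto simp: space_PiM)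

text \<open>
  The integral of \<open>f (counting h s)\<close> over \<open>s \<in> {0..t}\<close>, when \<open>t\<close> lies in the \<open>n\<close>-th cell.
\<close>
definition accrued :: "(nat \<Rightarrow> real) \<Rightarrow> (nat \<Rightarrow> real) \<Rightarrow> nat \<Rightarrow> real \<Rightarrow> real" where
  "accrued f h n t = (\<Sum>k<n. f k * h k) + f n * (t - jump_time h n)"

text \<open>
  On \<open>{0..t}\<close> the integrand is the step function with value \<open>f k\<close> on the \<open>k\<close>-th cell.
\<close>
lemma has_integral_counting:
  assumes h: "\<forall>k. 0 < h k" and t: "in_cell h n t"
  shows "has_bochner_integral lborel (\<lambda>s. indicator {0..t} s *\<^sub>R f (counting h s)) (accrued f h n t)"
proof -
  have S: "jump_time h n \<le> t" using t by (simp add: in_cell_def)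
  have fin: "emeasure lborel {a..<b} < \<infinity>" "emeasure lborel {a..b} < \<infinity>" for a b :: real
    by (cases "a \<le> b"; simp)+
  have "has_bochner_integral lborel (\<lambda>s. indicator {jump_time h k..<jump_time h (Suc k)} s *\<^sub>R f k)
      (f k * h k)" for k
  proof -
    have "has_bochner_integral lborel (\<lambda>s. indicator {jump_time h k..<jump_time h (Suc k)} s *\<^sub>R f k)
      (measure lborel {jump_time h k..<jump_time h (Suc k)} *\<^sub>R f k)"
      by (intro has_bochner_integral_scaleR_left has_bochner_integral_real_indicator fin) auto
    then show ?thesis using h[rule_format, of k] by (simp add: jump_time_Suc mult.commute)
  qed
  moreover have "has_bochner_integral lborel (\<lambda>s. indicator {jump_time h n..t} s *\<^sub>R f n)
      (f n * (t - jump_time h n))"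
  proof -
    have "has_bochner_integral lborel (\<lambda>s. indicator {jump_time h n..t} s *\<^sub>R f n)
      (measure lborel {jump_time h n..t} *\<^sub>R f n)"
      by (intro has_bochner_integral_scaleR_left has_bochner_integral_real_indicator fin) auto
    then show ?thesis using S by (simp add: mult.commute)
  qed
  ultimately have *: "has_bochner_integral lborel
      (\<lambda>s. (\<Sum>k<n. indicator {jump_time h k..<jump_time h (Suc k)} s *\<^sub>R f k)
        + indicator {jump_time h n..t} s *\<^sub>R f n) (accrued f h n t)"
    unfolding accrued_def by (intro has_bochner_integral_add has_bochner_integral_sum)
  have cell: "s \<in> {jump_time h k..<jump_time h (Suc k)} \<longleftrightarrow> in_cell h k s" for k s
    by (auto simp: in_cell_def)
  have "(\<Sum>k<n. indicator {jump_time h k..<jump_time h (Suc k)} s *\<^sub>R f k)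
        + indicator {jump_time h n..t} s *\<^sub>R f n = indicator {0..t} s *\<^sub>R f (counting h s)" for s
  proof (cases "s \<in> {0..t}")
    case True
    then obtain j where j: "j < Suc n" "in_cell h j s"
      using ex_in_cell[of s h "Suc n"] t by (auto simp: in_cell_def)
    have "in_cell h k s \<longleftrightarrow> k = j" for k
      using in_cell_unique[OF h j(2)] j(2) by blast
    then have "(\<Sum>k<n. indicator {jump_time h k..<jump_time h (Suc k)} s *\<^sub>R f k)
      = (\<Sum>k<n. if k = j then f k else 0)"
      by (intro sum.cong refl) (simp add: indicator_def cell del: atLeastLessThan_iff)
    also have "\<dots> = (if j < n then f j else 0)" by simp
    also have "\<dots> + indicator {jump_time h n..t} s *\<^sub>R f n = f j"
    proof (cases "j < n")
      case True
      have "s < jump_time h (Suc j)" using j by (simp add: in_cell_def)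
      also have "\<dots> \<le> jump_time h n" using True by (intro jump_time_mono h) simp
      finally show ?thesis using True by simp
    next
      case False
      then have "j = n" using j by simp
      then show ?thesis using j \<open>s \<in> {0..t}\<close> by (simp add: in_cell_def)
    qed
    finally show ?thesis using True counting_in_cell[OF h j(2)] by simp
  next
    case False
    have "\<not> in_cell h k s" if "k < n" for k
    proof
      assume "in_cell h k s"
      then have "jump_time h k \<le> s" "s < jump_time h (Suc k)" by (auto simp: in_cell_def)
      moreover have "jump_time h (Suc k) \<le> jump_time h n" using that by (intro jump_time_mono h) simp
      moreover have "0 \<le> jump_time h k" by (rule jump_time_nonneg[OF h])
      ultimately show False using False S by auto
    qed
    then have "(\<Sum>k<n. indicator {jump_time h k..<jump_time h (Suc k)} s *\<^sub>R f k) = 0"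
      by (intro sum.neutral ballI) (simp add: indicator_def cell del: atLeastLessThan_iff)
    moreover have "s \<notin> {jump_time h n..t}" using False jump_time_nonneg[OF h, of n] by auto
    ultimately show ?thesis using False by simp
  qed
  then show ?thesis using * by simp
qed

lemma LBINT_counting:
  assumes "\<forall>k. 0 < h k" "in_cell h n t"
  shows "(LBINT s:{0..t}. f (counting h s)) = accrued f h n t"
  using has_bochner_integral_integral_eq[OF has_integral_counting[OF assms]]
  by (simp add: set_lebesgue_integral_def)

lemma nn_integral_counting:
  assumes "\<forall>k. 0 < h k" "in_cell h n t" "\<And>k. 0 \<le> f k"
  shows "(\<integral>\<^sup>+s\<in>{0..t}. ennreal (f (counting h s)) \<partial>lborel) = ennreal (accrued f h n t)"
proof -
  have "(\<integral>\<^sup>+s\<in>{0..t}. ennreal (f (counting h s)) \<partial>lborel)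
      = (\<integral>\<^sup>+s. ennreal (indicator {0..t} s *\<^sub>R f (counting h s)) \<partial>lborel)"
    by (intro nn_integral_cong) (simp add: indicator_def)
  also have "\<dots> = ennreal (accrued f h n t)"
    using has_integral_counting[of h n t f, OF assms(1,2)] assms(3)
    by (subst nn_integral_eq_integral) (auto simp: has_bochner_integral_iff indicator_def)
  finally show ?thesis .
qed

lemma exp_minus_counting:
  assumes "\<forall>k. 0 < h k" "in_cell h n t" "\<And>k. 0 \<le> f k"
  shows "exp_minus (\<integral>\<^sup>+s\<in>{0..t}. ennreal (f (counting h s)) \<partial>lborel) = exp (- accrued f h n t)"
proof -
  have "0 \<le> accrued f h n t"
    using assms unfolding accrued_def in_cell_def
    by (intro add_nonneg_nonneg sum_nonneg mult_nonneg_nonneg) (auto intro: less_imp_le)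
  then show ?thesis
    by (subst nn_integral_counting[OF assms]) (simp_all add: exp_minus_def)
qed

section \<open>Exponential holding times and changes of intensity\<close>

definition exp_holding :: "(nat \<Rightarrow> real) \<Rightarrow> (nat \<Rightarrow> real) measure" where
  "exp_holding l = (\<Pi>\<^sub>M n\<in>UNIV. density lborel (exponential_density (l n)))"

lemma sets_exp_holding [measurable_cong]:
  "sets (exp_holding l) = sets (\<Pi>\<^sub>M n\<in>UNIV. borel)"
  unfolding exp_holding_def by (intro sets_PiM_cong) simp_all

lemma space_exp_holding [simp]: "space (exp_holding l) = UNIV"
  by (simp add: exp_holding_def space_PiM)

lemma product_prob_space_exp:
  "\<forall>n. 0 < l n \<Longrightarrow> product_prob_space (\<lambda>n. density lborel (exponential_density (l n)))"
  by (intro product_prob_spaceI prob_space_exponential_density) auto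

lemma prob_space_exp_holding: "\<forall>n. 0 < l n \<Longrightarrow> prob_space (exp_holding l)"
  unfolding exp_holding_def by (intro prob_space_PiM prob_space_exponential_density) auto

lemma measurable_jump_time [measurable]:
  "(\<lambda>h. jump_time h n) \<in> borel_measurable (\<Pi>\<^sub>M n\<in>UNIV. borel)"
  unfolding jump_time_def by measurable

text \<open>
  The holding time \<open>h n\<close> may be integrated out when, apart from it, the integrand depends only on
  the earlier ones: restricting the infinite product to \<open>{..n}\<close> leaves a finite product measure, from which the
  last factor is split off.
\<close>
lemma nn_integral_next_holding:
  fixes f :: "(nat \<Rightarrow> real) \<times> real \<Rightarrow> ennreal"
  assumes l: "\<forall>n. 0 < l n"
    and [measurable]: "f \<in> borel_measurable ((\<Pi>\<^sub>M n\<in>UNIV. borel) \<Otimes>\<^sub>M borel)"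
    and past: "\<And>h h' x. (\<And>k. k < n \<Longrightarrow> h k = h' k) \<Longrightarrow> f (h, x) = f (h', x)"
  shows "(\<integral>\<^sup>+h. f (h, h n) \<partial>exp_holding l)
    = (\<integral>\<^sup>+h. (\<integral>\<^sup>+x. exponential_density (l n) x * f (h, x) \<partial>lborel) \<partial>exp_holding l)"
proof -
  define D where "D = (\<lambda>n. density lborel (exponential_density (l n)))"
  interpret product_prob_space D UNIV unfolding D_def by (rule product_prob_space_exp[OF l])
  have E: "exp_holding l = PiM UNIV D" by (simp add: exp_holding_def D_def)
  define past where "past y = (\<lambda>k. if k < n then y k else (0::real))" for y
  have past_m [measurable]: "past \<in> measurable (PiM J D) (\<Pi>\<^sub>M n\<in>UNIV. borel)"
    if "{..<n} \<subseteq> J" for J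
  proof (rule measurable_PiM_single')
    fix i :: nat
    show "(\<lambda>y. past y i) \<in> borel_measurable (PiM J D)"
    proof (cases "i < n")
      case True
      then have "(\<lambda>y. y i) \<in> measurable (PiM J D) (D i)"
        using that by (intro measurable_component_singleton) auto
      then show ?thesis using True by (simp add: past_def D_def)
    qed (simp add: past_def)
  qed (auto simp: space_PiM)
  have f_past: "f (h, x) = f (past h, x)" for h x
    by (intro assms(3)) (simp add: past_def)
  have restr: "past (restrict h J) = past h" if "{..<n} \<subseteq> J" for h J
    using that by (intro ext) (auto simp: past_def)
  have lift: "(\<integral>\<^sup>+h. g (restrict h J) \<partial>exp_holding l) = (\<integral>\<^sup>+y. g y \<partial>PiM J D)"
    if "finite J" "g \<in> borel_measurable (PiM J D)" for g J
    unfolding E using that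
    by (subst distr_PiM_restrict_finite[symmetric, of J])
       (auto intro!: nn_integral_distr[symmetric] measurable_restrict_subset)
  have m1: "(\<lambda>y. f (past y, y n)) \<in> borel_measurable (PiM {..n} D)"
  proof -
    have "{..<n} \<subseteq> {..n}" by auto
    note [measurable] = past_m[OF this]
    have [measurable]: "(\<lambda>y. y n) \<in> borel_measurable (PiM {..n} D)"
      using measurable_component_singleton[of n "{..n}" D] by (simp add: D_def)
    show ?thesis by measurable
  qed
  have m2: "(\<lambda>y. \<integral>\<^sup>+x. exponential_density (l n) x * f (past y, x) \<partial>lborel)
      \<in> borel_measurable (PiM {..<n} D)"
  proof -
    note [measurable] = past_m[OF order_refl]
    show ?thesis by measurable
  qed
  have "(\<integral>\<^sup>+h. f (h, h n) \<partial>exp_holding l) = (\<integral>\<^sup>+h. f (past (restrict h {..n}), (restrict h {..n}) n) \<partial>exp_holding l)"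
    by (intro nn_integral_cong) (subst f_past, subst restr, auto)
  also have "\<dots> = (\<integral>\<^sup>+y. f (past y, y n) \<partial>PiM {..n} D)"
    by (rule lift[OF _ m1]) simp
  also have "{..n} = insert n {..<n}" by auto
  also have "(\<integral>\<^sup>+y. f (past y, y n) \<partial>PiM (insert n {..<n}) D)
      = (\<integral>\<^sup>+y. \<integral>\<^sup>+x. f (past (y(n := x)), (y(n := x)) n) \<partial>D n \<partial>PiM {..<n} D)"
    using m1 by (intro product_nn_integral_insert) (auto simp: \<open>{..n} = insert n {..<n}\<close>)
  also have "\<dots> = (\<integral>\<^sup>+y. \<integral>\<^sup>+x. exponential_density (l n) x * f (past y, x) \<partial>lborel \<partial>PiM {..<n} D)"
  proof (intro nn_integral_cong)
    fix y assume "y \<in> space (PiM {..<n} D)"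
    have "past (y(n := x)) = past y" for x by (auto simp: past_def)
    moreover have "past y \<in> space (\<Pi>\<^sub>M n\<in>UNIV. borel)" by (simp add: space_PiM)
    ultimately show "(\<integral>\<^sup>+x. f (past (y(n := x)), (y(n := x)) n) \<partial>D n)
      = (\<integral>\<^sup>+x. exponential_density (l n) x * f (past y, x) \<partial>lborel)"
      unfolding D_def by (subst nn_integral_density) simp_all
  qed
  also have "\<dots> = (\<integral>\<^sup>+h. \<integral>\<^sup>+x. exponential_density (l n) x * f (past (restrict h {..<n}), x) \<partial>lborel \<partial>exp_holding l)"
    by (rule lift[OF _ m2, symmetric]) simp
  also have "\<dots> = (\<integral>\<^sup>+h. (\<integral>\<^sup>+x. exponential_density (l n) x * f (h, x) \<partial>lborel) \<partial>exp_holding l)"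
    by (subst restr[OF order_refl], subst f_past[symmetric], rule refl)
  finally show ?thesis .
qed

text \<open>
  The Radon-Nikodym factor of a change of intensities of the first \<open>n\<close> holding times, with free
  multipliers \<open>\<rho>\<close> and rates \<open>\<alpha>\<close>; with \<open>\<rho> = 1\<close> it is the survival factor for killing at rates \<open>\<alpha>\<close>.
\<close>
definition tilt :: "(nat \<Rightarrow> real) \<Rightarrow> (nat \<Rightarrow> real) \<Rightarrow> (nat \<Rightarrow> real) \<Rightarrow> nat \<Rightarrow> real" where
  "tilt \<rho> \<alpha> h n = (\<Prod>k<n. \<rho> k * exp (- (\<alpha> k * h k)))"

lemma tilt_nonneg: "\<forall>k. 0 \<le> \<rho> k \<Longrightarrow> 0 \<le> tilt \<rho> \<alpha> h n"
  unfolding tilt_def by (intro prod_nonneg) auto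

lemma tilt_Suc: "tilt \<rho> \<alpha> h (Suc n) = tilt \<rho> \<alpha> h n * (\<rho> n * exp (- (\<alpha> n * h n)))"
  by (simp add: tilt_def)

lemma tilt_past: "(\<And>k. k < n \<Longrightarrow> h k = h' k) \<Longrightarrow> tilt \<rho> \<alpha> h n = tilt \<rho> \<alpha> h' n"
  unfolding tilt_def by (intro prod.cong) auto

lemma jump_time_past: "(\<And>k. k < n \<Longrightarrow> h k = h' k) \<Longrightarrow> jump_time h n = jump_time h' n"
  unfolding jump_time_def by (intro sum.cong) auto

lemma measurable_tilt [measurable]:
  "(\<lambda>h. tilt \<rho> \<alpha> h n) \<in> borel_measurable (\<Pi>\<^sub>M n\<in>UNIV. borel)"
  unfolding tilt_def by measurable

lemma exponential_density_mult_exp: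
  "0 < l \<Longrightarrow> exponential_density l x * exp (- (a * x)) = l * exp (- ((a + l) * x)) * indicator {0..} x"
  by (auto simp: exponential_density_def algebra_simps simp flip: exp_add)

lemma nn_integral_tilt_step:
  fixes \<phi> :: "real \<Rightarrow> ennreal"
  assumes l: "\<forall>n. 0 < l n" and \<rho>: "\<forall>n. 0 \<le> \<rho> n" and [measurable]: "\<phi> \<in> borel_measurable borel"
  shows "(\<integral>\<^sup>+h. ennreal (tilt \<rho> \<alpha> h (Suc n)) * \<phi> (jump_time h (Suc n)) \<partial>exp_holding l)
    = (\<integral>\<^sup>+h. ennreal (tilt \<rho> \<alpha> h n) * (\<integral>\<^sup>+x. ennreal (\<rho> n * l n * exp (- ((\<alpha> n + l n) * x)) * indicator {0..} x)
          * \<phi> (jump_time h n + x) \<partial>lborel) \<partial>exp_holding l)"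
proof -
  define f where "f = (\<lambda>(h, x). ennreal (tilt \<rho> \<alpha> h n * (\<rho> n * exp (- (\<alpha> n * x)))) * \<phi> (jump_time h n + x))"
  have [measurable]: "f \<in> borel_measurable ((\<Pi>\<^sub>M n\<in>UNIV. borel) \<Otimes>\<^sub>M borel)"
    unfolding f_def by measurable
  have past: "f (h, x) = f (h', x)" if "\<And>k. k < n \<Longrightarrow> h k = h' k" for h h' x
    using tilt_past[of n h h' \<rho> \<alpha>, OF that] jump_time_past[of n h h', OF that] by (simp add: f_def)
  have "(\<integral>\<^sup>+h. ennreal (tilt \<rho> \<alpha> h (Suc n)) * \<phi> (jump_time h (Suc n)) \<partial>exp_holding l)
      = (\<integral>\<^sup>+h. f (h, h n) \<partial>exp_holding l)"
    by (simp add: f_def tilt_Suc jump_time_Suc)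
  also have "\<dots> = (\<integral>\<^sup>+h. (\<integral>\<^sup>+x. exponential_density (l n) x * f (h, x) \<partial>lborel) \<partial>exp_holding l)"
    by (intro nn_integral_next_holding l past) measurable
  also have "\<dots> = (\<integral>\<^sup>+h. ennreal (tilt \<rho> \<alpha> h n) * (\<integral>\<^sup>+x. ennreal (\<rho> n * l n * exp (- ((\<alpha> n + l n) * x)) * indicator {0..} x)
          * \<phi> (jump_time h n + x) \<partial>lborel) \<partial>exp_holding l)"
  proof (intro nn_integral_cong)
    fix h :: "nat \<Rightarrow> real"
    have "exponential_density (l n) x * f (h, x)
        = ennreal (tilt \<rho> \<alpha> h n) * (ennreal (\<rho> n * l n * exp (- ((\<alpha> n + l n) * x)) * indicator {0..} x)
          * \<phi> (jump_time h n + x))" for x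
    proof -
      have ln: "0 < l n" using l by simp
      have "ennreal (exponential_density (l n) x) * ennreal (tilt \<rho> \<alpha> h n * (\<rho> n * exp (- (\<alpha> n * x))))
        = ennreal (tilt \<rho> \<alpha> h n * (\<rho> n * (exponential_density (l n) x * exp (- (\<alpha> n * x)))))"
        using exponential_density_nonneg[OF ln] tilt_nonneg[OF \<rho>]
        by (subst ennreal_mult'[symmetric]) (auto simp: algebra_simps)
      also have "\<dots> = ennreal (tilt \<rho> \<alpha> h n) * ennreal (\<rho> n * l n * exp (- ((\<alpha> n + l n) * x)) * indicator {0..} x)"
        unfolding exponential_density_mult_exp[OF ln]
        using tilt_nonneg[OF \<rho>] \<rho> ln
        by (subst ennreal_mult'[symmetric]) (auto simp: algebra_simps)
      finally show ?thesis by (simp add: f_def mult.assoc[symmetric])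
    qed
    then show "(\<integral>\<^sup>+x. exponential_density (l n) x * f (h, x) \<partial>lborel) = ennreal (tilt \<rho> \<alpha> h n) * (\<integral>\<^sup>+x. ennreal (\<rho> n * l n * exp (- ((\<alpha> n + l n) * x)) * indicator {0..} x)
          * \<phi> (jump_time h n + x) \<partial>lborel)"
      by (simp add: nn_integral_cmult)
  qed
  finally show ?thesis .
qed

text \<open>
  The change of intensities. Integrating out the last holding time replaces \<open>\<phi>\<close> by its
  convolution with the density \<open>\<rho> n * l n * exp (- (\<alpha> n + l n) * x)\<close>, which depends on the two
  combinations of parameters only; induction on \<open>n\<close> does the rest.
\<close>
lemma nn_integral_tilt_cong:
  fixes \<phi> :: "real \<Rightarrow> ennreal"
  assumes l: "\<forall>n. 0 < l n" "\<forall>n. 0 < l' n" and \<rho>: "\<forall>n. 0 \<le> \<rho> n" "\<forall>n. 0 \<le> \<rho>' n"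
    and intensity: "\<forall>n. \<rho> n * l n = \<rho>' n * l' n"
    and decay: "\<forall>n. \<alpha> n + l n = \<alpha>' n + l' n"
    and "\<phi> \<in> borel_measurable borel"
  shows "(\<integral>\<^sup>+h. ennreal (tilt \<rho> \<alpha> h n) * \<phi> (jump_time h n) \<partial>exp_holding l)
    = (\<integral>\<^sup>+h. ennreal (tilt \<rho>' \<alpha>' h n) * \<phi> (jump_time h n) \<partial>exp_holding l')"
  using assms(7)
proof (induction n arbitrary: \<phi>)
  case 0
  interpret E: prob_space "exp_holding l" by (rule prob_space_exp_holding[OF l(1)])
  interpret E': prob_space "exp_holding l'" by (rule prob_space_exp_holding[OF l(2)])
  show ?case using E.emeasure_space_1 E'.emeasure_space_1 by (simp add: tilt_def)
next
  case (Suc n)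
  note [measurable] = Suc.prems
  show ?case
    unfolding nn_integral_tilt_step[OF l(1) \<rho>(1) Suc.prems] nn_integral_tilt_step[OF l(2) \<rho>(2) Suc.prems]
    using Suc.IH[of "\<lambda>s. \<integral>\<^sup>+x. ennreal (\<rho> n * l n * exp (- ((\<alpha> n + l n) * x)) * indicator {0..} x)
          * \<phi> (s + x) \<partial>lborel"] intensity decay by simp
qed

section \<open>Killing a path at a rate that depends on the count\<close>

text \<open>
  With killing rate \<open>a n\<close> while the count is \<open>n\<close>, and given the holding times, \<open>alive\<close> is the conditional
  probability of being unkilled at \<open>t\<close> with count \<open>n\<close>, \<open>reached\<close> that of making the \<open>n\<close>-th jump by \<open>t\<close>
  unkilled, and \<open>killed\<close> that of being killed by \<open>t\<close> at count \<open>n\<close>.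
\<close>
definition alive :: "(nat \<Rightarrow> real) \<Rightarrow> (nat \<Rightarrow> real) \<Rightarrow> nat \<Rightarrow> real \<Rightarrow> real" where
  "alive a h n t = (if in_cell h n t then exp (- accrued a h n t) else 0)"

definition reached :: "(nat \<Rightarrow> real) \<Rightarrow> (nat \<Rightarrow> real) \<Rightarrow> nat \<Rightarrow> real \<Rightarrow> real" where
  "reached a h n t = (if jump_time h n \<le> t then exp (- (\<Sum>k<n. a k * h k)) else 0)"

definition killed :: "(nat \<Rightarrow> real) \<Rightarrow> (nat \<Rightarrow> real) \<Rightarrow> nat \<Rightarrow> real \<Rightarrow> ennreal" where
  "killed a h n t = (\<integral>\<^sup>+s\<in>{0..t}. ennreal (a n * alive a h n s) \<partial>lborel)"

text \<open>
  The integrand in the definition of \<open>PoExp\<close>. Unlike the sum of \<open>alive\<close> over all counts, it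
  may be positive after an explosion.
\<close>
definition survival :: "(nat \<Rightarrow> real) \<Rightarrow> (nat \<Rightarrow> real) \<Rightarrow> real \<Rightarrow> real" where
  "survival a h t = exp_minus (\<integral>\<^sup>+s\<in>{0..t}. ennreal (a (counting h s)) \<partial>lborel)"

definition regular :: "(nat \<Rightarrow> real) \<Rightarrow> bool" where
  "regular h \<longleftrightarrow> (\<forall>k. 0 < h k) \<and> (\<forall>t. \<exists>n. t < jump_time h n)"

lemma alive_nonneg [simp]: "0 \<le> alive a h n t"
  and reached_nonneg [simp]: "0 \<le> reached a h n t"
  by (simp_all add: alive_def reached_def)

text \<open>
  A path that has made the \<open>n\<close>-th jump unkilled is at \<open>t\<close> still unkilled at count \<open>n\<close>, or was killed at
  count \<open>n\<close>, or has made the next jump unkilled.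
\<close>
lemma reached_eq_alive_plus_killed:
  assumes h: "\<forall>k. 0 < h k" and a: "0 \<le> a n"
  shows "ennreal (reached a h n t)
    = ennreal (alive a h n t) + killed a h n t + ennreal (reached a h (Suc n) t)"
proof (cases "jump_time h n \<le> t")
  case False
  then have "\<not> jump_time h (Suc n) \<le> t"
    using h[rule_format, of n] by (simp add: jump_time_Suc)
  moreover have "alive a h n s = 0" if "s \<le> t" for s
    using False that by (simp add: alive_def in_cell_def)
  then have "killed a h n t = (\<integral>\<^sup>+s. 0 \<partial>(lborel :: real measure))"
    unfolding killed_def by (intro nn_integral_cong) (auto simp: indicator_def)
  ultimately show ?thesis using False by (simp add: reached_def alive_def in_cell_def)
next
  case True
  define A where "A = (\<Sum>k<n. a k * h k)"
  define S where "S = jump_time h n"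
  define S' where "S' = jump_time h (Suc n)"
  define u where "u = min t S'"
  have S: "0 \<le> S" "S < S'" "S \<le> t" "S \<le> u" "S' = S + h n" "u \<le> t"
    using True jump_time_nonneg[OF h, of n] h[rule_format, of n]
    by (auto simp: S_def S'_def u_def jump_time_Suc)
  have acc: "accrued a h n s = A + a n * (s - S)" for s
    by (simp add: accrued_def A_def S_def)
  have "killed a h n t
      = (\<integral>\<^sup>+s. ennreal (a n * exp (- (A + a n * (s - S)))) * indicator {S..u} s \<partial>lborel)"
    \<comment> \<open>the two integrands differ at most at the right end of the cell\<close>
    unfolding killed_def
  proof (rule nn_integral_cong_AE)
    show "AE s in lborel. ennreal (a n * alive a h n s) * indicator {0..t} s
      = ennreal (a n * exp (- (A + a n * (s - S)))) * indicator {S..u} s"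
      using AE_lborel_singleton[of S']
    proof eventually_elim
      case (elim s)
      then show ?case
        using S by (cases "S \<le> s"; cases "s < S'"; cases "s \<le> t")
          (simp_all add: alive_def in_cell_def acc u_def indicator_def flip: S_def S'_def)
    qed
  qed
  also have "\<dots> = - exp (- (A + a n * (u - S))) - (- exp (- (A + a n * (S - S))))"
  proof (rule nn_integral_FTC_Icc)
    fix s
    show "((\<lambda>s. - exp (- (A + a n * (s - S)))) has_field_derivative a n * exp (- (A + a n * (s - S)))) (at s)"
      by (auto intro!: derivative_eq_intros)
  qed (use a S in auto)
  finally have "killed a h n t = ennreal (exp (- A) - exp (- (A + a n * (u - S))))" by simp
  moreover have "exp (- (A + a n * (u - S))) \<le> exp (- A)"
    using a S by simp
  moreover have "reached a h n t = exp (- A)"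
    using True by (simp add: reached_def A_def)
  moreover have "alive a h n t = (if t < S' then exp (- (A + a n * (u - S))) else 0)"
    using True by (auto simp: alive_def in_cell_def acc u_def simp flip: S'_def)
  moreover have "reached a h (Suc n) t = (if t < S' then 0 else exp (- (A + a n * (u - S))))"
    using S by (auto simp: reached_def u_def A_def algebra_simps simp flip: S'_def)
  ultimately show ?thesis by (simp add: ennreal_plus[symmetric] del: ennreal_plus)
qed

lemma sum_alive_killed_reached:
  assumes h: "\<forall>k. 0 < h k" and a: "\<forall>k. 0 \<le> a k" and t: "0 \<le> t"
  shows "(\<Sum>n<m. ennreal (alive a h n t) + killed a h n t) + ennreal (reached a h m t) = 1"
proof (induction m)
  case 0
  then show ?case using t by (simp add: reached_def)
next
  case (Suc m)
  then show ?case
    using reached_eq_alive_plus_killed[OF h, of a m t] a by (simp add: ac_simps)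
qed

lemma alive_sums_in_cell:
  assumes "\<forall>k. 0 < h k" "in_cell h n t"
  shows "(\<Sum>k. ennreal (alive a h k t)) = ennreal (exp (- accrued a h n t))"
proof -
  have "alive a h k t = 0" if "k \<noteq> n" for k
    using in_cell_unique[OF assms, of k] that by (auto simp: alive_def)
  then have "(\<Sum>k. ennreal (alive a h k t)) = (\<Sum>k\<in>{n}. ennreal (alive a h k t))"
    by (intro suminf_finite) auto
  then show ?thesis using assms by (simp add: alive_def)
qed

lemma alive_sums_exploded: "(\<And>n. \<not> in_cell h n t) \<Longrightarrow> (\<Sum>k. ennreal (alive a h k t)) = 0"
  by (simp add: alive_def)

lemma survival_in_cell:
  assumes "\<forall>k. 0 < h k" "in_cell h n t" "\<forall>k. 0 \<le> a k"
  shows "survival a h t = exp (- accrued a h n t)"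
  unfolding survival_def using assms by (intro exp_minus_counting) auto

lemma exp_minus_antimono: "x \<le> y \<Longrightarrow> exp_minus y \<le> exp_minus x"
  by (auto simp: exp_minus_def top_unique enn2real_mono less_top)

text \<open>
  Past the \<open>n\<close>-th jump, survival is bounded by survival up to that jump; this remains true after an
  explosion.
\<close>
lemma survival_le_reached:
  assumes h: "\<forall>k. 0 < h k" and a: "\<forall>k. 0 \<le> a k" and "jump_time h n \<le> t"
  shows "survival a h t \<le> reached a h n t"
proof -
  have cell: "in_cell h n (jump_time h n)"
    using h by (simp add: in_cell_def jump_time_Suc)
  have "survival a h t \<le> survival a h (jump_time h n)"
    unfolding survival_def using assms(3)
    by (intro exp_minus_antimono nn_integral_mono) (auto simp: indicator_def)
  also have "\<dots> = reached a h n t"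
    unfolding survival_in_cell[OF h cell a] using assms(3) by (simp add: accrued_def reached_def)
  finally show ?thesis .
qed

lemma survival_bounds: "0 \<le> survival a h t" "survival a h t \<le> 1"
  by (simp_all add: survival_def exp_minus_def)

text \<open>
  Survival exceeds the sum of \<open>alive\<close> only on exploded paths, and there it is at most \<open>reached\<close> for
  every \<open>m\<close>.
\<close>
lemma survival_between:
  assumes h: "\<forall>k. 0 < h k" and a: "\<forall>k. 0 \<le> a k" and t: "0 \<le> t"
  shows "(\<Sum>k. ennreal (alive a h k t)) \<le> ennreal (survival a h t)"
    and "ennreal (survival a h t) \<le> (\<Sum>k. ennreal (alive a h k t)) + ennreal (reached a h m t)"
proof -
  consider n where "in_cell h n t" | "\<And>n. \<not> in_cell h n t" by blast
  then have "(\<Sum>k. ennreal (alive a h k t)) \<le> ennreal (survival a h t) \<and>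
    ennreal (survival a h t) \<le> (\<Sum>k. ennreal (alive a h k t)) + ennreal (reached a h m t)"
  proof cases
    case 1
    show ?thesis unfolding alive_sums_in_cell[OF h 1] survival_in_cell[OF h 1 a] by simp
  next
    case 2
    then have "jump_time h m \<le> t" using ex_in_cell[OF t, of h m] by (auto simp: not_less[symmetric])
    then show ?thesis
      using survival_le_reached[OF h a] by (simp add: alive_sums_exploded[OF 2] ennreal_leI)
  qed
  then show "(\<Sum>k. ennreal (alive a h k t)) \<le> ennreal (survival a h t)"
    "ennreal (survival a h t) \<le> (\<Sum>k. ennreal (alive a h k t)) + ennreal (reached a h m t)" by auto
qed

lemma regular_in_cell: "regular h \<Longrightarrow> 0 \<le> t \<Longrightarrow> \<exists>n. in_cell h n t"
  using ex_in_cell unfolding regular_def by blast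

text \<open>
  On a non-explosive path the hazard rate and the survival function determine each other as usual. The
  telescoping identity for \<open>reached\<close> replaces the fundamental theorem of calculus at the jumps.
\<close>
lemma survival_density:
  assumes h: "regular h" and a: "\<forall>k. 0 \<le> a k" and t: "0 \<le> t"
  shows "ennreal (survival a h t)
    + (\<integral>\<^sup>+s\<in>{0..t}. ennreal (a (counting h s) * survival a h s) \<partial>lborel) = 1"
proof -
  have pos: "\<forall>k. 0 < h k" using h by (simp add: regular_def)
  obtain m where m: "t < jump_time h m" using h by (auto simp: regular_def)
  have single: "(\<Sum>n<m. f n * alive a h n s) = f (counting h s) * survival a h s"
    if s: "0 \<le> s" "s \<le> t" for s and f :: "nat \<Rightarrow> real"
  proof -
    obtain n where n: "n < m" "in_cell h n s" using ex_in_cell[of s h m] s m by auto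
    have "f k * alive a h k s = (if k = n then f n * alive a h n s else 0)" for k
    proof (cases "k = n")
      case False
      then have "\<not> in_cell h k s" using in_cell_unique[OF pos n(2)] by blast
      then show ?thesis using False by (simp add: alive_def)
    qed simp
    then show ?thesis
      using n by (simp add: counting_in_cell[OF pos n(2)] survival_in_cell[OF pos n(2) a] alive_def)
  qed
  have [measurable]: "alive a h n \<in> borel_measurable borel" for n
    unfolding alive_def[abs_def] in_cell_def accrued_def by measurable
  have "(\<Sum>n<m. killed a h n t)
      = (\<integral>\<^sup>+s. (\<Sum>n<m. ennreal (a n * alive a h n s) * indicator {0..t} s) \<partial>lborel)"
    unfolding killed_def by (intro nn_integral_sum[symmetric]) simp
  also have "\<dots> = (\<integral>\<^sup>+s\<in>{0..t}. ennreal (a (counting h s) * survival a h s) \<partial>lborel)"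
  proof (intro nn_integral_cong)
    fix s
    show "(\<Sum>n<m. ennreal (a n * alive a h n s) * indicator {0..t} s)
      = ennreal (a (counting h s) * survival a h s) * indicator {0..t} s"
      using a single[of s a] by (auto simp: indicator_def sum_ennreal)
  qed
  finally have "(\<Sum>n<m. killed a h n t)
    = (\<integral>\<^sup>+s\<in>{0..t}. ennreal (a (counting h s) * survival a h s) \<partial>lborel)" .
  moreover have "(\<Sum>n<m. ennreal (alive a h n t)) = ennreal (survival a h t)"
    using single[of t "\<lambda>_. 1"] t by (simp add: sum_ennreal)
  moreover have "reached a h m t = 0" using m by (simp add: reached_def)
  ultimately show ?thesis
    using sum_alive_killed_reached[OF pos a t, of m] by (simp add: sum.distrib)
qed

abbreviation seq_space :: "(nat \<Rightarrow> real) measure" where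
  "seq_space \<equiv> \<Pi>\<^sub>M n\<in>UNIV. borel"

lemma measurable_indicator_Icc [measurable (raw)]:
  fixes f g :: "'a \<Rightarrow> real"
  assumes [measurable]: "f \<in> borel_measurable K" "g \<in> borel_measurable K"
  shows "(\<lambda>x. indicator {0..f x} (g x) :: ennreal) \<in> borel_measurable K"
  unfolding indicator_def atLeastAtMost_iff by measurable

lemma measurable_counting [measurable (raw)]:
  assumes [measurable]: "f \<in> measurable K seq_space" "g \<in> borel_measurable K"
  shows "(\<lambda>x. counting (f x) (g x)) \<in> measurable K (count_space UNIV)"
  unfolding counting_eq by measurable

lemma measurable_in_cell [measurable (raw)]:
  assumes [measurable]: "f \<in> measurable K seq_space" "g \<in> borel_measurable K"
  shows "Measurable.pred K (\<lambda>x. in_cell (f x) n (g x))"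
  unfolding in_cell_def by measurable

lemma measurable_accrued [measurable (raw)]:
  assumes [measurable]: "f \<in> measurable K seq_space" "g \<in> borel_measurable K"
  shows "(\<lambda>x. accrued a (f x) n (g x)) \<in> borel_measurable K"
  unfolding accrued_def by measurable

lemma measurable_alive [measurable (raw)]:
  assumes [measurable]: "f \<in> measurable K seq_space" "g \<in> borel_measurable K"
  shows "(\<lambda>x. alive a (f x) n (g x)) \<in> borel_measurable K"
  unfolding alive_def by measurable

lemma measurable_reached [measurable (raw)]:
  assumes [measurable]: "f \<in> measurable K seq_space" "g \<in> borel_measurable K"
  shows "(\<lambda>x. reached a (f x) n (g x)) \<in> borel_measurable K"
  unfolding reached_def by measurable

lemma measurable_killed [measurable (raw)]:
  assumes [measurable]: "f \<in> measurable K seq_space" "g \<in> borel_measurable K"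
  shows "(\<lambda>x. killed a (f x) n (g x)) \<in> borel_measurable K"
  unfolding killed_def by measurable

lemma measurable_exp_minus [measurable]: "exp_minus \<in> borel_measurable borel"
  unfolding exp_minus_def[abs_def] by measurable

lemma measurable_survival [measurable (raw)]:
  assumes [measurable]: "f \<in> measurable K seq_space" "g \<in> borel_measurable K"
  shows "(\<lambda>x. survival a (f x) (g x)) \<in> borel_measurable K"
proof -
  have "(\<lambda>x. \<integral>\<^sup>+s\<in>{0..g x}. ennreal (a (counting (f x) s)) \<partial>lborel) \<in> borel_measurable K"
    by measurable
  then show ?thesis unfolding survival_def by measurable
qed

section \<open>Expectations over the holding times\<close>

lemma nn_integral_holding_coordinate:
  fixes f :: "real \<Rightarrow> ennreal"
  assumes l: "\<forall>n. 0 < l n" and [measurable]: "f \<in> borel_measurable borel"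
  shows "(\<integral>\<^sup>+h. f (h n) \<partial>exp_holding l) = (\<integral>\<^sup>+x. exponential_density (l n) x * f x \<partial>lborel)"
proof -
  interpret E: prob_space "exp_holding l" by (rule prob_space_exp_holding[OF l])
  have "(\<integral>\<^sup>+h. (\<lambda>(h, x). f x) (h, h n) \<partial>exp_holding l)
    = (\<integral>\<^sup>+h. (\<integral>\<^sup>+x. exponential_density (l n) x * (\<lambda>(h, x). f x) (h, x) \<partial>lborel) \<partial>exp_holding l)"
    by (rule nn_integral_next_holding[OF l]) auto
  then show ?thesis using E.emeasure_space_1 by simp
qed

lemma AE_holding_pos:
  assumes l: "\<forall>n. 0 < l n"
  shows "AE h in exp_holding l. \<forall>n. 0 < h n"
  unfolding AE_all_countable
proof
  fix n
  have [measurable]: "{h. \<not> 0 < h n} \<in> sets (exp_holding l)"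
  proof -
    have "{h \<in> space (exp_holding l). \<not> 0 < h n} \<in> sets (exp_holding l)" by measurable
    then show ?thesis by simp
  qed
  have "emeasure (exp_holding l) {h. \<not> 0 < h n} = (\<integral>\<^sup>+h. indicator {..0} (h n) \<partial>exp_holding l)"
    by (subst nn_integral_indicator[symmetric], simp, intro nn_integral_cong)
      (auto simp: indicator_def)
  also have "\<dots> = (\<integral>\<^sup>+x. ennreal (exponential_density (l n) x) * indicator {..0} x \<partial>lborel)"
    by (rule nn_integral_holding_coordinate[OF l]) simp
  also have "\<dots> = (\<integral>\<^sup>+x. 0 \<partial>(lborel :: real measure))"
  proof (rule nn_integral_cong_AE)
    show "AE x in lborel. ennreal (exponential_density (l n) x) * indicator {..0} x = 0"
      using AE_lborel_singleton[of 0]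
      by eventually_elim (auto simp: indicator_def exponential_density_def)
  qed
  finally show "AE h in exp_holding l. 0 < h n"
    by (subst AE_iff_measurable[of "{h. \<not> 0 < h n}"]) simp_all
qed

lemma nn_integral_exponential_tail:
  assumes l: "0 < (l::real)" and u: "0 \<le> u"
  shows "(\<integral>\<^sup>+x. ennreal (exponential_density l x) * indicator {u<..} x \<partial>lborel) = ennreal (exp (- (l * u)))"
proof -
  interpret X: prob_space "density lborel (exponential_density l)"
    by (rule prob_space_exponential_density[OF l])
  have "(\<integral>\<^sup>+x. ennreal (exponential_density l x) * indicator {u<..} x \<partial>lborel)
     = emeasure (density lborel (exponential_density l)) {u<..}"
    by (subst emeasure_density) (auto intro!: nn_integral_cong simp: indicator_def)
  also have "\<dots> = ennreal (exp (- (l * u)))"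
    using X.exponential_distributedD_gt[of "\<lambda>x. x" l u] l u
    by (simp add: X.emeasure_eq_measure distributed_def distr_id2 mult.commute greaterThan_def)
  finally show ?thesis .
qed

text \<open>
  The event \<open>in_cell h n t\<close> involves the holding time \<open>h n\<close> only through \<open>t - jump_time h n < h n\<close>, whose
  probability \<open>exp (- l n * (t - jump_time h n))\<close> turns the rate \<open>\<alpha> n\<close> into \<open>\<alpha> n + l n\<close>.
\<close>
lemma nn_integral_tilt_cell:
  assumes l: "\<forall>n. 0 < l n" and \<rho>: "\<forall>n. 0 \<le> \<rho> n"
  shows "(\<integral>\<^sup>+h. ennreal (tilt \<rho> \<alpha> h n) * (ennreal (exp (- (\<alpha> n * (t - jump_time h n)))) * indicator {h. in_cell h n t} h) \<partial>exp_holding l)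
    = (\<integral>\<^sup>+h. ennreal (tilt \<rho> \<alpha> h n) * (ennreal (exp (- ((\<alpha> n + l n) * (t - jump_time h n)))) * indicator {..t} (jump_time h n)) \<partial>exp_holding l)"
proof -
  define f where "f = (\<lambda>(h, x). ennreal (tilt \<rho> \<alpha> h n) * (ennreal (exp (- (\<alpha> n * (t - jump_time h n))))
    * (indicator {..t} (jump_time h n) * indicator {t - jump_time h n<..} x)))"
  have [measurable]: "f \<in> borel_measurable (seq_space \<Otimes>\<^sub>M borel)"
    unfolding f_def indicator_def greaterThan_iff atMost_iff by measurable
  have past: "f (h, x) = f (h', x)" if "\<And>k. k < n \<Longrightarrow> h k = h' k" for h h' x
    using tilt_past[of n h h' \<rho> \<alpha>, OF that] jump_time_past[of n h h', OF that] by (simp add: f_def)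
  have "(\<integral>\<^sup>+h. ennreal (tilt \<rho> \<alpha> h n) * (ennreal (exp (- (\<alpha> n * (t - jump_time h n)))) * indicator {h. in_cell h n t} h) \<partial>exp_holding l)
    = (\<integral>\<^sup>+h. f (h, h n) \<partial>exp_holding l)"
    by (intro nn_integral_cong) (auto simp: f_def in_cell_def jump_time_Suc indicator_def)
  also have "\<dots> = (\<integral>\<^sup>+h. (\<integral>\<^sup>+x. exponential_density (l n) x * f (h, x) \<partial>lborel) \<partial>exp_holding l)"
    by (intro nn_integral_next_holding l past) measurable
  also have "\<dots> = (\<integral>\<^sup>+h. ennreal (tilt \<rho> \<alpha> h n) * (ennreal (exp (- ((\<alpha> n + l n) * (t - jump_time h n)))) * indicator {..t} (jump_time h n)) \<partial>exp_holding l)"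
  proof (intro nn_integral_cong)
    fix h :: "nat \<Rightarrow> real"
    define u where "u = t - jump_time h n"
    have "(\<integral>\<^sup>+x. exponential_density (l n) x * f (h, x) \<partial>lborel)
      = (\<integral>\<^sup>+x. (ennreal (tilt \<rho> \<alpha> h n) * (ennreal (exp (- (\<alpha> n * u))) * indicator {..t} (jump_time h n)))
          * (ennreal (exponential_density (l n) x) * indicator {u<..} x) \<partial>lborel)"
      by (intro nn_integral_cong) (simp add: f_def u_def ac_simps)
    also have "\<dots> = (ennreal (tilt \<rho> \<alpha> h n) * (ennreal (exp (- (\<alpha> n * u))) * indicator {..t} (jump_time h n)))
          * (\<integral>\<^sup>+x. ennreal (exponential_density (l n) x) * indicator {u<..} x \<partial>lborel)"
      by (intro nn_integral_cmult) simp
    also have "\<dots> = ennreal (tilt \<rho> \<alpha> h n) * (ennreal (exp (- ((\<alpha> n + l n) * u))) * indicator {..t} (jump_time h n))"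
    proof (cases "0 \<le> u")
      case True
      have "exp (- ((\<alpha> n + l n) * u)) = exp (- (\<alpha> n * u)) * exp (- (l n * u))"
        by (simp add: algebra_simps flip: exp_add)
      then show ?thesis using nn_integral_exponential_tail[of "l n" u] l True
        by (simp add: ennreal_mult' ac_simps)
    qed (simp add: u_def)
    finally show "(\<integral>\<^sup>+x. exponential_density (l n) x * f (h, x) \<partial>lborel)
      = ennreal (tilt \<rho> \<alpha> h n) * (ennreal (exp (- ((\<alpha> n + l n) * (t - jump_time h n)))) * indicator {..t} (jump_time h n))"
      by (simp add: u_def)
  qed
  finally show ?thesis .
qed

lemma alive_eq_tilt:
  "ennreal (alive a h n t) = ennreal (tilt (\<lambda>_. 1) a h n) *
    (ennreal (exp (- (a n * (t - jump_time h n)))) * indicator {h. in_cell h n t} h)"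
proof -
  have "exp (- accrued a h n t) = tilt (\<lambda>_. 1) a h n * exp (- (a n * (t - jump_time h n)))"
    by (simp add: accrued_def tilt_def exp_add[symmetric] exp_sum[symmetric] sum_negf)
  then show ?thesis by (simp add: alive_def indicator_def ennreal_mult tilt_nonneg)
qed

text \<open>
  Tilting is a change of intensities from \<open>l\<close> to \<open>l'\<close> combined with killing at rate \<open>a\<close>.
\<close>
lemma nn_integral_tilt_alive:
  assumes l: "\<forall>n. 0 < l n" "\<forall>n. 0 < l' n" and \<rho>: "\<forall>n. 0 \<le> \<rho> n"
    and intensity: "\<forall>n. \<rho> n * l n = l' n" and decay: "\<forall>n. \<alpha> n + l n = a n + l' n"
  shows "(\<integral>\<^sup>+h. ennreal (tilt \<rho> \<alpha> h n) * (ennreal (exp (- (\<alpha> n * (t - jump_time h n)))) * indicator {h. in_cell h n t} h) \<partial>exp_holding l)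
    = (\<integral>\<^sup>+h. alive a h n t \<partial>exp_holding l')"
proof -
  define \<phi> :: "real \<Rightarrow> ennreal" where "\<phi> s = ennreal (exp (- ((a n + l' n) * (t - s)))) * indicator {..t} s" for s
  have [measurable]: "\<phi> \<in> borel_measurable borel" unfolding \<phi>_def by measurable
  have "(\<integral>\<^sup>+h. ennreal (tilt \<rho> \<alpha> h n) * (ennreal (exp (- (\<alpha> n * (t - jump_time h n)))) * indicator {h. in_cell h n t} h) \<partial>exp_holding l)
    = (\<integral>\<^sup>+h. ennreal (tilt \<rho> \<alpha> h n) * \<phi> (jump_time h n) \<partial>exp_holding l)"
    unfolding nn_integral_tilt_cell[OF l(1) \<rho>] using decay by (simp add: \<phi>_def)
  also have "\<dots> = (\<integral>\<^sup>+h. ennreal (tilt (\<lambda>_. 1) a h n) * \<phi> (jump_time h n) \<partial>exp_holding l')"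
    using intensity decay by (intro nn_integral_tilt_cong l \<rho>) auto
  also have "\<dots> = (\<integral>\<^sup>+h. ennreal (tilt (\<lambda>_. 1) a h n) * (ennreal (exp (- (a n * (t - jump_time h n)))) * indicator {h. in_cell h n t} h) \<partial>exp_holding l')"
    unfolding \<phi>_def by (rule nn_integral_tilt_cell[OF l(2), symmetric]) simp
  finally show ?thesis by (simp only: alive_eq_tilt)
qed

text \<open>
  The Laplace transform at \<open>1\<close>, as another instance of tilting: \<open>exp (- h k)\<close> changes the rate \<open>l k\<close> into
  \<open>1 + l k\<close> at the cost of the factor \<open>l k / (1 + l k)\<close>.
\<close>
lemma nn_integral_exp_jump_time:
  assumes l: "\<forall>n. 0 < l n"
  shows "(\<integral>\<^sup>+h. ennreal (exp (- jump_time h n)) \<partial>exp_holding l) = ennreal (\<Prod>k<n. l k / (1 + l k))"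
proof -
  have l': "\<forall>n. 0 < 1 + l n" using l by (simp add: add_pos_pos)
  interpret E: prob_space "exp_holding (\<lambda>n. 1 + l n)" by (rule prob_space_exp_holding[OF l'])
  have "(\<integral>\<^sup>+h. ennreal (exp (- jump_time h n)) \<partial>exp_holding l)
    = (\<integral>\<^sup>+h. ennreal (tilt (\<lambda>_. 1) (\<lambda>_. 1) h n) * 1 \<partial>exp_holding l)"
    by (simp add: tilt_def jump_time_def exp_sum[symmetric] sum_negf)
  also have "\<dots> = (\<integral>\<^sup>+h. ennreal (tilt (\<lambda>n. l n / (1 + l n)) (\<lambda>_. 0) h n) * 1 \<partial>exp_holding (\<lambda>n. 1 + l n))"
    using l l' by (intro nn_integral_tilt_cong) (auto simp: less_imp_le less_imp_neq[symmetric])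
  also have "\<dots> = ennreal (\<Prod>k<n. l k / (1 + l k))"
    using E.emeasure_space_1 by (simp add: tilt_def)
  finally show ?thesis .
qed

lemma prod_ratio_tendsto_0:
  assumes l: "\<forall>n. 0 < l n" and div: "\<not> summable (\<lambda>n. 1 / l n)"
  shows "(\<lambda>n. \<Prod>k<n. l k / (1 + l k) :: real) \<longlonglongrightarrow> 0"
proof (rule tendsto_sandwich)
  show "\<forall>\<^sub>F n in sequentially. 0 \<le> (\<Prod>k<n. l k / (1 + l k))"
    using l by (intro always_eventually allI prod_nonneg) (simp add: less_imp_le add_nonneg_nonneg)
  have "(\<Prod>k<n. l k / (1 + l k)) \<le> inverse (\<Sum>k<n. 1 / l k)" if n: "0 < n" for n
  proof -
    have s: "0 < (\<Sum>k<n. 1 / l k)" using l n by (intro sum_pos) auto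
    have *: "(\<Sum>k<n. 1 / l k) \<le> (\<Prod>k<n. 1 + 1 / l k)"
      using l by (intro sum_le_prod) (simp add: less_imp_le)
    have "l k / (1 + l k) = inverse (1 + 1 / l k)" for k
      using l[rule_format, of k] by (simp add: field_simps)
    then have "(\<Prod>k<n. l k / (1 + l k)) = inverse (\<Prod>k<n. 1 + 1 / l k)"
      using prod_inversef[of "\<lambda>k. 1 + 1 / l k" "{..<n}"] by (simp add: o_def)
    also have "\<dots> \<le> inverse (\<Sum>k<n. 1 / l k)" using * s by (intro le_imp_inverse_le)
    finally show ?thesis .
  qed
  then show "\<forall>\<^sub>F n in sequentially. (\<Prod>k<n. l k / (1 + l k)) \<le> inverse (\<Sum>k<n. 1 / l k)"
    by (intro eventually_sequentiallyI[of 1]) simp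
  have "filterlim (\<lambda>n. \<Sum>k<n. 1 / l k) at_top sequentially"
  proof -
    have bound: "\<exists>m. c \<le> (\<Sum>k<m. 1 / l k)" for c
    proof (rule ccontr)
      assume "\<not> (\<exists>m. c \<le> (\<Sum>k<m. 1 / l k))"
      then have "(\<Sum>k<m. 1 / l k) \<le> c" for m by (simp add: not_le less_imp_le)
      then have "summable (\<lambda>n. 1 / l n)"
        using l by (intro summableI_nonneg_bounded) (simp_all add: less_imp_le)
      then show False using div by simp
    qed
    have mono: "(\<Sum>k<m. 1 / l k) \<le> (\<Sum>k<n. 1 / l k)" if "m \<le> n" for m n
      using that l by (intro sum_mono2) (auto simp: less_imp_le)
    show ?thesis
      unfolding filterlim_at_top eventually_sequentially
    proof
      fix c
      obtain m where "c \<le> (\<Sum>k<m. 1 / l k)" using bound by blast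
      then show "\<exists>m. \<forall>n\<ge>m. c \<le> (\<Sum>k<n. 1 / l k)"
        using mono by (intro exI[of _ m]) fastforce
    qed
  qed
  then show "(\<lambda>n. inverse (\<Sum>k<n. 1 / l k)) \<longlonglongrightarrow> 0"
    by (rule tendsto_inverse_0_at_top)
qed simp

text \<open>
  The Laplace transforms of the jump times tend to \<open>0\<close>, so by Markov's inequality the jump times exceed
  every bound.
\<close>
lemma AE_regular:
  assumes l: "\<forall>n. 0 < l n" and div: "\<not> summable (\<lambda>n. 1 / l n)"
  shows "AE h in exp_holding l. regular h"
proof -
  have "AE h in exp_holding l. \<exists>n. real i < jump_time h n" for i :: nat
  proof -
    define A where "A = {h \<in> space (exp_holding l). \<not> (\<exists>n. real i < jump_time h n)}"
    have [measurable]: "A \<in> sets (exp_holding l)" unfolding A_def by measurable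
    have "emeasure (exp_holding l) A \<le> ennreal (exp i) * ennreal (\<Prod>k<n. l k / (1 + l k))" for n
    proof -
      have "emeasure (exp_holding l) A = (\<integral>\<^sup>+h. indicator A h \<partial>exp_holding l)" by simp
      also have "\<dots> \<le> (\<integral>\<^sup>+h. ennreal (exp i) * ennreal (exp (- jump_time h n)) \<partial>exp_holding l)"
      proof (intro nn_integral_mono)
        fix h
        have "1 \<le> exp (real i - jump_time h n)" if "h \<in> A"
          using that by (simp add: A_def not_less)
        then show "indicator A h \<le> ennreal (exp i) * ennreal (exp (- jump_time h n))"
          by (auto simp: indicator_def ennreal_mult[symmetric] exp_add[symmetric] one_ennreal_def[symmetric] simp flip: ennreal_1 intro!: ennreal_leI)
      qed
      also have "\<dots> = ennreal (exp i) * ennreal (\<Prod>k<n. l k / (1 + l k))"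
        by (subst nn_integral_cmult) (auto simp: nn_integral_exp_jump_time[OF l])
      finally show ?thesis .
    qed
    moreover have "(\<lambda>n. ennreal (exp i) * ennreal (\<Prod>k<n. l k / (1 + l k))) \<longlonglongrightarrow> ennreal (exp i) * ennreal 0"
      by (intro ennreal_tendsto_cmult tendsto_ennrealI prod_ratio_tendsto_0 l div) simp
    ultimately have "emeasure (exp_holding l) A \<le> 0"
      by (intro LIMSEQ_le_const[where X = "\<lambda>n. ennreal (exp i) * ennreal (\<Prod>k<n. l k / (1 + l k))"]) auto
    then show ?thesis by (subst AE_iff_measurable[OF _ A_def[symmetric]]) auto
  qed
  then have "AE h in exp_holding l. \<forall>i::nat. \<exists>n. real i < jump_time h n"
    by (simp add: AE_all_countable)
  with AE_holding_pos[OF l] show ?thesis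
  proof eventually_elim
    case (elim h)
    have "\<exists>n. t < jump_time h n" for t
    proof -
      obtain i :: nat where "t \<le> real i" using real_arch_simple by blast
      moreover obtain n where "real i < jump_time h n" using elim by blast
      ultimately show ?thesis by (intro exI[of _ n]) simp
    qed
    then show ?case using elim by (simp add: regular_def)
  qed
qed

definition alive_mass :: "(nat \<Rightarrow> real) \<Rightarrow> (nat \<Rightarrow> real) \<Rightarrow> real \<Rightarrow> ennreal" where
  "alive_mass l a t = (\<integral>\<^sup>+h. (\<Sum>n. ennreal (alive a h n t)) \<partial>exp_holding l)"

definition killed_mass :: "(nat \<Rightarrow> real) \<Rightarrow> (nat \<Rightarrow> real) \<Rightarrow> real \<Rightarrow> ennreal" where
  "killed_mass l a t = (\<integral>\<^sup>+h. (\<Sum>n. killed a h n t) \<partial>exp_holding l)"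

text \<open>
  The deficit of the first \<open>m\<close> terms is the mass of the paths that make \<open>m\<close> jumps unkilled. In the
  limit this is the mass of the paths that explode unkilled, which is why \<open>mass_le_1\<close> is an
  inequality.
\<close>
lemma partial_mass_balance:
  assumes l: "\<forall>n. 0 < l n" and a: "\<forall>n. 0 \<le> a n" and t: "0 \<le> t"
  shows "(\<integral>\<^sup>+h. (\<Sum>n<m. ennreal (alive a h n t) + killed a h n t) \<partial>exp_holding l)
    + (\<integral>\<^sup>+h. reached a h m t \<partial>exp_holding l) = 1"
proof -
  interpret E: prob_space "exp_holding l" by (rule prob_space_exp_holding[OF l])
  have "(\<integral>\<^sup>+h. (\<Sum>n<m. ennreal (alive a h n t) + killed a h n t) \<partial>exp_holding l)
    + (\<integral>\<^sup>+h. reached a h m t \<partial>exp_holding l)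
    = (\<integral>\<^sup>+h. (\<Sum>n<m. ennreal (alive a h n t) + killed a h n t) + ennreal (reached a h m t) \<partial>exp_holding l)"
    by (intro nn_integral_add[symmetric]) measurable
  also have "\<dots> = (\<integral>\<^sup>+h. 1 \<partial>exp_holding l)"
    using AE_holding_pos[OF l]
    by (intro nn_integral_cong_AE) (auto elim!: eventually_mono simp: sum_alive_killed_reached[OF _ a t])
  finally show ?thesis using E.emeasure_space_1 by simp
qed

lemma mass_limit:
  shows "(\<lambda>m. \<integral>\<^sup>+h. (\<Sum>n<m. ennreal (alive a h n t) + killed a h n t) \<partial>exp_holding l)
    \<longlonglongrightarrow> alive_mass l a t + killed_mass l a t"
proof -
  have "alive_mass l a t + killed_mass l a t
    = (\<integral>\<^sup>+h. (\<Sum>n. ennreal (alive a h n t)) + (\<Sum>n. killed a h n t) \<partial>exp_holding l)"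
    unfolding alive_mass_def killed_mass_def by (intro nn_integral_add[symmetric]) measurable
  also have "\<dots> = (\<integral>\<^sup>+h. (\<Sum>n. ennreal (alive a h n t) + killed a h n t) \<partial>exp_holding l)"
    by (subst suminf_add) (auto intro: summableI)
  finally show ?thesis
    by (simp add: nn_integral_suminf nn_integral_sum summable_LIMSEQ)
qed

lemma mass_le_1:
  assumes "\<forall>n. 0 < l n" and "\<forall>n. 0 \<le> a n" and "0 \<le> t"
  shows "alive_mass l a t + killed_mass l a t \<le> 1"
proof (rule LIMSEQ_le_const2[OF mass_limit], intro exI allI impI)
  fix m :: nat
  show "(\<integral>\<^sup>+h. (\<Sum>n<m. ennreal (alive a h n t) + killed a h n t) \<partial>exp_holding l) \<le> 1"
    unfolding partial_mass_balance[OF assms, of m, symmetric] by simp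
qed

text \<open>
  If the masses add up to \<open>1\<close>, no mass is left for unkilled explosion, and exploded paths do not
  contribute to the expected survival either.
\<close>
lemma expected_survival:
  assumes l: "\<forall>n. 0 < l n" and a: "\<forall>n. 0 \<le> a n" and t: "0 \<le> t"
    and full: "alive_mass l a t + killed_mass l a t = 1"
  shows "(\<integral>\<^sup>+h. survival a h t \<partial>exp_holding l) = alive_mass l a t"
proof (rule antisym)
  define u where "u m = (\<integral>\<^sup>+h. reached a h m t \<partial>exp_holding l)" for m
  define p where "p m = (\<integral>\<^sup>+h. (\<Sum>n<m. ennreal (alive a h n t) + killed a h n t) \<partial>exp_holding l)" for m
  have pu: "p m + u m = 1" for m
    using partial_mass_balance[OF l a t] by (simp add: p_def u_def)
  have "u m = 1 - p m" for m
  proof -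
    have "p m \<noteq> \<top>" using pu[of m] by auto
    then have "p m + u m - p m = u m" by (rule ennreal_add_diff_cancel_left)
    then show ?thesis by (simp add: pu)
  qed
  then have "u = (\<lambda>m. 1 - p m)" by blast
  moreover have "(\<lambda>m. 1 - p m) \<longlonglongrightarrow> 1 - 1"
    using mass_limit[where a = a and l = l and t = t] full unfolding p_def[symmetric]
    by (intro tendsto_diff_ennreal) auto
  ultimately have u: "u \<longlonglongrightarrow> 0" by simp
  have "(\<integral>\<^sup>+h. survival a h t \<partial>exp_holding l) \<le> alive_mass l a t + u m" for m
  proof -
    have "(\<integral>\<^sup>+h. survival a h t \<partial>exp_holding l)
      \<le> (\<integral>\<^sup>+h. (\<Sum>n. ennreal (alive a h n t)) + ennreal (reached a h m t) \<partial>exp_holding l)"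
      using AE_holding_pos[OF l]
      by (intro nn_integral_mono_AE) (auto elim!: eventually_mono intro!: survival_between(2) a t)
    also have "\<dots> = alive_mass l a t + u m"
      unfolding alive_mass_def u_def by (intro nn_integral_add) measurable
    finally show ?thesis .
  qed
  moreover have "(\<lambda>m. alive_mass l a t + u m) \<longlonglongrightarrow> alive_mass l a t + 0"
    by (intro tendsto_add u tendsto_const)
  ultimately show "(\<integral>\<^sup>+h. survival a h t \<partial>exp_holding l) \<le> alive_mass l a t"
    by (intro LIMSEQ_le_const[where X = "\<lambda>m. alive_mass l a t + u m"]) auto
  show "alive_mass l a t \<le> (\<integral>\<^sup>+h. survival a h t \<partial>exp_holding l)"
    unfolding alive_mass_def using AE_holding_pos[OF l]
    by (intro nn_integral_mono_AE) (auto elim!: eventually_mono intro!: survival_between(1) a t)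
qed

lemma alive_sum_le_1:
  assumes "\<forall>k. 0 < h k" "\<forall>k. 0 \<le> a k"
  shows "(\<Sum>k. ennreal (alive a h k t)) \<le> 1"
proof (cases "\<exists>n. in_cell h n t")
  case True
  then obtain n where n: "in_cell h n t" by blast
  have "exp (- accrued a h n t) \<le> 1"
    using survival_bounds(2)[of a h t] unfolding survival_in_cell[OF assms(1) n assms(2)] .
  then show ?thesis unfolding alive_sums_in_cell[OF assms(1) n] by simp
next
  case False
  then show ?thesis by (subst alive_sums_exploded) auto
qed

text \<open>
  Right limits suffice below because switching times are rounded up; from the right, a path stays in its
  cell for a while, and an exploded path stays exploded.
\<close>
lemma alive_mass_right_continuous:
  assumes l: "\<forall>n. 0 < l n" and a: "\<forall>n. 0 \<le> a n" and t: "0 \<le> t"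
    and d: "d \<longlonglongrightarrow> 0" "\<And>i. 0 \<le> d i"
  shows "(\<lambda>i. alive_mass l a (t + d i)) \<longlonglongrightarrow> alive_mass l a t"
  unfolding alive_mass_def
proof (rule nn_integral_dominated_convergence[where w = "\<lambda>_. 1"])
  interpret E: prob_space "exp_holding l" by (rule prob_space_exp_holding[OF l])
  show "AE h in exp_holding l. (\<Sum>n. ennreal (alive a h n (t + d i))) \<le> 1" for i
    using AE_holding_pos[OF l] by (auto elim!: eventually_mono intro!: alive_sum_le_1 a)
  show "(\<integral>\<^sup>+h. 1 \<partial>exp_holding l) < \<infinity>" using E.emeasure_space_1 by simp
  show "AE h in exp_holding l.
    (\<lambda>i. \<Sum>n. ennreal (alive a h n (t + d i))) \<longlonglongrightarrow> (\<Sum>n. ennreal (alive a h n t))"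
    using AE_holding_pos[OF l]
  proof eventually_elim
    case (elim h)
    show ?case
    proof (cases "\<exists>n. in_cell h n t")
      case True
      then obtain n where n: "in_cell h n t" by blast
      have "(\<lambda>i. t + d i) \<longlonglongrightarrow> t + 0" by (intro tendsto_add d tendsto_const)
      moreover have "t + 0 < jump_time h (Suc n)" using n by (simp add: in_cell_def)
      ultimately have "\<forall>\<^sub>F i in sequentially. t + d i < jump_time h (Suc n)"
        by (rule order_tendstoD)
      then have "\<forall>\<^sub>F i in sequentially. in_cell h n (t + d i)"
      proof eventually_elim
        case (elim i)
        then show ?case using n d(2)[of i] by (simp add: in_cell_def)
      qed
      then have "\<forall>\<^sub>F i in sequentially. ennreal (exp (- accrued a h n (t + d i)))
          = (\<Sum>n. ennreal (alive a h n (t + d i)))"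
        by eventually_elim (rule alive_sums_in_cell[OF elim, symmetric])
      moreover have "(\<lambda>i. ennreal (exp (- accrued a h n (t + d i)))) \<longlonglongrightarrow> ennreal (exp (- accrued a h n (t + 0)))"
        unfolding accrued_def by (intro tendsto_ennrealI tendsto_intros d)
      ultimately show ?thesis unfolding alive_sums_in_cell[OF elim n] by (auto intro: Lim_transform_eventually)
    next
      case False
      have "\<not> in_cell h n (t + d i)" for n i
        using ex_in_cell[OF t, of h "Suc n"] False d(2)[of i] by (fastforce simp: in_cell_def)
      then have "(\<Sum>n. ennreal (alive a h n (t + d i))) = 0" for i by (rule alive_sums_exploded)
      moreover have "(\<Sum>n. ennreal (alive a h n t)) = 0"
        using False by (intro alive_sums_exploded) blast
      ultimately show ?thesis by (simp only: tendsto_const)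
    qed
  qed
qed measurable

lemma alive_mass_measurable:
  assumes "\<forall>n. 0 < l n"
  shows "alive_mass l a \<in> borel_measurable borel"
proof -
  interpret E: prob_space "exp_holding l" by (rule prob_space_exp_holding[OF assms])
  show ?thesis unfolding alive_mass_def[abs_def] by measurable
qed

lemma alive_mass_0:
  assumes l: "\<forall>n. 0 < l n"
  shows "alive_mass l a 0 = 1"
proof -
  interpret E: prob_space "exp_holding l" by (rule prob_space_exp_holding[OF l])
  have "alive_mass l a 0 = (\<integral>\<^sup>+h. 1 \<partial>exp_holding l)"
    unfolding alive_mass_def
  proof (rule nn_integral_cong_AE)
    show "AE h in exp_holding l. (\<Sum>n. ennreal (alive a h n 0)) = 1"
      using AE_holding_pos[OF l]
    proof eventually_elim
      case (elim h)
      then have "in_cell h 0 0" by (simp add: in_cell_def jump_time_Suc)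
      from alive_sums_in_cell[OF elim this] show ?case by (simp add: accrued_def)
    qed
  qed
  then show ?thesis using E.emeasure_space_1 by simp
qed

section \<open>A counting process with its killing time\<close>

text \<open>
  The factor that one stage contributes to the density process by time \<open>t\<close>: velocities \<open>d\<close> in the
  exponent and a factor \<open>\<rho> n\<close> for the jump from \<open>n\<close> to \<open>n + 1\<close>.
\<close>
definition path_weight :: "(nat \<Rightarrow> real) \<Rightarrow> (nat \<Rightarrow> real) \<Rightarrow> (nat \<Rightarrow> real) \<Rightarrow> real \<Rightarrow> real" where
  "path_weight d \<rho> h t = exp (LBINT s:{0..t}. d (counting h s)) * (\<Prod>n=1..counting h t. \<rho> (n - 1))"

lemma measurable_path_weight [measurable (raw)]:
  assumes [measurable]: "f \<in> measurable K seq_space" "g \<in> borel_measurable K"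
  shows "(\<lambda>x. path_weight d \<rho> (f x) (g x)) \<in> borel_measurable K"
proof -
  have "(\<lambda>x. \<integral>s. indicator {0..g x} s *\<^sub>R d (counting (f x) s) \<partial>lborel) \<in> borel_measurable K"
    unfolding indicator_def atLeastAtMost_iff by measurable
  then show ?thesis unfolding path_weight_def set_lebesgue_integral_def by measurable
qed

lemma path_weight_nonneg: "\<forall>n. 0 \<le> \<rho> n \<Longrightarrow> 0 \<le> path_weight d \<rho> h t"
  unfolding path_weight_def by (intro mult_nonneg_nonneg prod_nonneg) auto

text \<open>
  Multiplying by the survival function of the killing time turns the weight into a tilt, with rates
  \<open>\<mu> k - d k\<close>.
\<close>
lemma path_weight_survival:
  assumes h: "\<forall>k. 0 < h k" and n: "in_cell h n t" and \<mu>: "\<forall>k. 0 \<le> \<mu> k"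
  shows "path_weight d \<rho> h t * survival \<mu> h t
    = tilt \<rho> (\<lambda>k. \<mu> k - d k) h n * exp (- ((\<mu> n - d n) * (t - jump_time h n)))"
proof -
  have "(\<Prod>k=1..n. \<rho> (k - 1)) = (\<Prod>k<n. \<rho> k)"
    by (rule prod.reindex_bij_witness[of _ Suc "\<lambda>k. k - 1"]) auto
  then have "path_weight d \<rho> h t * survival \<mu> h t
    = (\<Prod>k<n. \<rho> k) * (exp (accrued d h n t) * exp (- accrued \<mu> h n t))"
    by (simp add: path_weight_def LBINT_counting[OF h n] counting_in_cell[OF h n] survival_in_cell[OF h n \<mu>])
  also have "exp (accrued d h n t) * exp (- accrued \<mu> h n t)
    = exp (\<Sum>k<n. - ((\<mu> k - d k) * h k)) * exp (- ((\<mu> n - d n) * (t - jump_time h n)))"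
    by (simp add: accrued_def exp_add[symmetric] algebra_simps sum_subtractf sum_negf)
  finally show ?thesis by (simp add: tilt_def exp_sum prod.distrib)
qed

text \<open>
  A stage of the market in isolation: a counting process with independent exponential holding times, and
  a time \<open>S\<close> with conditional hazard rate \<open>\<mu> (counting (h \<omega>) s)\<close> at \<open>s\<close>.
\<close>
locale killing_time = prob_space P
  for P :: "'a measure" and h :: "'a \<Rightarrow> nat \<Rightarrow> real" and S :: "'a \<Rightarrow> real"
    and l \<mu> :: "nat \<Rightarrow> real" +
  assumes l_pos: "\<forall>n. 0 < l n" and \<mu>_pos: "\<forall>n. 0 < \<mu> n"
    and nonexplosive: "\<not> summable (\<lambda>n. 1 / l n)"
    and h_rv [measurable]: "h \<in> measurable P seq_space"
    and S_rv [measurable]: "S \<in> borel_measurable P"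
    and S_pos: "\<And>\<omega>. \<omega> \<in> space P \<Longrightarrow> 0 < S \<omega>"
    and h_law: "distr P seq_space h = exp_holding l"
    and S_cond: "\<And>C t. C \<in> sets seq_space \<Longrightarrow> 0 \<le> t \<Longrightarrow>
      emeasure P {\<omega> \<in> space P. h \<omega> \<in> C \<and> t < S \<omega>} = (\<integral>\<^sup>+x. ennreal (survival \<mu> x t) * indicator C x \<partial>exp_holding l)"
begin

lemma nn_integral_alive:
  fixes f :: "(nat \<Rightarrow> real) \<Rightarrow> ennreal"
  assumes [measurable]: "f \<in> borel_measurable seq_space" and t: "0 \<le> t"
  shows "(\<integral>\<^sup>+\<omega>. f (h \<omega>) * indicator {t<..} (S \<omega>) \<partial>P) = (\<integral>\<^sup>+x. f x * survival \<mu> x t \<partial>exp_holding l)"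
proof -
  have "distr (density P (\<lambda>\<omega>. indicator {t<..} (S \<omega>))) seq_space h
      = density (exp_holding l) (\<lambda>x. ennreal (survival \<mu> x t))" (is "?A = ?B")
  proof (rule measure_eqI)
    fix C assume "C \<in> sets ?A"
    then have C [measurable]: "C \<in> sets seq_space" by simp
    have "emeasure ?A C = (\<integral>\<^sup>+\<omega>. indicator {t<..} (S \<omega>) * indicator (h -` C \<inter> space P) \<omega> \<partial>P)"
      by (simp add: emeasure_distr emeasure_density)
    also have "\<dots> = (\<integral>\<^sup>+\<omega>. indicator {\<omega> \<in> space P. h \<omega> \<in> C \<and> t < S \<omega>} \<omega> \<partial>P)"
      by (intro nn_integral_cong) (auto simp: indicator_def)
    also have "\<dots> = emeasure P {\<omega> \<in> space P. h \<omega> \<in> C \<and> t < S \<omega>}" by (intro nn_integral_indicator) measurable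
    also have "\<dots> = emeasure ?B C"
      unfolding S_cond[OF C t] by (subst emeasure_density) (simp_all add: sets_exp_holding C)
    finally show "emeasure ?A C = emeasure ?B C" .
  qed (simp add: sets_exp_holding)
  then have "(\<integral>\<^sup>+x. f x \<partial>?A) = (\<integral>\<^sup>+x. f x \<partial>?B)" by simp
  then show ?thesis
    by (simp add: nn_integral_distr nn_integral_density mult.commute)
qed

lemma AE_regular_path: "AE x in exp_holding l. regular x"
  by (rule AE_regular[OF l_pos nonexplosive])

lemma survival_increment:
  assumes "regular x" "0 \<le> s" "s \<le> t"
  shows "(\<integral>\<^sup>+u. ennreal (\<mu> (counting x u) * survival \<mu> x u) * indicator {s<..t} u \<partial>lborel)
    + survival \<mu> x t = survival \<mu> x s"
proof -
  define I where "I A = (\<integral>\<^sup>+u. ennreal (\<mu> (counting x u) * survival \<mu> x u) * indicator A u \<partial>lborel)" for A :: "real set"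
  have \<mu>0: "\<forall>k. 0 \<le> \<mu> k" using \<mu>_pos by (simp add: less_imp_le)
  have 1: "ennreal (survival \<mu> x s) + I {0..s} = 1"
    unfolding I_def using survival_density[OF assms(1) \<mu>0 assms(2)] .
  have 2: "ennreal (survival \<mu> x t) + I {0..t} = 1"
    unfolding I_def using survival_density[OF assms(1) \<mu>0, of t] assms by simp
  have [measurable]: "(\<lambda>u. x) \<in> measurable borel seq_space" by (intro measurable_const) (simp add: space_PiM)
  have "I {0..t} = (\<integral>\<^sup>+u. ennreal (\<mu> (counting x u) * survival \<mu> x u) * indicator {0..s} u
      + ennreal (\<mu> (counting x u) * survival \<mu> x u) * indicator {s<..t} u \<partial>lborel)"
    unfolding I_def using assms by (intro nn_integral_cong) (auto simp: indicator_def)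
  also have "\<dots> = I {0..s} + I {s<..t}"
    unfolding I_def by (intro nn_integral_add) measurable
  finally have 3: "I {0..t} = I {0..s} + I {s<..t}" .
  have fin: "I {0..s} \<noteq> \<top>" using 1 by auto
  have "I {0..s} + (I {s<..t} + ennreal (survival \<mu> x t)) = I {0..s} + ennreal (survival \<mu> x s)"
    using 1 2 3 by (simp add: ac_simps)
  then have "I {s<..t} + ennreal (survival \<mu> x t) = ennreal (survival \<mu> x s)"
    using fin by (simp add: ennreal_add_left_cancel)
  then show ?thesis by (simp add: I_def)
qed

text \<open>
  The joint law of holding times and killing time has a density. It is identified on the
  rectangles \<open>C \<times> {y<..}\<close>, which generate the product \<open>\<sigma>\<close>-algebra and form a \<open>\<pi>\<close>-system. Truncation at
  \<open>t\<close> leaves the behaviour of the hazard at infinity out of the argument.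
\<close>
lemma truncated_law:
  assumes t: "0 \<le> t"
  shows "density (distr P (seq_space \<Otimes>\<^sub>M borel) (\<lambda>\<omega>. (h \<omega>, S \<omega>))) (\<lambda>(x, s). indicator {..t} s)
    = density (exp_holding l \<Otimes>\<^sub>M lborel)
        (\<lambda>(x, s). ennreal (\<mu> (counting x s) * survival \<mu> x s) * indicator {0..t} s)" (is "?A = ?B")
proof (rule measure_eqI_generator_eq[where E = "{C \<times> {y<..} | C y. C \<in> sets seq_space}" and \<Omega> = UNIV
      and A = "\<lambda>i. UNIV \<times> {- real i<..}"])
  let ?E = "{C \<times> {y<..} | C (y::real). C \<in> sets seq_space}"
  have "sets (seq_space \<Otimes>\<^sub>M borel) = sets (sigma (space seq_space \<times> space borel)
      {a \<times> b | a b. a \<in> sets seq_space \<and> b \<in> range (greaterThan :: real \<Rightarrow> _)})"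
  proof (rule sets_pair_eq[where Ca = "{UNIV}" and Cb = "range (\<lambda>i::nat. {- real i<..})"])
    show "sets (borel :: real measure) = sigma_sets (space borel) (range greaterThan)"
      by (subst borel_Ioi) (simp add: sets_measure_of_conv)
    show "\<Union> (range (\<lambda>i::nat. {- real i<..})) = space borel"
    proof (intro set_eqI iffI)
      fix y :: real
      obtain i :: nat where "- y < real i" using reals_Archimedean2 by blast
      then show "y \<in> \<Union> (range (\<lambda>i::nat. {- real i<..}))" by (auto intro!: exI[of _ i])
    qed simp
    show "{UNIV} \<subseteq> sets seq_space" using sets.top[of seq_space] by (simp add: space_PiM)
    show "sets seq_space = sigma_sets (space seq_space) (sets seq_space)"
      by (rule sets.sigma_sets_eq[symmetric])
  qed (auto simp: space_PiM dest: sets.sets_into_space)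
  also have "{a \<times> b | a b. a \<in> sets seq_space \<and> b \<in> range (greaterThan :: real \<Rightarrow> _)} = ?E" by auto
  finally have gen: "sets (seq_space \<Otimes>\<^sub>M borel) = sigma_sets UNIV ?E"
    by (simp add: space_PiM)
  show "sets ?A = sigma_sets UNIV ?E" by (simp add: gen)
  have "sets (exp_holding l \<Otimes>\<^sub>M lborel) = sets (seq_space \<Otimes>\<^sub>M (borel :: real measure))"
    by (intro sets_pair_measure_cong) (simp_all add: sets_exp_holding)
  then show "sets ?B = sigma_sets UNIV ?E" by (simp add: gen)
  show "Int_stable ?E"
  proof (rule Int_stableI)
    fix a b assume "a \<in> ?E" "b \<in> ?E"
    then obtain C y C' y' where "a = C \<times> {y<..}" "b = C' \<times> {y'<..}" "C \<in> sets seq_space" "C' \<in> sets seq_space"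
      by blast
    moreover from this have "a \<inter> b = (C \<inter> C') \<times> {max y y'<..}" by auto
    ultimately show "a \<inter> b \<in> ?E" by blast
  qed
  show "range (\<lambda>i. UNIV \<times> {- real i<..}) \<subseteq> ?E"
    using sets.top[of seq_space] by (auto simp: space_PiM)
  show "(\<Union>i::nat. UNIV \<times> {- real i<..}) = (UNIV :: ((nat \<Rightarrow> real) \<times> real) set)"
  proof (intro set_eqI iffI)
    fix z :: "(nat \<Rightarrow> real) \<times> real"
    obtain i :: nat where "- snd z < real i" using reals_Archimedean2 by blast
    then show "z \<in> (\<Union>i::nat. UNIV \<times> {- real i<..})" by (auto simp: mem_Times_iff intro!: exI[of _ i])
  qed simp
  show "emeasure ?A (UNIV \<times> {- real i<..}) \<noteq> \<infinity>" for i
  proof -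
    interpret D: prob_space "distr P (seq_space \<Otimes>\<^sub>M borel) (\<lambda>\<omega>. (h \<omega>, S \<omega>))"
      by (rule prob_space_distr) measurable
    have "emeasure ?A (UNIV \<times> {- real i<..}) \<le> emeasure ?A (space ?A)"
      by (rule emeasure_space)
    also have "\<dots> \<le> (\<integral>\<^sup>+z. 1 \<partial>distr P (seq_space \<Otimes>\<^sub>M borel) (\<lambda>\<omega>. (h \<omega>, S \<omega>)))"
    proof (subst emeasure_density)
      show "(\<integral>\<^sup>+z. (case z of (x, s) \<Rightarrow> indicator {..t} s) * indicator (space ?A) z
          \<partial>distr P (seq_space \<Otimes>\<^sub>M borel) (\<lambda>\<omega>. (h \<omega>, S \<omega>)))
        \<le> (\<integral>\<^sup>+z. 1 \<partial>distr P (seq_space \<Otimes>\<^sub>M borel) (\<lambda>\<omega>. (h \<omega>, S \<omega>)))"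
        by (intro nn_integral_mono) (auto simp: indicator_def split: prod.split)
    qed simp_all
    also have "\<dots> = 1" using D.emeasure_space_1 by simp
    finally show ?thesis by (auto simp: top_unique)
  qed
  fix X assume "X \<in> ?E"
  then obtain C y where X: "X = C \<times> {y<..}" and C [measurable]: "C \<in> sets seq_space" by blast
  have XS [measurable]: "X \<in> sets (seq_space \<Otimes>\<^sub>M borel)" unfolding X by measurable
  \<comment> \<open>clipping \<open>y\<close> to \<open>{0..t}\<close> affects neither measure: \<open>S\<close> is positive, and \<open>0\<close> is a Lebesgue null set\<close>
  define y' where "y' = min (max y 0) t"
  have y': "0 \<le> y'" "y' \<le> t" using t by (auto simp: y'_def)
  have "emeasure ?A X = (\<integral>\<^sup>+\<omega>. indicator {..t} (S \<omega>) * indicator X (h \<omega>, S \<omega>) \<partial>P)"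
    by (simp add: emeasure_density nn_integral_distr split_beta')
  also have "\<dots> = (\<integral>\<^sup>+\<omega>. indicator {\<omega> \<in> space P. h \<omega> \<in> C \<and> y' < S \<omega> \<and> S \<omega> \<le> t} \<omega> \<partial>P)"
    using S_pos by (intro nn_integral_cong) (fastforce simp: indicator_def X y'_def)
  also have "\<dots> = emeasure P {\<omega> \<in> space P. h \<omega> \<in> C \<and> y' < S \<omega> \<and> S \<omega> \<le> t}"
    by (intro nn_integral_indicator) measurable
  finally have A: "emeasure ?A X = emeasure P {\<omega> \<in> space P. h \<omega> \<in> C \<and> y' < S \<omega> \<and> S \<omega> \<le> t}" .
  \<comment> \<open>both measures of the rectangle are shown to be \<open>s y' - s t\<close>, in additive form\<close>
  define s where "s = (\<lambda>u. \<integral>\<^sup>+x. ennreal (survival \<mu> x u) * indicator C x \<partial>exp_holding l)"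
  have "emeasure ?A X + s t = emeasure P ({\<omega> \<in> space P. h \<omega> \<in> C \<and> y' < S \<omega> \<and> S \<omega> \<le> t}
      \<union> {\<omega> \<in> space P. h \<omega> \<in> C \<and> t < S \<omega>})"
    unfolding A s_def S_cond[OF C t, symmetric]
    by (intro plus_emeasure) (auto)
  also have "{\<omega> \<in> space P. h \<omega> \<in> C \<and> y' < S \<omega> \<and> S \<omega> \<le> t} \<union> {\<omega> \<in> space P. h \<omega> \<in> C \<and> t < S \<omega>}
      = {\<omega> \<in> space P. h \<omega> \<in> C \<and> y' < S \<omega>}" using y' by auto
  also have "emeasure P \<dots> = s y'" unfolding s_def by (rule S_cond[OF C y'(1)])
  finally have A': "emeasure ?A X + s t = s y'" .
  have kernel [measurable]: "(\<lambda>(x, u). ennreal (\<mu> (counting x u) * survival \<mu> x u) * indicator {0..t} u)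
      \<in> borel_measurable (exp_holding l \<Otimes>\<^sub>M lborel)" by measurable
  have XB [measurable]: "X \<in> sets (exp_holding l \<Otimes>\<^sub>M lborel)"
    using XS \<open>sets (exp_holding l \<Otimes>\<^sub>M lborel) = sets (seq_space \<Otimes>\<^sub>M borel)\<close> by simp
  have "emeasure ?B X = (\<integral>\<^sup>+z. (case z of (x, u) \<Rightarrow> ennreal (\<mu> (counting x u) * survival \<mu> x u) * indicator {0..t} u)
      * indicator X z \<partial>(exp_holding l \<Otimes>\<^sub>M lborel))"
    by (rule emeasure_density[OF kernel XB])
  also have "\<dots> = (\<integral>\<^sup>+x. \<integral>\<^sup>+u. ennreal (\<mu> (counting x u) * survival \<mu> x u) * indicator {0..t} u
      * indicator X (x, u) \<partial>lborel \<partial>exp_holding l)"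
    by (subst lborel.nn_integral_fst[symmetric])
      (intro borel_measurable_times_ennreal kernel borel_measurable_indicator XB, simp)
  also have "\<dots> = (\<integral>\<^sup>+x. (\<integral>\<^sup>+u. ennreal (\<mu> (counting x u) * survival \<mu> x u) * indicator {y'<..t} u \<partial>lborel)
      * indicator C x \<partial>exp_holding l)"
  proof (intro nn_integral_cong)
    fix x
    have [measurable]: "(\<lambda>u. x) \<in> measurable borel seq_space" by (intro measurable_const) (simp add: space_PiM)
    have "(\<integral>\<^sup>+u. ennreal (\<mu> (counting x u) * survival \<mu> x u) * indicator {0..t} u * indicator X (x, u) \<partial>lborel)
      = (\<integral>\<^sup>+u. ennreal (\<mu> (counting x u) * survival \<mu> x u) * indicator {y'<..t} u * indicator C x \<partial>lborel)"
    proof (rule nn_integral_cong_AE)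
      show "AE u in lborel. ennreal (\<mu> (counting x u) * survival \<mu> x u) * indicator {0..t} u * indicator X (x, u)
        = ennreal (\<mu> (counting x u) * survival \<mu> x u) * indicator {y'<..t} u * indicator C x"
        using AE_lborel_singleton[of 0]
        by eventually_elim (auto simp: indicator_def X y'_def)
    qed
    then show "(\<integral>\<^sup>+u. ennreal (\<mu> (counting x u) * survival \<mu> x u) * indicator {0..t} u * indicator X (x, u) \<partial>lborel)
      = (\<integral>\<^sup>+u. ennreal (\<mu> (counting x u) * survival \<mu> x u) * indicator {y'<..t} u \<partial>lborel) * indicator C x"
      by (simp add: nn_integral_multc)
  qed
  finally have B: "emeasure ?B X = (\<integral>\<^sup>+x. (\<integral>\<^sup>+u. ennreal (\<mu> (counting x u) * survival \<mu> x u) * indicator {y'<..t} u \<partial>lborel)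
      * indicator C x \<partial>exp_holding l)" .
  have C' [measurable]: "C \<in> sets (exp_holding l)" by (simp add: sets_exp_holding)
  have "emeasure ?B X + s t = (\<integral>\<^sup>+x. (\<integral>\<^sup>+u. ennreal (\<mu> (counting x u) * survival \<mu> x u) * indicator {y'<..t} u \<partial>lborel)
      * indicator C x + ennreal (survival \<mu> x t) * indicator C x \<partial>exp_holding l)"
    unfolding B s_def by (intro nn_integral_add[symmetric]) (simp_all add: greaterThanAtMost_def)
  also have "\<dots> = s y'"
    unfolding s_def
  proof (rule nn_integral_cong_AE)
    show "AE x in exp_holding l. (\<integral>\<^sup>+u. ennreal (\<mu> (counting x u) * survival \<mu> x u) * indicator {y'<..t} u \<partial>lborel)
      * indicator C x + ennreal (survival \<mu> x t) * indicator C x = ennreal (survival \<mu> x y') * indicator C x"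
      using AE_regular_path
    proof eventually_elim
      case (elim x)
      then show ?case using survival_increment[OF elim y'] by (simp add: distrib_right[symmetric])
    qed
  qed
  finally have B': "emeasure ?B X + s t = s y'" .
  have "s t \<le> (\<integral>\<^sup>+x. 1 \<partial>exp_holding l)"
    unfolding s_def using survival_bounds by (intro nn_integral_mono) (auto simp: indicator_def)
  also have "\<dots> = 1" using prob_space.emeasure_space_1[OF prob_space_exp_holding[OF l_pos]] by simp
  finally have "s t \<noteq> \<top>" by (auto simp: top_unique)
  moreover have "s t + emeasure ?A X = s t + emeasure ?B X"
    by (subst (1 2) add.commute) (simp only: A' B')
  ultimately show "emeasure ?A X = emeasure ?B X"
    by (simp only: ennreal_add_left_cancel infinity_ennreal_def) blast
qed auto

lemma nn_integral_killed:
  fixes f :: "(nat \<Rightarrow> real) \<times> real \<Rightarrow> ennreal"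
  assumes [measurable]: "f \<in> borel_measurable (seq_space \<Otimes>\<^sub>M borel)" and t: "0 \<le> t"
  shows "(\<integral>\<^sup>+\<omega>. f (h \<omega>, S \<omega>) * indicator {..t} (S \<omega>) \<partial>P)
    = (\<integral>\<^sup>+x. \<integral>\<^sup>+s. f (x, s) * ennreal (\<mu> (counting x s) * survival \<mu> x s) * indicator {0..t} s \<partial>lborel \<partial>exp_holding l)"
proof -
  have "(\<integral>\<^sup>+\<omega>. f (h \<omega>, S \<omega>) * indicator {..t} (S \<omega>) \<partial>P)
    = (\<integral>\<^sup>+z. f z \<partial>density (distr P (seq_space \<Otimes>\<^sub>M borel) (\<lambda>\<omega>. (h \<omega>, S \<omega>))) (\<lambda>(x, s). indicator {..t} s))"
    by (simp add: nn_integral_density nn_integral_distr split_beta' mult.commute)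
  also have "\<dots> = (\<integral>\<^sup>+z. (case z of (x, s) \<Rightarrow> ennreal (\<mu> (counting x s) * survival \<mu> x s) * indicator {0..t} s) * f z
      \<partial>(exp_holding l \<Otimes>\<^sub>M lborel))"
    unfolding truncated_law[OF t] by (intro nn_integral_density) measurable
  also have "\<dots> = (\<integral>\<^sup>+x. \<integral>\<^sup>+s. f (x, s) * ennreal (\<mu> (counting x s) * survival \<mu> x s) * indicator {0..t} s \<partial>lborel \<partial>exp_holding l)"
    by (subst lborel.nn_integral_fst[symmetric]) (simp_all add: ac_simps)
  finally show ?thesis .
qed

lemma measurable_tilt_cell [measurable]:
  "(\<lambda>(x, t). ennreal (tilt \<rho> \<alpha> x n) * (ennreal (exp (- (\<alpha> n * (t - jump_time x n)))) * indicator {h. in_cell h n t} x))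
    \<in> borel_measurable (seq_space \<Otimes>\<^sub>M borel)"
proof -
  have "(\<lambda>z. ennreal (tilt \<rho> \<alpha> (fst z) n) * (ennreal (exp (- (\<alpha> n * (snd z - jump_time (fst z) n)))) *
      (if in_cell (fst z) n (snd z) then 1 else 0 :: ennreal))) \<in> borel_measurable (seq_space \<Otimes>\<^sub>M borel)"
    by measurable
  then show ?thesis by (simp add: split_beta' indicator_def of_bool_def)
qed

text \<open>
  The velocities \<open>d\<close> below are those of \<open>cstar\<close> with \<open>\<rho> = 1 + rs\<close> and \<open>\<sigma> = 1 + Rs\<close>. They are determined
  by the requirement that the tilt has intensity \<open>l * \<rho>\<close> and leaves the killing rate \<open>\<mu> * \<sigma>\<close>.
\<close>
context
  fixes d \<rho> \<sigma> :: "nat \<Rightarrow> real"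
  assumes \<rho>: "\<forall>n. 0 < \<rho> n" and \<sigma>: "\<forall>n. 0 < \<sigma> n"
    and d: "\<forall>n. d n = l n * (1 - \<rho> n) + \<mu> n * (1 - \<sigma> n)"
begin

definition cell_weight :: "nat \<Rightarrow> (nat \<Rightarrow> real) \<Rightarrow> real \<Rightarrow> ennreal" where
  "cell_weight n x t = ennreal (tilt \<rho> (\<lambda>k. \<mu> k - d k) x n) *
    (ennreal (exp (- ((\<mu> n - d n) * (t - jump_time x n)))) * indicator {h. in_cell h n t} x)"

lemma measurable_cell_weight:
  "(\<lambda>(x, t). cell_weight n x t) \<in> borel_measurable (seq_space \<Otimes>\<^sub>M borel)"
  unfolding cell_weight_def using measurable_tilt_cell[of \<rho> "\<lambda>k. \<mu> k - d k" n] .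

lemma measurable_cell_weight' [measurable (raw)]:
  assumes [measurable]: "f \<in> measurable K seq_space" "g \<in> borel_measurable K"
  shows "(\<lambda>z. cell_weight n (f z) (g z)) \<in> borel_measurable K"
  using measurable_compose[OF _ measurable_cell_weight, of "\<lambda>z. (f z, g z)" K n] by simp

lemma nn_integral_cell_weight:
  "(\<integral>\<^sup>+x. cell_weight n x t \<partial>exp_holding l)
    = (\<integral>\<^sup>+x. alive (\<lambda>n. \<mu> n * \<sigma> n) x n t \<partial>exp_holding (\<lambda>n. l n * \<rho> n))"
  unfolding cell_weight_def using l_pos \<rho> d
  by (intro nn_integral_tilt_alive) (auto simp: less_imp_le algebra_simps)

lemma path_weight_eq_cells:
  assumes x: "regular x" and t: "0 \<le> t" and f: "\<forall>n. 0 \<le> f n"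
  shows "ennreal (f (counting x t)) * ennreal (path_weight d \<rho> x t * survival \<mu> x t)
    = (\<Sum>n. ennreal (f n) * cell_weight n x t)"
proof -
  have pos: "\<forall>k. 0 < x k" using x by (simp add: regular_def)
  obtain n where n: "in_cell x n t" using regular_in_cell[OF x t] by blast
  have "cell_weight k x t = 0" if "k \<noteq> n" for k
  proof -
    have "\<not> in_cell x k t" using in_cell_unique[OF pos n] that by blast
    then show ?thesis by (simp add: cell_weight_def)
  qed
  then have "(\<Sum>k. ennreal (f k) * cell_weight k x t) = (\<Sum>k\<in>{n}. ennreal (f k) * cell_weight k x t)"
    by (intro suminf_finite) auto
  also have "\<dots> = ennreal (f n) * ennreal (path_weight d \<rho> x t * survival \<mu> x t)"
  proof -
    have "path_weight d \<rho> x t * survival \<mu> x t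
      = tilt \<rho> (\<lambda>k. \<mu> k - d k) x n * exp (- ((\<mu> n - d n) * (t - jump_time x n)))"
      using \<mu>_pos by (intro path_weight_survival pos n) (simp add: less_imp_le)
    then show ?thesis
      using n tilt_nonneg[of \<rho>] \<rho> by (simp add: cell_weight_def ennreal_mult less_imp_le)
  qed
  finally show ?thesis by (simp add: counting_in_cell[OF pos n])
qed

text \<open>
  Conditioning on the path replaces the event \<open>t < S\<close> by the survival function, and on each cell the
  weight becomes a tilt.
\<close>
lemma weighted_alive:
  assumes t: "0 \<le> t"
  shows "(\<integral>\<^sup>+\<omega>. ennreal (path_weight d \<rho> (h \<omega>) t) * indicator {t<..} (S \<omega>) \<partial>P)
    = alive_mass (\<lambda>n. l n * \<rho> n) (\<lambda>n. \<mu> n * \<sigma> n) t"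
proof -
  have "(\<integral>\<^sup>+\<omega>. ennreal (path_weight d \<rho> (h \<omega>) t) * indicator {t<..} (S \<omega>) \<partial>P)
    = (\<integral>\<^sup>+x. ennreal (path_weight d \<rho> x t) * ennreal (survival \<mu> x t) \<partial>exp_holding l)"
    by (intro nn_integral_alive t) measurable
  also have "\<dots> = (\<integral>\<^sup>+x. (\<Sum>n. cell_weight n x t) \<partial>exp_holding l)"
  proof (rule nn_integral_cong_AE)
    show "AE x in exp_holding l. ennreal (path_weight d \<rho> x t) * ennreal (survival \<mu> x t) = (\<Sum>n. cell_weight n x t)"
      using AE_regular_path
    proof eventually_elim
      case (elim x)
      show ?case
        using path_weight_eq_cells[OF elim t, of "\<lambda>_. 1"] path_weight_nonneg[of \<rho> d x t] \<rho>
        by (simp add: ennreal_mult' less_imp_le)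
    qed
  qed
  also have "\<dots> = (\<Sum>n. \<integral>\<^sup>+x. cell_weight n x t \<partial>exp_holding l)"
    by (intro nn_integral_suminf) measurable
  also have "\<dots> = alive_mass (\<lambda>n. l n * \<rho> n) (\<lambda>n. \<mu> n * \<sigma> n) t"
    unfolding alive_mass_def nn_integral_cell_weight by (intro nn_integral_suminf[symmetric]) measurable
  finally show ?thesis .
qed

text \<open>
  The hazard \<open>\<mu>\<close> of \<open>S\<close> and the factor \<open>\<sigma>\<close> at the killing time combine into the new hazard; the rest is
  the computation of \<open>weighted_alive\<close> at each time \<open>s \<le> t\<close>, integrated over \<open>s\<close>.
\<close>
lemma weighted_killed:
  assumes t: "0 \<le> t"
  shows "(\<integral>\<^sup>+\<omega>. ennreal (\<sigma> (counting (h \<omega>) (S \<omega>)) * path_weight d \<rho> (h \<omega>) (S \<omega>)) * indicator {..t} (S \<omega>) \<partial>P)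
    = killed_mass (\<lambda>n. l n * \<rho> n) (\<lambda>n. \<mu> n * \<sigma> n) t"
proof -
  let ?E = "exp_holding l" and ?E' = "exp_holding (\<lambda>n. l n * \<rho> n)"
  have l': "\<forall>n. 0 < l n * \<rho> n" using l_pos \<rho> by simp
  interpret E: prob_space ?E by (rule prob_space_exp_holding[OF l_pos])
  interpret E': prob_space ?E' by (rule prob_space_exp_holding[OF l'])
  interpret EL: pair_sigma_finite lborel ?E ..
  interpret EL': pair_sigma_finite lborel ?E' ..
  have pw: "0 \<le> path_weight d \<rho> x s" for x s using \<rho> by (intro path_weight_nonneg) (simp add: less_imp_le)
  have c: "\<forall>n. 0 \<le> \<mu> n * \<sigma> n" using \<mu>_pos \<sigma> by (simp add: less_imp_le)
  have "(\<integral>\<^sup>+\<omega>. (\<lambda>(x, s). ennreal (\<sigma> (counting x s) * path_weight d \<rho> x s)) (h \<omega>, S \<omega>) * indicator {..t} (S \<omega>) \<partial>P)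
    = (\<integral>\<^sup>+x. \<integral>\<^sup>+s. (\<lambda>(x, s). ennreal (\<sigma> (counting x s) * path_weight d \<rho> x s)) (x, s)
        * ennreal (\<mu> (counting x s) * survival \<mu> x s) * indicator {0..t} s \<partial>lborel \<partial>?E)"
    by (intro nn_integral_killed t) measurable
  also have "\<dots> = (\<integral>\<^sup>+x. \<integral>\<^sup>+s. (\<Sum>n. ennreal (\<mu> n * \<sigma> n) * cell_weight n x s * indicator {0..t} s) \<partial>lborel \<partial>?E)"
  proof (rule nn_integral_cong_AE)
    show "AE x in ?E. (\<integral>\<^sup>+s. (\<lambda>(x, s). ennreal (\<sigma> (counting x s) * path_weight d \<rho> x s)) (x, s)
        * ennreal (\<mu> (counting x s) * survival \<mu> x s) * indicator {0..t} s \<partial>lborel)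
      = (\<integral>\<^sup>+s. (\<Sum>n. ennreal (\<mu> n * \<sigma> n) * cell_weight n x s * indicator {0..t} s) \<partial>lborel)"
      using AE_regular_path
    proof eventually_elim
      case (elim x)
      show ?case
      proof (rule nn_integral_cong)
        fix s
        show "(\<lambda>(x, s). ennreal (\<sigma> (counting x s) * path_weight d \<rho> x s)) (x, s)
          * ennreal (\<mu> (counting x s) * survival \<mu> x s) * indicator {0..t} s
          = (\<Sum>n. ennreal (\<mu> n * \<sigma> n) * cell_weight n x s * indicator {0..t} s)"
        proof (cases "0 \<le> s \<and> s \<le> t")
          case True
          have "ennreal (\<sigma> (counting x s) * path_weight d \<rho> x s) * ennreal (\<mu> (counting x s) * survival \<mu> x s)
            = ennreal (\<mu> (counting x s) * \<sigma> (counting x s)) * ennreal (path_weight d \<rho> x s * survival \<mu> x s)"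
            using \<mu>_pos \<sigma> pw[of x s] survival_bounds(1)[of \<mu> x s]
            by (simp add: ennreal_mult[symmetric] less_imp_le ac_simps)
          then show ?thesis
            using True path_weight_eq_cells[OF elim _ c, of s] by simp
        qed (auto simp: indicator_def)
      qed
    qed
  qed
  also have "\<dots> = (\<Sum>n. \<integral>\<^sup>+x. \<integral>\<^sup>+s. ennreal (\<mu> n * \<sigma> n) * cell_weight n x s * indicator {0..t} s \<partial>lborel \<partial>?E)"
  proof -
    have "(\<integral>\<^sup>+s. (\<Sum>n. ennreal (\<mu> n * \<sigma> n) * cell_weight n x s * indicator {0..t} s) \<partial>lborel)
      = (\<Sum>n. \<integral>\<^sup>+s. ennreal (\<mu> n * \<sigma> n) * cell_weight n x s * indicator {0..t} s \<partial>lborel)" for x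
    proof (intro nn_integral_suminf)
      have [measurable]: "(\<lambda>u. x) \<in> measurable borel seq_space" by (intro measurable_const) (simp add: space_PiM)
      show "(\<lambda>s. ennreal (\<mu> n * \<sigma> n) * cell_weight n x s * indicator {0..t} s) \<in> borel_measurable lborel" for n
        by measurable
    qed
    then show ?thesis by (simp add: nn_integral_suminf)
  qed
  also have "\<dots> = (\<Sum>n. \<integral>\<^sup>+x. killed (\<lambda>n. \<mu> n * \<sigma> n) x n t \<partial>?E')"
  proof (rule suminf_cong)
    fix n
    have "(\<integral>\<^sup>+x. \<integral>\<^sup>+s. ennreal (\<mu> n * \<sigma> n) * cell_weight n x s * indicator {0..t} s \<partial>lborel \<partial>?E)
      = (\<integral>\<^sup>+s. \<integral>\<^sup>+x. ennreal (\<mu> n * \<sigma> n) * cell_weight n x s * indicator {0..t} s \<partial>?E \<partial>lborel)"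
      by (rule EL.Fubini') measurable
    also have "\<dots> = (\<integral>\<^sup>+s. ennreal (\<mu> n * \<sigma> n) * (\<integral>\<^sup>+x. cell_weight n x s \<partial>?E) * indicator {0..t} s \<partial>lborel)"
      by (intro nn_integral_cong) (simp add: nn_integral_cmult nn_integral_multc)
    also have "\<dots> = (\<integral>\<^sup>+s. ennreal (\<mu> n * \<sigma> n) * (\<integral>\<^sup>+x. alive (\<lambda>n. \<mu> n * \<sigma> n) x n s \<partial>?E') * indicator {0..t} s \<partial>lborel)"
      by (simp add: nn_integral_cell_weight)
    also have "\<dots> = (\<integral>\<^sup>+s. \<integral>\<^sup>+x. ennreal (\<mu> n * \<sigma> n * alive (\<lambda>n. \<mu> n * \<sigma> n) x n s) * indicator {0..t} s \<partial>?E' \<partial>lborel)"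
      using c by (intro nn_integral_cong) (simp add: nn_integral_cmult nn_integral_multc ennreal_mult)
    also have "\<dots> = (\<integral>\<^sup>+x. killed (\<lambda>n. \<mu> n * \<sigma> n) x n t \<partial>?E')"
      unfolding killed_def by (rule EL'.Fubini'[symmetric]) measurable
    finally show "(\<integral>\<^sup>+x. \<integral>\<^sup>+s. ennreal (\<mu> n * \<sigma> n) * cell_weight n x s * indicator {0..t} s \<partial>lborel \<partial>?E)
      = (\<integral>\<^sup>+x. killed (\<lambda>n. \<mu> n * \<sigma> n) x n t \<partial>?E')" .
  qed
  also have "\<dots> = killed_mass (\<lambda>n. l n * \<rho> n) (\<lambda>n. \<mu> n * \<sigma> n) t"
    unfolding killed_mass_def by (intro nn_integral_suminf[symmetric]) measurable
  finally show ?thesis by simp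
qed

end

end

section \<open>The holding times and stages of the market\<close>

text \<open>
  Fubini's theorem for independent variables: \<open>Y\<close> may be replaced by an independent copy.
\<close>
lemma (in prob_space) nn_integral_indep_var:
  fixes f :: "'b \<Rightarrow> 'b \<Rightarrow> ennreal"
  assumes ind: "indep_var A X B Y" and f [measurable]: "(\<lambda>(x, y). f x y) \<in> borel_measurable (A \<Otimes>\<^sub>M B)"
  shows "(\<integral>\<^sup>+\<omega>. f (X \<omega>) (Y \<omega>) \<partial>M) = (\<integral>\<^sup>+\<omega>. (\<integral>\<^sup>+\<omega>'. f (X \<omega>) (Y \<omega>') \<partial>M) \<partial>M)"
proof -
  have X [measurable]: "X \<in> measurable M A" and Y [measurable]: "Y \<in> measurable M B"
    and prod: "distr M A X \<Otimes>\<^sub>M distr M B Y = distr M (A \<Otimes>\<^sub>M B) (\<lambda>\<omega>. (X \<omega>, Y \<omega>))"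
    using ind unfolding indep_var_distribution_eq by auto
  interpret Y: prob_space "distr M B Y" by (rule prob_space_distr) measurable
  have "(\<integral>\<^sup>+\<omega>. f (X \<omega>) (Y \<omega>) \<partial>M)
    = (\<integral>\<^sup>+z. (\<lambda>(x, y). f x y) z \<partial>distr M (A \<Otimes>\<^sub>M B) (\<lambda>\<omega>. (X \<omega>, Y \<omega>)))"
    by (subst nn_integral_distr) simp_all
  also have "\<dots> = (\<integral>\<^sup>+x. \<integral>\<^sup>+y. f x y \<partial>distr M B Y \<partial>distr M A X)"
    unfolding prod[symmetric] by (subst Y.nn_integral_fst[symmetric]) simp_all
  also have "\<dots> = (\<integral>\<^sup>+\<omega>. \<integral>\<^sup>+y. f (X \<omega>) y \<partial>distr M B Y \<partial>M)"
    by (subst nn_integral_distr) simp_all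
  also have "\<dots> = (\<integral>\<^sup>+\<omega>. (\<integral>\<^sup>+\<omega>'. f (X \<omega>) (Y \<omega>') \<partial>M) \<partial>M)"
  proof (intro nn_integral_cong)
    fix \<omega> assume "\<omega> \<in> space M"
    then have "X \<omega> \<in> space A" using measurable_space[OF X] by blast
    then have "(\<lambda>y. f (X \<omega>) y) \<in> borel_measurable B"
      using measurable_compose[OF measurable_Pair1' f] by simp
    then show "(\<integral>\<^sup>+y. f (X \<omega>) y \<partial>distr M B Y) = (\<integral>\<^sup>+\<omega>'. f (X \<omega>) (Y \<omega>') \<partial>M)"
      by (intro nn_integral_distr) simp_all
  qed
  finally show ?thesis .
qed

context market_paths
begin

definition holding :: "nat \<Rightarrow> 'a \<Rightarrow> nat \<Rightarrow> real" where
  "holding m \<omega> = (\<lambda>n. H m n \<omega>)"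

lemma N_eq: "N m t \<omega> = counting (holding m \<omega>) t"
  by (simp add: N_def holding_def)

lemma Tplus_eq: "Tplus m \<omega> = jump_time (\<lambda>k. T (Suc k) \<omega>) m"
  unfolding Tplus_def jump_time_def
  by (rule sum.reindex_bij_witness[of _ Suc "\<lambda>k. k - 1"]) auto

lemma M_eq: "M t \<omega> = counting (\<lambda>k. T (Suc k) \<omega>) t"
  by (simp add: M_def counting_eq Tplus_eq)

lemma path_N_eq: "path_N m \<omega> = (\<lambda>s\<in>{0..}. counting (holding m \<omega>) s)"
  by (simp add: path_N_def N_eq)

end

context market
begin

lemma eps_01: "eps m \<in> {0, 1}"
  using e0 by (induction m) auto

lemma T_Suc_pos: "\<omega> \<in> space P \<Longrightarrow> \<forall>k. 0 < T (Suc k) \<omega>"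
  using T_pos by simp

lemma M_eqI:
  assumes "\<omega> \<in> space P" "Tplus m \<omega> \<le> t" "t < Tplus (Suc m) \<omega>"
  shows "M t \<omega> = m"
  unfolding M_eq using assms T_Suc_pos by (intro counting_in_cell) (auto simp: in_cell_def Tplus_eq)

lemma H_measurable [measurable]: "H m n \<in> borel_measurable P"
  using distributed_measurable[OF H_distr[of m n]] by simp

lemma T_Suc_measurable [measurable]: "T (Suc m) \<in> borel_measurable P"
  by (rule T_rv) simp

lemma holding_measurable [measurable]: "holding m \<in> measurable P seq_space"
  unfolding holding_def[abs_def] by (rule measurable_PiM_single') (auto simp: space_PiM)

lemma distr_holding: "distr P seq_space (holding m) = exp_holding (lam (eps m))"
proof -
  have "indep_vars (\<lambda>n. PiM {(m, n)} (\<lambda>_. borel)) (\<lambda>n \<omega>. restrict (\<lambda>i. (case i of (m, n) \<Rightarrow> H m n) \<omega>) {(m, n)}) UNIV"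
    by (rule indep_vars_restrict[OF H_indep]) (auto simp: disjoint_family_on_def)
  then have "indep_vars (\<lambda>_. borel) (\<lambda>n \<omega>. (\<lambda>f. f (m, n)) (restrict (\<lambda>i. (case i of (m, n) \<Rightarrow> H m n) \<omega>) {(m, n)})) UNIV"
    by (rule indep_vars_compose2) (auto intro!: measurable_component_singleton)
  then have "indep_vars (\<lambda>_. borel) (\<lambda>n. H m n) UNIV" by simp
  then have "distr P seq_space (\<lambda>\<omega>. \<lambda>n\<in>UNIV. H m n \<omega>) = (\<Pi>\<^sub>M n\<in>UNIV. distr P borel (H m n))"
    by (subst (asm) indep_vars_iff_distr_eq_PiM) auto
  moreover have "distr P borel (H m n) = density lborel (exponential_density (lam (eps m) n))" for n
    using distributed_distr_eq_density[OF H_distr[of m n]] by (simp cong: distr_cong)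
  ultimately show ?thesis by (simp add: exp_holding_def holding_def[abs_def] restrict_UNIV)
qed

lemma lam_eps_pos: "\<forall>n. 0 < lam (eps m) n" and mu_eps_pos: "\<forall>n. 0 < mu (eps m) n"
  using lam_pos[OF eps_01] mu_pos[OF eps_01] by auto

lemma AE_regular_holding: "AE \<omega> in P. \<forall>m. regular (holding m \<omega>)"
  unfolding AE_all_countable
proof
  fix m
  have "AE h in distr P seq_space (holding m). regular h"
    unfolding distr_holding by (rule AE_regular[OF lam_eps_pos lam_nonexplosive[OF eps_01]])
  then show "AE \<omega> in P. regular (holding m \<omega>)" by (rule AE_distrD[OF holding_measurable])
qed

lemma path_holding_path_N: "regular (holding m \<omega>) \<Longrightarrow> path_holding (path_N m \<omega>) = holding m \<omega>"
  unfolding path_N_eq by (intro path_holding_counting) (simp add: regular_def)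

lemma path_N_measurable [measurable]: "path_N m \<in> measurable P path_space"
proof -
  have "(\<lambda>\<omega>. (path_N (Suc m - 1) \<omega>, T (Suc m) \<omega>)) \<in> measurable P (path_space \<Otimes>\<^sub>M borel)"
    using NT_indep unfolding indep_vars_def by (elim conjE bspec) simp
  from measurable_compose[OF this measurable_fst] show ?thesis by simp
qed

text \<open>
  The conditional law of the switching time is given relative to the path of the counting process. Almost
  surely the holding times are a measurable functional of that path, so events about them
  are admissible as conditioning events.
\<close>
lemma emeasure_survival:
  assumes C: "C \<in> sets seq_space" and t: "0 \<le> t"
  shows "emeasure P {\<omega> \<in> space P. holding m \<omega> \<in> C \<and> t < T (Suc m) \<omega>}
    = (\<integral>\<^sup>+x. ennreal (survival (mu (eps m)) x t) * indicator C x \<partial>exp_holding (lam (eps m)))"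
proof -
  note C [measurable]
  define F where "F = vimage_algebra (space P) (path_N m) path_space"
  define A where "A = {\<omega> \<in> space P. path_holding (path_N m \<omega>) \<in> C}"
  define D where "D = {\<omega> \<in> space P. t < T (Suc m) \<omega>}"
  have D [measurable]: "D \<in> sets P" unfolding D_def by measurable
  have "subalgebra P F"
    unfolding subalgebra_def F_def using measurable_sets[OF path_N_measurable[of m]]
    by (auto simp: sets_vimage_algebra2[OF measurable_space[OF path_N_measurable[of m], THEN funcsetI]] )
  then interpret finite_measure_subalgebra P F by unfold_locales
  have pF: "path_N m \<in> measurable F path_space"
    unfolding F_def by (rule measurable_vimage_algebra1) (auto dest: measurable_space[OF path_N_measurable])
  have "A = (\<lambda>\<omega>. path_holding (path_N m \<omega>)) -` C \<inter> space F"
    by (auto simp: A_def F_def)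
  then have A: "A \<in> sets F"
    using measurable_compose[OF pF measurable_path_holding] C by (auto intro: measurable_sets)
  have AP [measurable]: "A \<in> sets P" unfolding A_def by measurable
  have int: "integrable P (indicator D :: 'a \<Rightarrow> real)" by (simp add: less_top[symmetric])
  have "emeasure P {\<omega> \<in> space P. holding m \<omega> \<in> C \<and> t < T (Suc m) \<omega>} = emeasure P (A \<inter> D)"
    using AE_regular_holding
    by (intro emeasure_eq_AE) (auto elim!: eventually_mono simp: A_def D_def path_holding_path_N)
  also have "\<dots> = ennreal (LINT \<omega>:A|P. indicator D \<omega>)"
    by (simp add: set_lebesgue_integral_def emeasure_eq_measure flip: indicator_inter_arith)
  also have "(LINT \<omega>:A|P. indicator D \<omega>) = (LINT \<omega>:A|P. real_cond_exp P F (indicator D) \<omega>)"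
    by (rule real_cond_exp_intA[OF int A])
  also have "\<dots> = (LINT \<omega>:A|P. survival (mu (eps m)) (holding m \<omega>) t)"
  proof (rule set_lebesgue_integral_cong_AE)
    have "AE \<omega> in P. real_cond_exp P F (indicator D) \<omega> = survival (mu (eps m)) (holding m \<omega>) t"
      using T_cond[of "Suc m" t] t by (simp add: F_def D_def survival_def N_eq)
    then show "AE \<omega>\<in>A in P. real_cond_exp P F (indicator D) \<omega> = survival (mu (eps m)) (holding m \<omega>) t"
      by eventually_elim auto
  qed measurable
  also have "ennreal \<dots> = (\<integral>\<^sup>+\<omega>. ennreal (indicator A \<omega> * survival (mu (eps m)) (holding m \<omega>) t) \<partial>P)"
    unfolding set_lebesgue_integral_def
    by (subst nn_integral_eq_integral)
      (auto intro!: integrable_const_bound[where B = 1] simp: survival_bounds indicator_def)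
  also have "\<dots> = (\<integral>\<^sup>+\<omega>. ennreal (survival (mu (eps m)) (holding m \<omega>) t) * indicator C (holding m \<omega>) \<partial>P)"
  proof (rule nn_integral_cong_AE)
    show "AE \<omega> in P. ennreal (indicator A \<omega> * survival (mu (eps m)) (holding m \<omega>) t)
      = ennreal (survival (mu (eps m)) (holding m \<omega>) t) * indicator C (holding m \<omega>)"
      using AE_regular_holding AE_space
      by eventually_elim (auto simp: A_def indicator_def path_holding_path_N)
  qed
  also have "\<dots> = (\<integral>\<^sup>+x. ennreal (survival (mu (eps m)) x t) * indicator C x \<partial>distr P seq_space (holding m))"
    by (subst nn_integral_distr) auto
  finally show ?thesis by (simp add: distr_holding)
qed

sublocale switch: killing_time P "holding m" "T (Suc m)" "lam (eps m)" "mu (eps m)" for m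
  using lam_eps_pos mu_eps_pos lam_nonexplosive[OF eps_01] T_pos
  by unfold_locales (auto simp: distr_holding emeasure_survival)

text \<open>
  The holding times are recomputed from the path, because the independence of the stages is known for
  the paths. The value at \<open>k = 0\<close> has no meaning; stage \<open>k\<close> ends with the \<open>k\<close>-th switch.
\<close>
definition stage :: "nat \<Rightarrow> 'a \<Rightarrow> (nat \<Rightarrow> real) \<times> real" where
  "stage k \<omega> = (path_holding (path_N (k - 1) \<omega>), T k \<omega>)"

lemma indep_stages: "indep_vars (\<lambda>_. seq_space \<Otimes>\<^sub>M borel) stage {1..}"
proof -
  have "indep_vars (\<lambda>_. seq_space \<Otimes>\<^sub>M borel)
      (\<lambda>k \<omega>. (\<lambda>(p, s). (path_holding p, s)) (path_N (k - 1) \<omega>, T k \<omega>)) {1..}"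
    by (rule indep_vars_compose2[OF NT_indep]) measurable
  then show ?thesis by (simp add: stage_def[abs_def])
qed

lemma stage_measurable [measurable]: "stage (Suc k) \<in> measurable P (seq_space \<Otimes>\<^sub>M borel)"
  using indep_stages unfolding indep_vars_def by auto

lemma AE_stage: "AE \<omega> in P. \<forall>k. stage (Suc k) \<omega> = (holding k \<omega>, T (Suc k) \<omega>)"
  using AE_regular_holding by eventually_elim (simp add: stage_def path_holding_path_N)

lemma nn_integral_past_next:
  fixes g :: "(nat \<Rightarrow> (nat \<Rightarrow> real) \<times> real) \<Rightarrow> (nat \<Rightarrow> real) \<times> real \<Rightarrow> ennreal"
  assumes [measurable]: "(\<lambda>(u, v). g u v) \<in> borel_measurable
      (PiM {1..m} (\<lambda>_. seq_space \<Otimes>\<^sub>M borel) \<Otimes>\<^sub>M (seq_space \<Otimes>\<^sub>M borel))"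
  shows "(\<integral>\<^sup>+\<omega>. g (\<lambda>k\<in>{1..m}. stage k \<omega>) (stage (Suc m) \<omega>) \<partial>P)
    = (\<integral>\<^sup>+\<omega>. (\<integral>\<^sup>+\<omega>'. g (\<lambda>k\<in>{1..m}. stage k \<omega>) (stage (Suc m) \<omega>') \<partial>P) \<partial>P)"
proof -
  let ?S = "seq_space \<Otimes>\<^sub>M (borel :: real measure)"
  let ?PU = "PiM {1..m} (\<lambda>_. ?S)" and ?PV = "PiM {Suc m} (\<lambda>_. ?S)"
  let ?U = "\<lambda>\<omega>. \<lambda>k\<in>{1..m}. stage k \<omega>" and ?V = "\<lambda>\<omega>. \<lambda>k\<in>{Suc m}. stage k \<omega>"
  have ind: "indep_var ?PU ?U ?PV ?V"
    by (rule indep_var_restrict[OF indep_stages]) auto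
  have [measurable]: "(\<lambda>v. v (Suc m)) \<in> measurable ?PV ?S"
    by (rule measurable_component_singleton) simp
  have "(\<lambda>z. (fst z, snd z (Suc m))) \<in> measurable (?PU \<Otimes>\<^sub>M ?PV) (?PU \<Otimes>\<^sub>M ?S)"
    by measurable
  from measurable_compose[OF this assms]
  have "(\<lambda>(u, v). g u (v (Suc m))) \<in> borel_measurable (?PU \<Otimes>\<^sub>M ?PV)"
    by (simp add: split_beta')
  from nn_integral_indep_var[OF ind this] show ?thesis by simp
qed

end

section \<open>The density process between switches\<close>

locale tilted_market = market P lam mu c e0 H T r R
  for P :: "'a measure"
    and lam mu c :: "nat \<Rightarrow> nat \<Rightarrow> real"
    and e0 :: nat
    and H :: "nat \<Rightarrow> nat \<Rightarrow> 'a \<Rightarrow> real"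
    and T :: "nat \<Rightarrow> 'a \<Rightarrow> real"
    and r R :: "nat \<Rightarrow> nat \<Rightarrow> 'a \<Rightarrow> real" +
  fixes rs Rs :: "nat \<Rightarrow> nat \<Rightarrow> real"
  assumes rs_gt: "\<And>i n. i \<in> {0, 1} \<Longrightarrow> rs i n > -1"
    and Rs_gt: "\<And>i n. i \<in> {0, 1} \<Longrightarrow> Rs i n > -1"
begin

abbreviation lam_star :: "nat \<Rightarrow> nat \<Rightarrow> real" where
  "lam_star m \<equiv> \<lambda>n. lam (eps m) n * (1 + rs (eps m) n)"

abbreviation mu_star :: "nat \<Rightarrow> nat \<Rightarrow> real" where
  "mu_star m \<equiv> \<lambda>n. mu (eps m) n * (1 + Rs (eps m) n)"

text \<open>
  The weight of an uncompleted stage of age \<open>t\<close>, where \<open>m\<close> switches have happened before.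
\<close>
definition age_weight :: "nat \<Rightarrow> (nat \<Rightarrow> real) \<Rightarrow> real \<Rightarrow> real" where
  "age_weight m = path_weight (cstar rs Rs (eps m)) (\<lambda>n. 1 + rs (eps m) n)"

text \<open>
  The weight of a completed stage; the additional factor is the one of the switch itself.
\<close>
definition switch_weight :: "nat \<Rightarrow> (nat \<Rightarrow> real) \<times> real \<Rightarrow> real" where
  "switch_weight m = (\<lambda>(x, s). (1 + Rs (eps m) (counting x s)) * age_weight m x s)"

lemma rs_pos: "\<forall>n. 0 < 1 + rs (eps m) n"
proof
  fix n show "0 < 1 + rs (eps m) n" using rs_gt[OF eps_01, of m n] by linarith
qed

lemma Rs_pos: "\<forall>n. 0 < 1 + Rs (eps m) n"
proof
  fix n show "0 < 1 + Rs (eps m) n" using Rs_gt[OF eps_01, of m n] by linarith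
qed

lemma cstar_eq: "\<forall>n. cstar rs Rs (eps m) n
    = lam (eps m) n * (1 - (1 + rs (eps m) n)) + mu (eps m) n * (1 - (1 + Rs (eps m) n))"
  by (simp add: cstar_def)

lemma lam_star_pos: "\<forall>n. 0 < lam_star m n" and mu_star_pos: "\<forall>n. 0 < mu_star m n"
  using lam_eps_pos mu_eps_pos rs_pos Rs_pos by auto

lemma age_weight_nonneg: "0 \<le> age_weight m x t"
  unfolding age_weight_def using rs_pos by (intro path_weight_nonneg) (simp add: less_imp_le)

lemma switch_weight_nonneg: "0 \<le> switch_weight m z"
  using Rs_pos age_weight_nonneg by (auto simp: switch_weight_def less_imp_le split: prod.split)

lemma measurable_age_weight [measurable (raw)]:
  assumes [measurable]: "f \<in> measurable K seq_space" "g \<in> borel_measurable K"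
  shows "(\<lambda>x. age_weight m (f x) (g x)) \<in> borel_measurable K"
  unfolding age_weight_def by measurable

lemma measurable_switch_weight [measurable]:
  "switch_weight m \<in> borel_measurable (seq_space \<Otimes>\<^sub>M borel)"
  unfolding switch_weight_def by measurable

lemma expected_age_weight:
  assumes "0 \<le> t"
  shows "(\<integral>\<^sup>+\<omega>. ennreal (age_weight m (holding m \<omega>) t) * indicator {t<..} (T (Suc m) \<omega>) \<partial>P)
    = alive_mass (lam_star m) (mu_star m) t"
  unfolding age_weight_def by (rule switch.weighted_alive[OF rs_pos Rs_pos cstar_eq assms])

text \<open>
  What will turn out to be the law of the \<open>m + 1\<close>-st switching time under the new measure. Its total
  mass is first bounded by \<open>1\<close>, which is enough for taking limits; equality follows from the limit.
\<close>
definition switch_law :: "nat \<Rightarrow> real measure" where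
  "switch_law m = distr (density P (\<lambda>\<omega>. ennreal (switch_weight m (stage (Suc m) \<omega>)))) borel (T (Suc m))"

lemma sets_switch_law [simp]: "sets (switch_law m) = sets borel"
  and space_switch_law [simp]: "space (switch_law m) = UNIV"
  by (simp_all add: switch_law_def)

lemma emeasure_switch_law:
  assumes [measurable]: "B \<in> sets borel"
  shows "emeasure (switch_law m) B
    = (\<integral>\<^sup>+\<omega>. ennreal (switch_weight m (stage (Suc m) \<omega>)) * indicator B (T (Suc m) \<omega>) \<partial>P)"
proof -
  have "emeasure (switch_law m) B = (\<integral>\<^sup>+\<omega>. ennreal (switch_weight m (stage (Suc m) \<omega>))
      * indicator (T (Suc m) -` B \<inter> space P) \<omega> \<partial>P)"
    by (simp add: switch_law_def emeasure_distr emeasure_density)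
  also have "\<dots> = (\<integral>\<^sup>+\<omega>. ennreal (switch_weight m (stage (Suc m) \<omega>)) * indicator B (T (Suc m) \<omega>) \<partial>P)"
    by (intro nn_integral_cong) (simp add: indicator_def)
  finally show ?thesis .
qed

lemma switch_law_atMost:
  assumes t: "0 \<le> t"
  shows "emeasure (switch_law m) {..t} = killed_mass (lam_star m) (mu_star m) t"
proof -
  have "emeasure (switch_law m) {..t}
    = (\<integral>\<^sup>+\<omega>. ennreal (switch_weight m (stage (Suc m) \<omega>)) * indicator {..t} (T (Suc m) \<omega>) \<partial>P)"
    by (rule emeasure_switch_law) simp
  also have "\<dots> = (\<integral>\<^sup>+\<omega>. ennreal ((1 + Rs (eps m) (counting (holding m \<omega>) (T (Suc m) \<omega>)))
      * age_weight m (holding m \<omega>) (T (Suc m) \<omega>)) * indicator {..t} (T (Suc m) \<omega>) \<partial>P)"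
  proof (rule nn_integral_cong_AE)
    show "AE \<omega> in P. ennreal (switch_weight m (stage (Suc m) \<omega>)) * indicator {..t} (T (Suc m) \<omega>)
      = ennreal ((1 + Rs (eps m) (counting (holding m \<omega>) (T (Suc m) \<omega>)))
      * age_weight m (holding m \<omega>) (T (Suc m) \<omega>)) * indicator {..t} (T (Suc m) \<omega>)"
      using AE_stage by eventually_elim (simp add: switch_weight_def)
  qed
  also have "\<dots> = killed_mass (lam_star m) (mu_star m) t"
    unfolding age_weight_def by (rule switch.weighted_killed[OF rs_pos Rs_pos cstar_eq t])
  finally show ?thesis .
qed

lemma mass_star_le_1: "0 \<le> t \<Longrightarrow> alive_mass (lam_star m) (mu_star m) t + killed_mass (lam_star m) (mu_star m) t \<le> 1"
  using lam_star_pos mu_star_pos by (intro mass_le_1) (auto simp: less_imp_le)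

lemma alive_mass_star_le_1: "0 \<le> t \<Longrightarrow> alive_mass (lam_star m) (mu_star m) t \<le> 1"
  using mass_star_le_1[of t m] le_add_same_cancel1 order_trans[OF _ mass_star_le_1[of t m]] by (meson add_increasing2 order_refl zero_le)

lemma switch_law_le_1: "emeasure (switch_law m) B \<le> 1"
proof -
  have "(\<lambda>i. emeasure (switch_law m) {..real i}) \<longlonglongrightarrow> emeasure (switch_law m) (\<Union>i. {..real i})"
    by (intro Lim_emeasure_incseq) (auto intro!: monoI)
  moreover have "emeasure (switch_law m) {..real i} \<le> 1" for i
    unfolding switch_law_atMost[OF of_nat_0_le_iff]
    by (rule order_trans[OF _ mass_star_le_1[of "real i" m]]) simp_all
  ultimately have "emeasure (switch_law m) (\<Union>i. {..real i}) \<le> 1"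
    by (intro LIMSEQ_le_const2) auto
  moreover have "(\<Union>i. {..real i}) = UNIV"
    using real_arch_simple by auto
  ultimately show ?thesis
    using emeasure_space[of "switch_law m" B] by simp
qed

definition past_weight :: "nat \<Rightarrow> (nat \<Rightarrow> real set) \<Rightarrow> 'a \<Rightarrow> ennreal" where
  "past_weight m B \<omega> = (\<Prod>k\<in>{1..m}. ennreal (switch_weight (k - 1) (stage k \<omega>)) * indicator (B k) (T k \<omega>))"

lemma stage_measurable' [measurable]: "1 \<le> k \<Longrightarrow> stage k \<in> measurable P (seq_space \<Otimes>\<^sub>M borel)"
  by (cases k) auto

lemma snd_stage: "snd (stage k \<omega>) = T k \<omega>"
  by (simp add: stage_def)

lemma nn_integral_past_weight:
  assumes B: "\<And>k. k \<in> {1..m} \<Longrightarrow> B k \<in> sets borel"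
  shows "(\<integral>\<^sup>+\<omega>. past_weight m B \<omega> \<partial>P) = (\<Prod>k\<in>{1..m}. emeasure (switch_law (k - 1)) (B k))"
proof -
  have "indep_vars (\<lambda>_. borel) (\<lambda>k \<omega>. (\<lambda>z. ennreal (switch_weight (k - 1) z) * indicator (B k) (snd z)) (stage k \<omega>)) {1..m}"
  proof (rule indep_vars_compose2[where M' = "\<lambda>_. seq_space \<Otimes>\<^sub>M borel"])
    show "indep_vars (\<lambda>_. seq_space \<Otimes>\<^sub>M borel) stage {1..m}"
      by (rule indep_vars_subset[OF indep_stages]) auto
    show "(\<lambda>z. ennreal (switch_weight (k - 1) z) * indicator (B k) (snd z)) \<in> borel_measurable (seq_space \<Otimes>\<^sub>M borel)"
      if "k \<in> {1..m}" for k
    proof -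
      note B[OF that, measurable]
      show ?thesis by measurable
    qed
  qed
  then have "(\<integral>\<^sup>+\<omega>. past_weight m B \<omega> \<partial>P)
    = (\<Prod>k\<in>{1..m}. \<integral>\<^sup>+\<omega>. ennreal (switch_weight (k - 1) (stage k \<omega>)) * indicator (B k) (T k \<omega>) \<partial>P)"
    unfolding past_weight_def snd_stage by (intro indep_vars_nn_integral) auto
  also have "\<dots> = (\<Prod>k\<in>{1..m}. emeasure (switch_law (k - 1)) (B k))"
  proof (rule prod.cong)
    fix k assume k: "k \<in> {1..m}"
    then have "Suc (k - 1) = k" by simp
    then show "(\<integral>\<^sup>+\<omega>. ennreal (switch_weight (k - 1) (stage k \<omega>)) * indicator (B k) (T k \<omega>) \<partial>P)
      = emeasure (switch_law (k - 1)) (B k)"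
      using emeasure_switch_law[OF B[OF k], of "k - 1"] by simp
  qed simp
  finally show ?thesis .
qed

lemma Tplus_measurable [measurable]: "Tplus m \<in> borel_measurable P"
  unfolding Tplus_eq[abs_def] jump_time_def by measurable

text \<open>
  The current stage is independent of the completed ones, and the time at which its age is evaluated
  depends on these only. Its contribution is thus its expectation at a frozen age.
\<close>
lemma nn_integral_past_age:
  assumes B: "\<And>k. k \<in> {1..m} \<Longrightarrow> B k \<in> sets borel" and t: "0 \<le> t"
    and o_m [measurable]: "gap \<in> borel_measurable borel" and o_nonneg: "\<And>x. 0 \<le> gap x"
  shows "(\<integral>\<^sup>+\<omega>. past_weight m B \<omega> * (ennreal (age_weight m (holding m \<omega>) (t + gap (Tplus m \<omega>)))
        * indicator {t + gap (Tplus m \<omega>)<..} (T (Suc m) \<omega>)) \<partial>P)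
    = (\<integral>\<^sup>+\<omega>. past_weight m B \<omega> * alive_mass (lam_star m) (mu_star m) (t + gap (Tplus m \<omega>)) \<partial>P)"
proof -
  let ?S = "seq_space \<Otimes>\<^sub>M (borel :: real measure)"
  let ?PU = "PiM {1..m} (\<lambda>_. ?S)"
  define \<Phi> where "\<Phi> u = (\<Prod>k\<in>{1..m}. ennreal (switch_weight (k - 1) (u k)) * indicator (B k) (snd (u k)))"
    for u :: "nat \<Rightarrow> (nat \<Rightarrow> real) \<times> real"
  define \<tau> where "\<tau> u = t + gap (\<Sum>k\<in>{1..m}. snd (u k))" for u :: "nat \<Rightarrow> (nat \<Rightarrow> real) \<times> real"
  define g where "g u v = \<Phi> u * (ennreal (age_weight m (fst v) (\<tau> u)) * (if \<tau> u < snd v then 1 else 0))"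
    for u v
  have comp: "(\<lambda>u. u k) \<in> measurable ?PU ?S" if "k \<in> {1..m}" for k
    using that by (rule measurable_component_singleton)
  have [measurable]: "\<Phi> \<in> borel_measurable ?PU"
    unfolding \<Phi>_def
  proof (rule borel_measurable_prod_ennreal)
    fix k assume k: "k \<in> {1..m}"
    note comp[OF k, measurable] B[OF k, measurable]
    show "(\<lambda>u. ennreal (switch_weight (k - 1) (u k)) * indicator (B k) (snd (u k))) \<in> borel_measurable ?PU"
      by measurable
  qed
  have [measurable]: "\<tau> \<in> borel_measurable ?PU"
  proof -
    have [measurable]: "(\<lambda>u. \<Sum>k\<in>{1..m}. snd (u k)) \<in> borel_measurable ?PU"
    proof (rule borel_measurable_sum)
      fix k assume k: "k \<in> {1..m}"
      from measurable_compose[OF comp[OF k] measurable_snd]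
      show "(\<lambda>u. snd (u k)) \<in> borel_measurable ?PU" .
    qed
    show ?thesis unfolding \<tau>_def[abs_def] by measurable
  qed
  have g_m: "(\<lambda>(u, v). g u v) \<in> borel_measurable (?PU \<Otimes>\<^sub>M ?S)"
    unfolding g_def by measurable
  have \<Phi>_eq: "\<Phi> (\<lambda>k\<in>{1..m}. stage k \<omega>) = past_weight m B \<omega>" for \<omega>
    unfolding \<Phi>_def past_weight_def by (intro prod.cong) (auto simp: snd_stage)
  have \<tau>_eq: "\<tau> (\<lambda>k\<in>{1..m}. stage k \<omega>) = t + gap (Tplus m \<omega>)" for \<omega>
    unfolding \<tau>_def Tplus_def by (intro arg_cong[where f = "\<lambda>x. t + gap x"] sum.cong) (auto simp: snd_stage)
  have "(\<integral>\<^sup>+\<omega>. past_weight m B \<omega> * (ennreal (age_weight m (holding m \<omega>) (t + gap (Tplus m \<omega>)))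
        * indicator {t + gap (Tplus m \<omega>)<..} (T (Suc m) \<omega>)) \<partial>P)
    = (\<integral>\<^sup>+\<omega>. g (\<lambda>k\<in>{1..m}. stage k \<omega>) (stage (Suc m) \<omega>) \<partial>P)"
  proof (rule nn_integral_cong_AE)
    show "AE \<omega> in P. past_weight m B \<omega> * (ennreal (age_weight m (holding m \<omega>) (t + gap (Tplus m \<omega>)))
        * indicator {t + gap (Tplus m \<omega>)<..} (T (Suc m) \<omega>)) = g (\<lambda>k\<in>{1..m}. stage k \<omega>) (stage (Suc m) \<omega>)"
      using AE_stage
      by eventually_elim (simp add: g_def \<Phi>_eq[simplified] \<tau>_eq[simplified] indicator_def)
  qed
  also have "\<dots> = (\<integral>\<^sup>+\<omega>. (\<integral>\<^sup>+\<omega>'. g (\<lambda>k\<in>{1..m}. stage k \<omega>) (stage (Suc m) \<omega>') \<partial>P) \<partial>P)"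
    by (rule nn_integral_past_next[OF g_m])
  also have "\<dots> = (\<integral>\<^sup>+\<omega>. past_weight m B \<omega> * alive_mass (lam_star m) (mu_star m) (t + gap (Tplus m \<omega>)) \<partial>P)"
  proof (intro nn_integral_cong)
    fix \<omega>
    define a where "a = t + gap (Tplus m \<omega>)"
    have a: "0 \<le> a" using t o_nonneg[of "Tplus m \<omega>"] by (simp add: a_def)
    have "(\<integral>\<^sup>+\<omega>'. g (\<lambda>k\<in>{1..m}. stage k \<omega>) (stage (Suc m) \<omega>') \<partial>P)
      = (\<integral>\<^sup>+\<omega>'. past_weight m B \<omega> * (ennreal (age_weight m (holding m \<omega>') a) * indicator {a<..} (T (Suc m) \<omega>')) \<partial>P)"
    proof (rule nn_integral_cong_AE)
      show "AE \<omega>' in P. g (\<lambda>k\<in>{1..m}. stage k \<omega>) (stage (Suc m) \<omega>')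
        = past_weight m B \<omega> * (ennreal (age_weight m (holding m \<omega>') a) * indicator {a<..} (T (Suc m) \<omega>'))"
        using AE_stage
        by eventually_elim (simp add: g_def \<Phi>_eq[simplified] \<tau>_eq[simplified] a_def indicator_def)
    qed
    also have "\<dots> = past_weight m B \<omega> * alive_mass (lam_star m) (mu_star m) a"
      by (subst nn_integral_cmult) (simp_all add: expected_age_weight[OF a])
    finally show "(\<integral>\<^sup>+\<omega>'. g (\<lambda>k\<in>{1..m}. stage k \<omega>) (stage (Suc m) \<omega>') \<partial>P)
      = past_weight m B \<omega> * alive_mass (lam_star m) (mu_star m) (t + gap (Tplus m \<omega>))"
      by (simp add: a_def)
  qed
  finally show ?thesis .
qed

lemma Z_between_switches:
  assumes "\<omega> \<in> space P" "Tplus m \<omega> \<le> t" "t < Tplus (Suc m) \<omega>"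
  shows "Z rs Rs t \<omega> = (\<Prod>k=1..m. switch_weight (k - 1) (holding (k - 1) \<omega>, T k \<omega>))
    * age_weight m (holding m \<omega>) (t - Tplus m \<omega>)"
proof -
  have "exp (\<Sum>k=1..m. lin (cstar rs Rs) (k - 1) (T k \<omega>) \<omega>)
      = (\<Prod>k=1..m. exp (lin (cstar rs Rs) (k - 1) (T k \<omega>) \<omega>))"
    by (simp add: exp_sum)
  then show ?thesis
    unfolding Z_def M_eqI[OF assms] Lin_def age_def
    by (simp add: exp_add prod.distrib switch_weight_def age_weight_def path_weight_def lin_def
        zstar_def N_eq ac_simps)
qed

end

section \<open>The filtration\<close>

context market
begin

lemma space_Filt [simp]: "space (Filt s) = space P"
  by (simp add: Filt_def)

lemma M_measurable_Filt:
  assumes "0 \<le> q" "q \<le> s"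
  shows "M q \<in> measurable (Filt s) (count_space UNIV)"
proof -
  let ?K = "borel \<Otimes>\<^sub>M count_space UNIV \<Otimes>\<^sub>M count_space UNIV \<Otimes>\<^sub>M count_space UNIV
    :: (real \<times> nat \<times> nat \<times> nat) measure"
  let ?f = "\<lambda>\<omega>. \<lambda>u\<in>{0..s}. (X u \<omega>, state u \<omega>, M u \<omega>, shocks u \<omega>)"
  have path: "?f \<in> measurable (Filt s) (\<Pi>\<^sub>M u\<in>{0..s}. ?K)"
    unfolding Filt_def by (rule measurable_vimage_algebra1) (auto simp: space_PiM space_pair_measure)
  have eval: "(\<lambda>p. p q) \<in> measurable (\<Pi>\<^sub>M u\<in>{0..s}. ?K) ?K"
    using assms by (intro measurable_component_singleton) simp
  have proj: "(\<lambda>x. fst (snd (snd x))) \<in> measurable ?K (count_space UNIV)" by measurable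
  have "fst (snd (snd (?f \<omega> q))) = M q \<omega>" for \<omega> using assms by simp
  then show ?thesis
    using measurable_compose[OF measurable_compose[OF path eval] proj] by (simp only:)
qed

lemma Tplus_le_iff:
  assumes "\<omega> \<in> space P" "0 \<le> u"
  shows "Tplus k \<omega> \<le> u \<longleftrightarrow> (\<exists>q\<in>insert u (\<rat> \<inter> {0..u}). k \<le> M q \<omega>)"
  unfolding Tplus_eq M_eq by (rule jump_time_le_iff[OF T_Suc_pos[OF assms(1)] assms(2)])

lemma Tplus_nonneg: "\<omega> \<in> space P \<Longrightarrow> 0 \<le> Tplus k \<omega>"
  unfolding Tplus_eq by (rule jump_time_nonneg[OF T_Suc_pos])

lemma Tplus_Suc: "Tplus (Suc k) \<omega> = Tplus k \<omega> + T (Suc k) \<omega>"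
  by (simp add: Tplus_def)

lemma Tplus_mono: "\<omega> \<in> space P \<Longrightarrow> j \<le> k \<Longrightarrow> Tplus j \<omega> \<le> Tplus k \<omega>"
  unfolding Tplus_eq by (rule jump_time_mono[OF T_Suc_pos])

text \<open>
  The switch counts at rational times and at \<open>u\<close> decide the event, so the \<open>k\<close>-th switch is a stopping
  time.
\<close>
lemma Tplus_le_in_Filt:
  assumes "u \<le> s"
  shows "{\<omega> \<in> space P. Tplus k \<omega> \<le> u} \<in> sets (Filt s)"
proof (cases "0 \<le> u")
  case True
  have "{\<omega> \<in> space P. Tplus k \<omega> \<le> u}
    = (\<Union>q\<in>insert u (\<rat> \<inter> {0..u}). M q -` {k..} \<inter> space (Filt s))"
    using Tplus_le_iff[OF _ True] by auto
  also have "\<dots> \<in> sets (Filt s)"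
  proof (rule sets.countable_UN'')
    show "countable (insert u (\<rat> \<inter> {0..u}))"
      by (intro countable_insert countable_Int1 countable_rat)
    show "M q -` {k..} \<inter> space (Filt s) \<in> sets (Filt s)" if "q \<in> insert u (\<rat> \<inter> {0..u})" for q
      using that True assms by (intro measurable_sets[OF M_measurable_Filt]) auto
  qed
  finally show ?thesis .
next
  case False
  have "\<not> Tplus k \<omega> \<le> u" if "\<omega> \<in> space P" for \<omega>
    using Tplus_nonneg[OF that, of k] False by linarith
  then have "{\<omega> \<in> space P. Tplus k \<omega> \<le> u} = {}" by blast
  then show ?thesis by (simp only: sets.empty_sets)
qed

lemma stopped_Tplus_measurable: "(\<lambda>\<omega>. min (Tplus k \<omega>) s) \<in> borel_measurable (Filt s)"
  unfolding borel_measurable_iff_le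
proof
  fix a
  have "{\<omega> \<in> space P. min (Tplus k \<omega>) s \<le> a} = (if s \<le> a then space P else {\<omega> \<in> space P. Tplus k \<omega> \<le> a})"
    by (auto simp: min_le_iff_disj)
  then show "{\<omega> \<in> space (Filt s). min (Tplus k \<omega>) s \<le> a} \<in> sets (Filt s)"
    using Tplus_le_in_Filt[of a s k] sets.top[of "Filt s"] by simp
qed

text \<open>
  Switching times that have occurred by time \<open>s\<close> are increments of the stopped times \<open>min (Tplus k) s\<close>,
  which are known at time \<open>s\<close>.
\<close>
lemma switch_times_event_in_Filt:
  assumes B: "\<And>k. k \<in> {1..m} \<Longrightarrow> B k \<in> sets borel" and v: "v \<le> s"
  shows "{\<omega> \<in> space P. (\<forall>k\<in>{1..m}. T k \<omega> \<in> B k) \<and> u \<le> Tplus m \<omega> \<and> Tplus m \<omega> < v \<and> s < Tplus (Suc m) \<omega>}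
    \<in> sets (Filt s)" (is "?A \<in> _")
proof -
  let ?\<tau> = "\<lambda>k \<omega>. min (Tplus k \<omega>) s"
  note stopped_Tplus_measurable[measurable]
  let ?C = "{\<omega> \<in> space (Filt s). \<forall>k\<in>{1..m}. ?\<tau> k \<omega> - ?\<tau> (k - 1) \<omega> \<in> B k}"
  have "?A = ?C \<inter> {\<omega> \<in> space (Filt s). u \<le> ?\<tau> m \<omega> \<and> ?\<tau> m \<omega> < v} \<inter> (space P - {\<omega> \<in> space P. Tplus (Suc m) \<omega> \<le> s})"
  proof -
    have "(\<forall>k\<in>{1..m}. T k \<omega> \<in> B k) \<and> u \<le> Tplus m \<omega> \<and> Tplus m \<omega> < v
      \<longleftrightarrow> (\<forall>k\<in>{1..m}. ?\<tau> k \<omega> - ?\<tau> (k - 1) \<omega> \<in> B k) \<and> u \<le> ?\<tau> m \<omega> \<and> ?\<tau> m \<omega> < v"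
      if \<omega>: "\<omega> \<in> space P" for \<omega>
    proof (cases "Tplus m \<omega> < v")
      case True
      have \<tau>: "?\<tau> k \<omega> = Tplus k \<omega>" if "k \<le> m" for k
        using Tplus_mono[OF \<omega> that] True v by simp
      have "?\<tau> k \<omega> - ?\<tau> (k - 1) \<omega> = T k \<omega>" if "k \<in> {1..m}" for k
      proof -
        have k: "k \<le> m" "k - 1 \<le> m" "Suc (k - 1) = k" using that by auto
        then have "Tplus k \<omega> = Tplus (k - 1) \<omega> + T k \<omega>" using Tplus_Suc[of "k - 1" \<omega>] by simp
        then show ?thesis unfolding \<tau>[OF k(1)] \<tau>[OF k(2)] by linarith
      qed
      then show ?thesis using \<tau>[of m] by simp
    next
      case False
      then show ?thesis using v by auto
    qed
    then show ?thesis by auto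
  qed
  moreover have "?C \<in> sets (Filt s)"
  proof (rule sets.sets_Collect_finite_All)
    fix k assume k: "k \<in> {1..m}"
    note B[OF k, measurable]
    show "{\<omega> \<in> space (Filt s). ?\<tau> k \<omega> - ?\<tau> (k - 1) \<omega> \<in> B k} \<in> sets (Filt s)" by measurable
  qed simp
  moreover have "{\<omega> \<in> space (Filt s). u \<le> ?\<tau> m \<omega> \<and> ?\<tau> m \<omega> < v} \<in> sets (Filt s)" by measurable
  moreover have "space P - {\<omega> \<in> space P. Tplus (Suc m) \<omega> \<le> s} \<in> sets (Filt s)"
    using sets.compl_sets[OF Tplus_le_in_Filt[OF order_refl, of "Suc m" s]] by simp
  ultimately show ?thesis by (simp only: sets.Int)
qed

end

section \<open>The law of the switching times under the new measure\<close>

locale changed_market = tilted_market P lam mu c e0 H T r R rs Rs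
  for P :: "'a measure"
    and lam mu c :: "nat \<Rightarrow> nat \<Rightarrow> real"
    and e0 :: nat
    and H :: "nat \<Rightarrow> nat \<Rightarrow> 'a \<Rightarrow> real"
    and T :: "nat \<Rightarrow> 'a \<Rightarrow> real"
    and r R :: "nat \<Rightarrow> nat \<Rightarrow> 'a \<Rightarrow> real"
    and rs Rs :: "nat \<Rightarrow> nat \<Rightarrow> real" +
  fixes Pstar :: "'a measure"
  assumes prob_Pstar: "prob_space Pstar" and space_Pstar [simp]: "space Pstar = space P"
    and Filt_subset_Pstar: "\<And>t. t > 0 \<Longrightarrow> sets (Filt t) \<subseteq> sets Pstar"
    and measure_Pstar: "\<And>t A. t > 0 \<Longrightarrow> A \<in> sets (Filt t) \<Longrightarrow>
      measure Pstar A = (\<integral>\<omega>. Z rs Rs t \<omega> * indicator A \<omega> \<partial>P)"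
    and Z_integrable: "\<And>t. t > 0 \<Longrightarrow> integrable P (Z rs Rs t)"
    and Filt_subalgebra: "\<And>t. t > 0 \<Longrightarrow> subalgebra P (Filt t)"
begin

sublocale star: prob_space Pstar by (rule prob_Pstar)

lemma Tplus_measurable_Pstar: "Tplus k \<in> borel_measurable Pstar"
  unfolding borel_measurable_iff_le
proof
  fix a
  have "{\<omega> \<in> space P. Tplus k \<omega> \<le> a} \<in> sets (Filt (max a 1))" by (rule Tplus_le_in_Filt) simp
  then show "{\<omega> \<in> space Pstar. Tplus k \<omega> \<le> a} \<in> sets Pstar"
    using Filt_subset_Pstar[of "max a 1"] by (auto simp: less_max_iff_disj)
qed

lemma T_measurable_Pstar [measurable]: "T (Suc k) \<in> borel_measurable Pstar"
proof -
  have "T (Suc k) = (\<lambda>\<omega>. Tplus (Suc k) \<omega> - Tplus k \<omega>)" by (simp add: Tplus_Suc)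
  then show ?thesis using Tplus_measurable_Pstar by simp
qed

lemma T_measurable_Pstar' [measurable]: "1 \<le> k \<Longrightarrow> T k \<in> borel_measurable Pstar"
  by (cases k) auto

lemma emeasure_Pstar:
  assumes t: "t > 0" and A: "A \<in> sets (Filt t)"
    and Z_nonneg: "\<And>\<omega>. \<omega> \<in> A \<Longrightarrow> 0 \<le> Z rs Rs t \<omega>"
  shows "emeasure Pstar A = (\<integral>\<^sup>+\<omega>. ennreal (Z rs Rs t \<omega>) * indicator A \<omega> \<partial>P)"
proof -
  have AP: "A \<in> sets P" using A Filt_subalgebra[OF t] by (auto simp: subalgebra_def)
  have "integrable P (\<lambda>\<omega>. Z rs Rs t \<omega> * indicator A \<omega>)"
    by (rule integrable_real_mult_indicator[OF AP Z_integrable[OF t]])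
  then have "(\<integral>\<^sup>+\<omega>. ennreal (Z rs Rs t \<omega> * indicator A \<omega>) \<partial>P) = ennreal (\<integral>\<omega>. Z rs Rs t \<omega> * indicator A \<omega> \<partial>P)"
    using Z_nonneg by (intro nn_integral_eq_integral) (auto simp: indicator_def)
  then have "emeasure Pstar A = (\<integral>\<^sup>+\<omega>. ennreal (Z rs Rs t \<omega> * indicator A \<omega>) \<partial>P)"
    by (simp add: star.emeasure_eq_measure measure_Pstar[OF t A])
  also have "\<dots> = (\<integral>\<^sup>+\<omega>. ennreal (Z rs Rs t \<omega>) * indicator A \<omega> \<partial>P)"
    by (intro nn_integral_cong) (auto simp: indicator_def)
  finally show ?thesis .
qed

text \<open>
  The distance from \<open>x\<close> to the next point of the grid \<open>d * \<int>\<close>, strictly to the right of \<open>x\<close>. Strictness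
  keeps all grid points in use positive.
\<close>
definition overshoot :: "real \<Rightarrow> real \<Rightarrow> real" where
  "overshoot d x = (of_int \<lfloor>x / d\<rfloor> + 1) * d - x"

lemma overshoot_bounds:
  assumes "0 < d"
  shows "0 < overshoot d x" "overshoot d x \<le> d"
proof -
  have "of_int \<lfloor>x / d\<rfloor> \<le> x / d" "x / d < of_int \<lfloor>x / d\<rfloor> + 1" by linarith+
  then have "of_int \<lfloor>x / d\<rfloor> * d \<le> x" "x < (of_int \<lfloor>x / d\<rfloor> + 1) * d"
    using assms by (simp_all only: pos_le_divide_eq pos_divide_less_eq)
  then show "0 < overshoot d x" "overshoot d x \<le> d"
    by (simp_all add: overshoot_def algebra_simps)
qed

lemma measurable_overshoot [measurable]: "overshoot d \<in> borel_measurable borel"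
  unfolding overshoot_def[abs_def] by measurable

text \<open>
  The discretised version of the event in \<open>joint_switch_law\<close>: the age of the last stage is counted from
  the first grid point after its beginning, so that finding it alive is known at a grid point plus \<open>t\<close>.
\<close>
definition star_event :: "nat \<Rightarrow> (nat \<Rightarrow> real set) \<Rightarrow> real \<Rightarrow> real \<Rightarrow> 'a set" where
  "star_event m B t d = {\<omega> \<in> space P. (\<forall>k\<in>{1..m}. T k \<omega> \<in> B k) \<and> t + overshoot d (Tplus m \<omega>) < T (Suc m) \<omega>}"

text \<open>
  The event is the disjoint union of its parts \<open>A j\<close> on which the \<open>m\<close>-th switch lies in the \<open>j\<close>-th grid
  interval. At the deterministic time \<open>s j\<close> exactly \<open>m\<close> switches have happened on
  \<open>A j\<close>, so there \<open>Z (s j)\<close> is a product of weights \<open>W\<close> that does not mention \<open>j\<close>.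
\<close>
lemma emeasure_star_event:
  assumes B: "\<And>k. k \<in> {1..m} \<Longrightarrow> B k \<in> sets borel" and t: "0 \<le> t" and d: "0 < d"
  shows "emeasure Pstar (star_event m B t d)
    = (\<integral>\<^sup>+\<omega>. past_weight m B \<omega> * alive_mass (lam_star m) (mu_star m) (t + overshoot d (Tplus m \<omega>)) \<partial>P)"
proof -
  define s where "s j = real (Suc j) * d + t" for j
  define A where "A j = {\<omega> \<in> space P. (\<forall>k\<in>{1..m}. T k \<omega> \<in> B k) \<and> real j * d \<le> Tplus m \<omega>
      \<and> Tplus m \<omega> < real (Suc j) * d \<and> s j < Tplus (Suc m) \<omega>}" for j
  define W where "W \<omega> = ennreal (\<Prod>k=1..m. switch_weight (k - 1) (holding (k - 1) \<omega>, T k \<omega>))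
      * ennreal (age_weight m (holding m \<omega>) (t + overshoot d (Tplus m \<omega>)))" for \<omega>
  have s: "0 < s j" for j using d t by (simp add: s_def add_pos_nonneg)
  have A_Filt: "A j \<in> sets (Filt (s j))" for j
    unfolding A_def using t by (intro switch_times_event_in_Filt B) (auto simp: s_def)
  have AP: "A j \<in> sets P" for j
    using A_Filt[of j] Filt_subalgebra[OF s[of j]] by (auto simp: subalgebra_def)
  have AS: "A j \<in> sets Pstar" for j
    using A_Filt[of j] Filt_subset_Pstar[OF s[of j]] by auto
  have [measurable]: "W \<in> borel_measurable P"
  proof -
    have "(\<lambda>\<omega>. switch_weight (k - 1) (holding (k - 1) \<omega>, T k \<omega>)) \<in> borel_measurable P" if "k \<in> {1..m}" for k
    proof -
      have [measurable]: "T k \<in> borel_measurable P" using that by (intro T_rv) simp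
      show ?thesis by measurable
    qed
    then have [measurable]: "(\<lambda>\<omega>. \<Prod>k=1..m. switch_weight (k - 1) (holding (k - 1) \<omega>, T k \<omega>)) \<in> borel_measurable P"
      by (intro borel_measurable_prod)
    show ?thesis unfolding W_def by measurable
  qed
  have floor: "\<lfloor>Tplus m \<omega> / d\<rfloor> = int j" if "\<omega> \<in> A j" for \<omega> j
  proof -
    have "real j * d \<le> Tplus m \<omega>" "Tplus m \<omega> < real (Suc j) * d" using that by (auto simp: A_def)
    then have "real j \<le> Tplus m \<omega> / d" "Tplus m \<omega> / d < real j + 1"
      using d by (simp_all add: field_simps)
    then show ?thesis by (intro floor_unique) auto
  qed
  have over: "t + overshoot d (Tplus m \<omega>) = s j - Tplus m \<omega>" if "\<omega> \<in> A j" for \<omega> j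
    using floor[OF that] by (simp add: overshoot_def s_def algebra_simps)
  have Z_W: "0 \<le> Z rs Rs (s j) \<omega> \<and> ennreal (Z rs Rs (s j) \<omega>) = W \<omega>" if "\<omega> \<in> A j" for \<omega> j
  proof -
    have \<omega>: "\<omega> \<in> space P" "Tplus m \<omega> \<le> s j" "s j < Tplus (Suc m) \<omega>"
      using that t d by (auto simp: A_def s_def)
    show ?thesis
      unfolding Z_between_switches[OF \<omega>] W_def over[OF that]
      using switch_weight_nonneg age_weight_nonneg
      by (auto simp: ennreal_mult prod_nonneg)
  qed
  have "emeasure Pstar (A j) = emeasure (density P W) (A j)" for j
  proof -
    have "emeasure Pstar (A j) = (\<integral>\<^sup>+\<omega>. ennreal (Z rs Rs (s j) \<omega>) * indicator (A j) \<omega> \<partial>P)"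
      using Z_W by (intro emeasure_Pstar s A_Filt) auto
    also have "\<dots> = (\<integral>\<^sup>+\<omega>. W \<omega> * indicator (A j) \<omega> \<partial>P)"
      using Z_W by (intro nn_integral_cong) (auto simp: indicator_def)
    finally show ?thesis using AP by (simp add: emeasure_density)
  qed
  moreover have disj: "disjoint_family A"
    unfolding disjoint_family_on_def using floor by (metis disjoint_iff of_nat_eq_iff)
  moreover have union: "(\<Union>j. A j) = star_event m B t d"
  proof (intro set_eqI iffI)
    fix \<omega> assume "\<omega> \<in> (\<Union>j. A j)"
    then obtain j where j: "\<omega> \<in> A j" by blast
    have "t + overshoot d (Tplus m \<omega>) < T (Suc m) \<omega>"
      using j over[OF j] Tplus_Suc[of m \<omega>] by (simp add: A_def)
    then show "\<omega> \<in> star_event m B t d" using j by (simp add: star_event_def A_def)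
  next
    fix \<omega> assume \<omega>: "\<omega> \<in> star_event m B t d"
    then have "0 \<le> Tplus m \<omega>" by (intro Tplus_nonneg) (simp add: star_event_def)
    define j where "j = nat \<lfloor>Tplus m \<omega> / d\<rfloor>"
    have j: "of_int \<lfloor>Tplus m \<omega> / d\<rfloor> = real j"
      using \<open>0 \<le> Tplus m \<omega>\<close> d by (simp add: j_def)
    have "overshoot d (Tplus m \<omega>) = real (Suc j) * d - Tplus m \<omega>"
      by (simp add: overshoot_def j algebra_simps)
    then have "\<omega> \<in> A j"
      using \<omega> overshoot_bounds[OF d, of "Tplus m \<omega>"] Tplus_Suc[of m \<omega>]
      by (auto simp: A_def star_event_def s_def algebra_simps)
    then show "\<omega> \<in> (\<Union>j. A j)" by blast
  qed
  moreover have "range A \<subseteq> sets Pstar" "range A \<subseteq> sets (density P W)" using AS AP by auto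
  ultimately have "emeasure Pstar (star_event m B t d) = emeasure (density P W) (star_event m B t d)"
    using suminf_emeasure[of A Pstar] suminf_emeasure[of A "density P W"] by simp
  also have "\<dots> = (\<integral>\<^sup>+\<omega>. W \<omega> * indicator (star_event m B t d) \<omega> \<partial>P)"
  proof (rule emeasure_density)
    show "star_event m B t d \<in> sets P"
      unfolding union[symmetric] using AP by (intro sets.countable_UN) auto
  qed simp
  also have "\<dots> = (\<integral>\<^sup>+\<omega>. past_weight m B \<omega> * (ennreal (age_weight m (holding m \<omega>) (t + overshoot d (Tplus m \<omega>)))
        * indicator {t + overshoot d (Tplus m \<omega>)<..} (T (Suc m) \<omega>)) \<partial>P)"
  proof (rule nn_integral_cong_AE)
    show "AE \<omega> in P. W \<omega> * indicator (star_event m B t d) \<omega>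
      = past_weight m B \<omega> * (ennreal (age_weight m (holding m \<omega>) (t + overshoot d (Tplus m \<omega>)))
        * indicator {t + overshoot d (Tplus m \<omega>)<..} (T (Suc m) \<omega>))"
      using AE_stage AE_space
    proof eventually_elim
      case (elim \<omega>)
      have "past_weight m B \<omega> = (\<Prod>k\<in>{1..m}. ennreal (switch_weight (k - 1) (holding (k - 1) \<omega>, T k \<omega>))
          * indicator (B k) (T k \<omega>))"
        unfolding past_weight_def
      proof (rule prod.cong)
        fix k assume "k \<in> {1..m}"
        then have "stage k \<omega> = (holding (k - 1) \<omega>, T k \<omega>)" using elim(1)[rule_format, of "k - 1"] by simp
        then show "ennreal (switch_weight (k - 1) (stage k \<omega>)) * indicator (B k) (T k \<omega>)
          = ennreal (switch_weight (k - 1) (holding (k - 1) \<omega>, T k \<omega>)) * indicator (B k) (T k \<omega>)" by simp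
      qed simp
      also have "\<dots> = ennreal (\<Prod>k=1..m. switch_weight (k - 1) (holding (k - 1) \<omega>, T k \<omega>))
          * (\<Prod>k\<in>{1..m}. indicator (B k) (T k \<omega>))"
        using switch_weight_nonneg by (simp add: prod.distrib prod_ennreal)
      also have "(\<Prod>k\<in>{1..m}. indicator (B k) (T k \<omega>)) = (if \<forall>k\<in>{1..m}. T k \<omega> \<in> B k then 1 else 0 :: ennreal)"
        by (auto simp: indicator_def intro!: prod.neutral)
      finally show ?case
        using elim(2) by (auto simp: W_def star_event_def indicator_def ac_simps)
    qed
  qed
  also have "\<dots> = (\<integral>\<^sup>+\<omega>. past_weight m B \<omega> * alive_mass (lam_star m) (mu_star m) (t + overshoot d (Tplus m \<omega>)) \<partial>P)"
    using overshoot_bounds(1)[OF d] by (intro nn_integral_past_age B t) (auto intro: less_imp_le)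
  finally show ?thesis .
qed

lemma past_weight_measurable:
  assumes B: "\<And>k. k \<in> {1..m} \<Longrightarrow> B k \<in> sets borel"
  shows "past_weight m B \<in> borel_measurable P"
  unfolding past_weight_def[abs_def]
proof (rule borel_measurable_prod_ennreal)
  fix k assume k: "k \<in> {1..m}"
  then have [measurable]: "stage k \<in> measurable P (seq_space \<Otimes>\<^sub>M borel)" "T k \<in> borel_measurable P"
    using T_rv by auto
  note B[OF k, measurable]
  show "(\<lambda>\<omega>. ennreal (switch_weight (k - 1) (stage k \<omega>)) * indicator (B k) (T k \<omega>)) \<in> borel_measurable P"
    by measurable
qed

text \<open>
  The limit of \<open>emeasure_star_event\<close> along meshes tending to \<open>0\<close>. On the left the events converge, since
  the overshoots are positive and tend to \<open>0\<close>; on the right \<open>alive_mass\<close> is right-continuous and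
  bounded by \<open>1\<close>.
\<close>
lemma joint_switch_law:
  assumes B: "\<And>k. k \<in> {1..m} \<Longrightarrow> B k \<in> sets borel" and t: "0 \<le> t"
  shows "emeasure Pstar {\<omega> \<in> space P. (\<forall>k\<in>{1..m}. T k \<omega> \<in> B k) \<and> t < T (Suc m) \<omega>}
    = (\<Prod>k\<in>{1..m}. emeasure (switch_law (k - 1)) (B k)) * alive_mass (lam_star m) (mu_star m) t"
proof -
  define d where "d i = inverse (real (Suc i))" for i
  have d: "0 < d i" for i by (simp add: d_def)
  have d0: "d \<longlonglongrightarrow> 0" unfolding d_def by (rule LIMSEQ_inverse_real_of_nat)
  have over: "(\<lambda>i. overshoot (d i) x) \<longlonglongrightarrow> 0" for x
    using overshoot_bounds[OF d] by (intro tendsto_sandwich[OF _ _ tendsto_const d0]) (auto intro!: always_eventually less_imp_le)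
  let ?E = "{\<omega> \<in> space P. (\<forall>k\<in>{1..m}. T k \<omega> \<in> B k) \<and> t < T (Suc m) \<omega>}"
  let ?G = "alive_mass (lam_star m) (mu_star m)"
  have past_set: "{\<omega> \<in> space Pstar. \<forall>k\<in>{1..m}. T k \<omega> \<in> B k} \<in> sets Pstar"
  proof (rule sets.sets_Collect_finite_All)
    fix k assume k: "k \<in> {1..m}"
    then have [measurable]: "T k \<in> borel_measurable Pstar" by simp
    note B[OF k, measurable]
    show "{\<omega> \<in> space Pstar. T k \<omega> \<in> B k} \<in> sets Pstar" by measurable
  qed simp
  note Tplus_measurable_Pstar[measurable]
  have "{\<omega> \<in> space Pstar. t < T (Suc m) \<omega>} \<in> sets Pstar" by measurable
  from sets.Int[OF past_set this] have E: "?E \<in> sets Pstar"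
    by (rule back_subst[where P = "\<lambda>A. A \<in> sets Pstar"]) auto
  have "{\<omega> \<in> space Pstar. t + overshoot (d i) (Tplus m \<omega>) < T (Suc m) \<omega>} \<in> sets Pstar" for i by measurable
  from sets.Int[OF past_set this] have Ei: "star_event m B t (d i) \<in> sets Pstar" for i
    unfolding star_event_def by (rule back_subst[where P = "\<lambda>A. A \<in> sets Pstar"]) auto
  have "(\<lambda>i. \<integral>\<^sup>+\<omega>. indicator (star_event m B t (d i)) \<omega> \<partial>Pstar) \<longlonglongrightarrow> (\<integral>\<^sup>+\<omega>. indicator ?E \<omega> \<partial>Pstar)"
  proof (rule nn_integral_dominated_convergence[where w = "\<lambda>_. 1"])
    show "AE \<omega> in Pstar. (\<lambda>i. indicator (star_event m B t (d i)) \<omega> :: ennreal) \<longlonglongrightarrow> indicator ?E \<omega>"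
    proof (rule AE_I2)
      fix \<omega>
      have "\<forall>\<^sub>F i in sequentially. (indicator (star_event m B t (d i)) \<omega> :: ennreal) = indicator ?E \<omega>"
      proof (cases "t < T (Suc m) \<omega>")
        case True
        then have "\<forall>\<^sub>F i in sequentially. overshoot (d i) (Tplus m \<omega>) < T (Suc m) \<omega> - t"
          by (intro order_tendstoD[OF over]) simp
        then show ?thesis
          by eventually_elim (use True in \<open>simp add: star_event_def indicator_def algebra_simps\<close>)
      next
        case False
        then have "\<not> t + overshoot (d i) (Tplus m \<omega>) < T (Suc m) \<omega>" for i
          using overshoot_bounds(1)[OF d, of i "Tplus m \<omega>"] by linarith
        then show ?thesis using False by (simp add: star_event_def indicator_def)
      qed
      then show "(\<lambda>i. indicator (star_event m B t (d i)) \<omega> :: ennreal) \<longlonglongrightarrow> indicator ?E \<omega>"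
        by (rule tendsto_eventually)
    qed
    show "(\<integral>\<^sup>+\<omega>. 1 \<partial>Pstar) < \<infinity>" using star.emeasure_space_1 by simp
    show "(\<lambda>\<omega>. indicator (star_event m B t (d i)) \<omega> :: ennreal) \<in> borel_measurable Pstar" for i
      by (rule borel_measurable_indicator[OF Ei])
    show "(\<lambda>\<omega>. indicator ?E \<omega> :: ennreal) \<in> borel_measurable Pstar"
      by (rule borel_measurable_indicator[OF E])
  qed (simp_all add: indicator_def)
  then have L: "(\<lambda>i. emeasure Pstar (star_event m B t (d i))) \<longlonglongrightarrow> emeasure Pstar ?E"
    by (simp only: nn_integral_indicator[OF Ei] nn_integral_indicator[OF E])
  note past_weight_measurable[OF B, measurable]
  note alive_mass_measurable[OF lam_star_pos, measurable]
  have "(\<lambda>i. \<integral>\<^sup>+\<omega>. past_weight m B \<omega> * ?G (t + overshoot (d i) (Tplus m \<omega>)) \<partial>P)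
    \<longlonglongrightarrow> (\<integral>\<^sup>+\<omega>. past_weight m B \<omega> * ?G t \<partial>P)"
  proof (rule nn_integral_dominated_convergence[where w = "past_weight m B"])
    have "(\<integral>\<^sup>+\<omega>. past_weight m B \<omega> \<partial>P) = (\<Prod>k\<in>{1..m}. emeasure (switch_law (k - 1)) (B k))"
      by (rule nn_integral_past_weight[OF B])
    also have "\<dots> \<le> (\<Prod>k\<in>{1..m}. 1)" by (intro prod_mono_ennreal switch_law_le_1)
    also have "\<dots> < \<infinity>" by simp
    finally show fin: "(\<integral>\<^sup>+\<omega>. past_weight m B \<omega> \<partial>P) < \<infinity>" .
    show "AE \<omega> in P. past_weight m B \<omega> * ?G (t + overshoot (d i) (Tplus m \<omega>)) \<le> past_weight m B \<omega>" for i
    proof (rule AE_I2)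
      fix \<omega>
      have "?G (t + overshoot (d i) (Tplus m \<omega>)) \<le> 1"
        using t overshoot_bounds(1)[OF d, of i "Tplus m \<omega>"] by (intro alive_mass_star_le_1) simp
      from mult_left_mono[OF this, of "past_weight m B \<omega>"]
      show "past_weight m B \<omega> * ?G (t + overshoot (d i) (Tplus m \<omega>)) \<le> past_weight m B \<omega>" by simp
    qed
    have "AE \<omega> in P. past_weight m B \<omega> \<noteq> \<infinity>"
      using fin by (intro nn_integral_PInf_AE) auto
    then show "AE \<omega> in P. (\<lambda>i. past_weight m B \<omega> * ?G (t + overshoot (d i) (Tplus m \<omega>))) \<longlonglongrightarrow> past_weight m B \<omega> * ?G t"
    proof eventually_elim
      case (elim \<omega>)
      have "(\<lambda>i. ?G (t + overshoot (d i) (Tplus m \<omega>))) \<longlonglongrightarrow> ?G t"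
        using lam_star_pos mu_star_pos overshoot_bounds(1)[OF d]
        by (intro alive_mass_right_continuous t over) (auto simp: less_imp_le)
      then show ?case using elim by (intro ennreal_tendsto_cmult) (auto simp: less_top)
    qed
  qed measurable
  moreover have "emeasure Pstar (star_event m B t (d i))
      = (\<integral>\<^sup>+\<omega>. past_weight m B \<omega> * ?G (t + overshoot (d i) (Tplus m \<omega>)) \<partial>P)" for i
    by (rule emeasure_star_event[OF B t d])
  ultimately have "(\<lambda>i. emeasure Pstar (star_event m B t (d i))) \<longlonglongrightarrow> (\<integral>\<^sup>+\<omega>. past_weight m B \<omega> * ?G t \<partial>P)"
    by (simp only:)
  then have "emeasure Pstar ?E = (\<integral>\<^sup>+\<omega>. past_weight m B \<omega> * ?G t \<partial>P)"
    by (rule LIMSEQ_unique[OF L])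
  also have "\<dots> = (\<integral>\<^sup>+\<omega>. past_weight m B \<omega> \<partial>P) * ?G t"
    by (rule nn_integral_multc) measurable
  also have "(\<integral>\<^sup>+\<omega>. past_weight m B \<omega> \<partial>P) = (\<Prod>k\<in>{1..m}. emeasure (switch_law (k - 1)) (B k))"
    by (rule nn_integral_past_weight[OF B])
  finally show ?thesis .
qed

lemma T_pos': "\<omega> \<in> space P \<Longrightarrow> 0 < T (Suc m) \<omega>"
  by (rule T_pos) simp_all

lemma joint_switch_law':
  assumes B: "\<And>k. k \<in> {1..m} \<Longrightarrow> B k \<in> sets borel"
  shows "emeasure Pstar {\<omega> \<in> space P. \<forall>k\<in>{1..m}. T k \<omega> \<in> B k}
    = (\<Prod>k\<in>{1..m}. emeasure (switch_law (k - 1)) (B k))"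
proof -
  have "{\<omega> \<in> space P. \<forall>k\<in>{1..m}. T k \<omega> \<in> B k}
    = {\<omega> \<in> space P. (\<forall>k\<in>{1..m}. T k \<omega> \<in> B k) \<and> 0 < T (Suc m) \<omega>}"
    using T_pos' by blast
  then show ?thesis
    using joint_switch_law[OF B order_refl] by (simp add: alive_mass_0[OF lam_star_pos])
qed

text \<open>
  The products of the first \<open>m\<close> and of the first \<open>m + 1\<close> total masses are both the total mass of a
  probability measure.
\<close>
lemma switch_law_UNIV: "emeasure (switch_law m) UNIV = 1"
proof -
  have one: "(\<Prod>k\<in>{1..m}. emeasure (switch_law (k - 1)) UNIV) = 1" for m
    using joint_switch_law'[of m "\<lambda>_. UNIV"] star.emeasure_space_1 by simp
  have "{1..Suc m} = insert (Suc m) {1..m}" by auto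
  then have "(\<Prod>k\<in>{1..Suc m}. emeasure (switch_law (k - 1)) UNIV)
    = emeasure (switch_law m) UNIV * (\<Prod>k\<in>{1..m}. emeasure (switch_law (k - 1)) UNIV)"
    by (simp only:) simp
  then show ?thesis unfolding one by simp
qed

lemma switch_law_restrict:
  assumes J: "finite J" "J \<subseteq> {1..}" and B: "\<And>k. k \<in> J \<Longrightarrow> B k \<in> sets borel"
  shows "emeasure Pstar {\<omega> \<in> space P. \<forall>k\<in>J. T k \<omega> \<in> B k} = (\<Prod>k\<in>J. emeasure (switch_law (k - 1)) (B k))"
proof -
  obtain m where m: "J \<subseteq> {1..m}"
    using J finite_nat_set_iff_bounded_le by (metis atLeastAtMost_iff atLeast_iff subset_iff)
  define B' where "B' k = (if k \<in> J then B k else UNIV)" for k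
  have "{\<omega> \<in> space P. \<forall>k\<in>J. T k \<omega> \<in> B k} = {\<omega> \<in> space P. \<forall>k\<in>{1..m}. T k \<omega> \<in> B' k}"
    using m by (auto simp: B'_def)
  then have "emeasure Pstar {\<omega> \<in> space P. \<forall>k\<in>J. T k \<omega> \<in> B k}
    = (\<Prod>k\<in>{1..m}. emeasure (switch_law (k - 1)) (B' k))"
    using B by (simp only:) (intro joint_switch_law', simp add: B'_def)
  also have "\<dots> = (\<Prod>k\<in>J. emeasure (switch_law (k - 1)) (B' k))"
    using m by (intro prod.mono_neutral_right) (auto simp: B'_def switch_law_UNIV)
  also have "\<dots> = (\<Prod>k\<in>J. emeasure (switch_law (k - 1)) (B k))"
    by (intro prod.cong) (simp_all add: B'_def)
  finally show ?thesis .
qed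

lemma T_law:
  assumes "B \<in> sets borel"
  shows "emeasure Pstar {\<omega> \<in> space P. T (Suc m) \<omega> \<in> B} = emeasure (switch_law m) B"
  using switch_law_restrict[of "{Suc m}" "\<lambda>_. B"] assms by simp

lemma T_tail:
  assumes "0 \<le> t"
  shows "emeasure Pstar {\<omega> \<in> space P. t < T (Suc m) \<omega>} = alive_mass (lam_star m) (mu_star m) t"
proof -
  have "(\<Prod>k\<in>{1..m}. emeasure (switch_law (k - 1)) UNIV) = 1" by (simp add: switch_law_UNIV)
  then show ?thesis using joint_switch_law[of m "\<lambda>_. UNIV" t] assms by simp
qed

text \<open>
  The two masses are the probabilities of complementary events. This is where unkilled explosion under
  the new parameters is excluded.
\<close>
lemma mass_star_eq_1:
  assumes t: "0 \<le> t"
  shows "alive_mass (lam_star m) (mu_star m) t + killed_mass (lam_star m) (mu_star m) t = 1"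
proof -
  have 1: "{\<omega> \<in> space Pstar. t < T (Suc m) \<omega>} \<in> sets Pstar" by measurable
  have 2: "{\<omega> \<in> space Pstar. T (Suc m) \<omega> \<in> {..t}} \<in> sets Pstar" by measurable
  have "alive_mass (lam_star m) (mu_star m) t + killed_mass (lam_star m) (mu_star m) t
    = emeasure Pstar {\<omega> \<in> space Pstar. t < T (Suc m) \<omega>} + emeasure Pstar {\<omega> \<in> space Pstar. T (Suc m) \<omega> \<in> {..t}}"
    using T_tail[OF t, of m] T_law[of "{..t}" m] switch_law_atMost[OF t, of m] by simp
  also have "\<dots> = emeasure Pstar ({\<omega> \<in> space Pstar. t < T (Suc m) \<omega>} \<union> {\<omega> \<in> space Pstar. T (Suc m) \<omega> \<in> {..t}})"
    using 1 2 by (intro plus_emeasure) auto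
  also have "{\<omega> \<in> space Pstar. t < T (Suc m) \<omega>} \<union> {\<omega> \<in> space Pstar. T (Suc m) \<omega> \<in> {..t}} = space Pstar"
    by auto
  finally show ?thesis using star.emeasure_space_1 by simp
qed

lemma T_has_poexp: "has_poexp Pstar (T (Suc m)) (lam_star m) (mu_star m)"
  unfolding has_poexp_def
proof (intro conjI allI impI ballI)
  show "T (Suc m) \<in> borel_measurable Pstar" by simp
  show "0 < T (Suc m) \<omega>" if "\<omega> \<in> space Pstar" for \<omega> using that T_pos' by simp
  fix t :: real assume t: "0 \<le> t"
  have "(\<integral>\<^sup>+h. ennreal (survival (mu_star m) h t) \<partial>exp_holding (lam_star m)) = alive_mass (lam_star m) (mu_star m) t"
    using mu_star_pos by (intro expected_survival lam_star_pos t mass_star_eq_1) (simp add: less_imp_le)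
  also have "\<dots> = emeasure Pstar {\<omega> \<in> space Pstar. t < T (Suc m) \<omega>}"
    using T_tail[OF t, of m] by simp
  finally have "measure Pstar {\<omega> \<in> space Pstar. t < T (Suc m) \<omega>}
    = enn2real (\<integral>\<^sup>+h. ennreal (survival (mu_star m) h t) \<partial>exp_holding (lam_star m))"
    by (simp add: measure_def)
  also have "\<dots> = (\<integral>h. survival (mu_star m) h t \<partial>exp_holding (lam_star m))"
    by (intro integral_eq_nn_integral[symmetric]) (auto simp: survival_bounds)
  finally show "measure Pstar {\<omega> \<in> space Pstar. t < T (Suc m) \<omega>} =
      (\<integral>h. exp_minus (\<integral>\<^sup>+s\<in>{0..t}. ennreal (mu_star m (counting h s)) \<partial>lborel)
        \<partial>(\<Pi>\<^sub>M n\<in>UNIV. density lborel (exponential_density (lam_star m n))))"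
    by (simp add: survival_def exp_holding_def)
qed

lemma T_indep: "star.indep_vars (\<lambda>_. borel) T {1..}"
  unfolding star.indep_vars_def2 star.indep_sets_def
proof (intro conjI ballI allI impI)
  show "T k \<in> borel_measurable Pstar" if "k \<in> {1..}" for k using that by simp
  show "{T k -` A \<inter> space Pstar | A. A \<in> sets borel} \<subseteq> sets Pstar" if "k \<in> {1..}" for k
  proof -
    have "T k \<in> borel_measurable Pstar" using that by simp
    then show ?thesis using measurable_sets by blast
  qed
  fix J A assume J: "J \<subseteq> {1..}" "J \<noteq> {}" "finite J"
    and A: "A \<in> (\<Pi> k\<in>J. {T k -` A \<inter> space Pstar | A. A \<in> sets borel})"
  have "\<forall>k\<in>J. \<exists>B. B \<in> sets borel \<and> A k = T k -` B \<inter> space P"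
    using A by (auto simp: Pi_iff)
  then obtain B where B: "\<And>k. k \<in> J \<Longrightarrow> B k \<in> sets borel \<and> A k = T k -` B k \<inter> space P"
    by metis
  have single: "emeasure Pstar (A k) = emeasure (switch_law (k - 1)) (B k)" if "k \<in> J" for k
  proof -
    have "A k = {\<omega> \<in> space P. \<forall>i\<in>{k}. T i \<omega> \<in> B i}" using B[OF that] by auto
    then show ?thesis using switch_law_restrict[of "{k}" B] B[OF that] that J(1) by auto
  qed
  have "(\<Inter>k\<in>J. A k) = {\<omega> \<in> space P. \<forall>k\<in>J. T k \<omega> \<in> B k}"
  proof -
    have "(\<Inter>k\<in>J. A k) = (\<Inter>k\<in>J. T k -` B k \<inter> space P)"
      using B by (intro INF_cong) auto
    also have "\<dots> = {\<omega> \<in> space P. \<forall>k\<in>J. T k \<omega> \<in> B k}" using J(2) by auto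
    finally show ?thesis .
  qed
  also have "emeasure Pstar \<dots> = (\<Prod>k\<in>J. emeasure (switch_law (k - 1)) (B k))"
    using B by (intro switch_law_restrict J) blast
  also have "\<dots> = (\<Prod>k\<in>J. emeasure Pstar (A k))"
    using single by (intro prod.cong) auto
  finally have "emeasure Pstar (\<Inter>k\<in>J. A k) = (\<Prod>k\<in>J. emeasure Pstar (A k))" .
  then show "measure Pstar (\<Inter>k\<in>J. A k) = (\<Prod>k\<in>J. measure Pstar (A k))"
    by (simp add: star.emeasure_eq_measure prod_ennreal prod_nonneg)
qed

lemma state_eq:
  "\<forall>\<omega>\<in>space Pstar. \<forall>m t. Tplus m \<omega> \<le> t \<and> t < Tplus (Suc m) \<omega> \<longrightarrow> state t \<omega> = eps m"
  by (auto simp: state_def M_eqI)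

end


theorem theorem5p1:
  fixes P Pstar :: "'a measure"
    and lam mu c rs Rs :: "nat \<Rightarrow> nat \<Rightarrow> real"
    and e0 :: nat
    and H :: "nat \<Rightarrow> nat \<Rightarrow> 'a \<Rightarrow> real"
    and T :: "nat \<Rightarrow> 'a \<Rightarrow> real"
    and r R :: "nat \<Rightarrow> nat \<Rightarrow> 'a \<Rightarrow> real"
  defines "eps \<equiv> market_paths.eps e0"
    and "Tplus \<equiv> market_paths.Tplus T"
    and "state \<equiv> market_paths.state e0 T"
    and "F \<equiv> market_paths.Filt P c e0 H T r R"
    and "Z \<equiv> market_paths.Z lam mu e0 H T rs Rs"
  assumes market: "market P lam mu e0 H T r R"
    and rs: "\<And>i n. i \<in> {0, 1} \<Longrightarrow> rs i n > -1"
    and Rs: "\<And>i n. i \<in> {0, 1} \<Longrightarrow> Rs i n > -1"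
    and martingale: "is_martingale P F Z"
    and mean: "\<And>t. t \<ge> 0 \<Longrightarrow> prob_space.expectation P (Z t) = 1"
    and Pstar: "prob_space Pstar" "space Pstar = space P"
    and Pstar_F: "\<And>t. t > 0 \<Longrightarrow> sets (F t) \<subseteq> sets Pstar"
    and Pstar_def: "\<And>t A. t > 0 \<Longrightarrow> A \<in> sets (F t) \<Longrightarrow>
      measure Pstar A = prob_space.expectation P (\<lambda>\<omega>. Z t \<omega> * indicator A \<omega>)"
  shows "(\<forall>\<omega>\<in>space Pstar. \<forall>m t. Tplus m \<omega> \<le> t \<and> t < Tplus (Suc m) \<omega> \<longrightarrow> state t \<omega> = eps m)
    \<and> prob_space.indep_vars Pstar (\<lambda>_. borel) T {1..}
    \<and> (\<forall>m\<ge>1. has_poexp Pstar (T m)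
         (\<lambda>n. lam (eps (m - 1)) n * (1 + rs (eps (m - 1)) n))
         (\<lambda>n. mu (eps (m - 1)) n * (1 + Rs (eps (m - 1)) n)))"
proof -
  \<comment> \<open>the names are shadowed by the interpretation that follows\<close>
  note local_defs = eps_def Tplus_def state_def F_def Z_def
  interpret market P lam mu c e0 H T r R by (rule market)
  interpret changed_market P lam mu c e0 H T r R rs Rs Pstar
  proof (intro changed_market.intro tilted_market.intro tilted_market_axioms.intro
      changed_market_axioms.intro market)
    show "- 1 < rs i n" if "i \<in> {0, 1}" for i n by (rule rs[OF that])
    show "- 1 < Rs i n" if "i \<in> {0, 1}" for i n by (rule Rs[OF that])
    show "prob_space Pstar" "space Pstar = space P" by (fact Pstar)+
    show "sets (Filt t) \<subseteq> sets Pstar" if "t > 0" for t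
      using Pstar_F[OF that] unfolding local_defs .
    show "measure Pstar A = (\<integral>\<omega>. market_paths.Z lam mu e0 H T rs Rs t \<omega> * indicator A \<omega> \<partial>P)"
      if "t > 0" "A \<in> sets (Filt t)" for t A
      using Pstar_def[of t A] that unfolding local_defs by blast
    show "integrable P (market_paths.Z lam mu e0 H T rs Rs t)" "subalgebra P (Filt t)" if "t > 0" for t
      using martingale that unfolding is_martingale_def local_defs by (blast dest: less_imp_le)+
  qed
  have "has_poexp Pstar (T m)
         (\<lambda>n. lam (eps (m - 1)) n * (1 + rs (eps (m - 1)) n))
         (\<lambda>n. mu (eps (m - 1)) n * (1 + Rs (eps (m - 1)) n))" if "1 \<le> m" for m
    using T_has_poexp[of "m - 1"] that unfolding local_defs by simp
  then show ?thesis
    using state_eq T_indep unfolding local_defs by blast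
qed

end
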